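(* Let $p$ be a prime, let $(\mathcal{L},\Delta,S)$ be a punctured group (a locality at the prime $p$ whose object set $\Delta$ is the set of all nonidentity subgroups of $S$), and suppose $\theta$ is a signalizer functor of $(\mathcal{L},\Delta,S)$ on elements of order $p$. Then $$\widehat{\Theta}:=\bigcup_{x\in\mathcal{I}_p(S)}\theta(x)$$ is a partial normal subgroup of $\mathcal{L}$ with $\widehat\Theta\cap S=1$. In particular, the canonical projection $\rho\colon\mathcal{L}\to\mathcal{L}/\widehat\Theta$ restricts to an isomorphism $S\to S^\rho$. Upon identifying $S$ with $S^\rho$, the following hold: (a) $(\mathcal{L}/\widehat\Theta,\Delta,S)$ is a locality and $\mathcal{F}_S(\mathcal{L}/\widehat\Theta)=\mathcal{F}_S(\mathcal{L})$. (b) For each $P\in\Delta$, the projection $\rho$ restricts to an epimorphism $N_{\mathcal{L}}(P)\to N_{\mathcal{L}/\widehat\Theta}(P)$ with kernel $\Theta(P):=\bigl(\bigcap_{x\in\mathcal{I}_p(P)}\theta(x)\bigr)\cap C_{\mathcal{L}}(P)$, and thus induces an isomorphism $N_{\mathcal{L}}(P)/\Theta(P)\cong N_{\mathcal{L}/\widehat\Theta}(P)$.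
   Context: Partial groups. For a set $\mathcal{L}$, $\mathbf{W}(\mathcal{L})$ is the set of words in $\mathcal{L}$, $\circ$ is concatenation, $\varnothing$ the empty word. A partial group is a nonempty set $\mathcal{L}$ with a subset $\mathbf{D}\subseteq\mathbf{W}(\mathcal{L})$, a map $\Pi\colon\mathbf{D}\to\mathcal{L}$ and an involutory bijection $(-)^{-1}$ on $\mathcal{L}$, extended to words by $(g_1,\dots,g_k)^{-1}=(g_k^{-1},\dots,g_1^{-1})$, such that: $\mathcal{L}\subseteq\mathbf{D}$ (words of length 1), and $u\circ v\in\mathbf{D}\Rightarrow u,v\in\mathbf{D}$; $\Pi$ is the identity on $\mathcal{L}$; $u\circ v\circ w\in\mathbf{D}$ implies $u\circ(\Pi(v))\circ w\in\mathbf{D}$ and $\Pi(u\circ v\circ w)=\Pi(u\circ(\Pi(v))\circ w)$; $w\in\mathbf{D}$ implies $w^{-1}\circ w\in\mathbf{D}$ and $\Pi(w^{-1}\circ w)=\mathbf{1}:=\Pi(\varnothing)$. For $g\in\mathcal{L}$, $\mathbf{D}(g)=\{x\in\mathcal{L}:(g^{-1},x,g)\in\mathbf{D}\}$ and $x^g=\Pi(g^{-1},x,g)$ for $x\in\mathbf{D}(g)$; writing $x^g$ or $\mathcal{H}^g$ implies $x\in\mathbf{D}(g)$, resp. $\mathcal{H}\subseteq\mathbf{D}(g)$. $N_{\mathcal{L}}(\mathcal{H})=\{g:\mathcal{H}\subseteq\mathbf{D}(g),\mathcal{H}^g=\mathcal{H}\}$, $C_{\mathcal{L}}(\mathcal{H})=\{g:\mathcal{H}\subseteq\mathbf{D}(g),h^g=h\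 \forall h\in\mathcal{H}\}$. A partial subgroup is a nonempty subset $\mathcal{H}$ closed under inversion and with $\Pi(w)\in\mathcal{H}$ for $w\in\mathbf{D}\cap\mathbf{W}(\mathcal{H})$; it is a subgroup if $\mathbf{W}(\mathcal{H})\subseteq\mathbf{D}$ (then it is a group). A partial normal subgroup is a partial subgroup $\mathcal{N}$ with $n^g\in\mathcal{N}$ whenever $n\in\mathcal{N}$, $g\in\mathcal{L}$, $n\in\mathbf{D}(g)$. Localities. $(\mathcal{L},\Delta,S)$ is a locality (at the prime $p$) if $\mathcal{L}$ is a finite partial group, $S$ is a $p$-subgroup of $\mathcal{L}$, $\Delta$ is a nonempty set of subgroups of $S$, and: (L1) $S$ is maximal among $p$-subgroups of $\mathcal{L}$; (L2) a word $(f_1,\dots,f_n)$ is in $\mathbf{D}$ iff there are $P_0,\dots,P_n\in\Delta$ with $P_{i-1}\subseteq\mathbf{D}(f_i)$ and $P_{i-1}^{f_i}=P_i$ for all $i$; (L3) $\Delta$ is closed under overgroups in $S$, and $P^g\in\Delta$ whenever $P\in\Delta$, $g\in\mathcal{L}$, $P\subseteq\mathbf{D}(g)$, $P^g\leq S$. For $P\in\Delta$, $N_{\mathcal{L}}(P)$ is a subgroup of $\mathcal{L}$. $\mathcal{F}_S(\mathcal{L})$ is the fusion system over $S$ generated by the conjugation maps $c_g\colon P\to P^g$, with $P\in\Delta$, $g\in\mathcal{L}$, $P^g\leq S$. Quotients. For $\mathcal{N}$ partial normal in $\mathcal{L}$, the cosets are $\mathcal{N}f=\{\Pi(n,f):n\in\mathcal{N},(n,f)\in\mathbf{D}\}$;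 the inclusion-maximal cosets partition $\mathcal{L}$, and $\mathcal{L}/\mathcal{N}$ is the set of maximal cosets. The canonical projection $\rho$ sends $f$ to the maximal coset containing it; $\mathcal{L}/\mathcal{N}$ has the unique partial group structure with domain $\{w^\rho:w\in\mathbf{D}\}$ and $\Pi(w)^\rho=\overline\Pi(w^\rho)$. Signalizer functors. For $P\leq S$, $\mathcal{I}_p(P)$ is the set of elements of $P$ of order $p$. For $a \in \mathcal{I}_p(S)$, $C_{\mathcal{L}}(a)$ is a subgroup of $\mathcal{L}$ since $\langle a\rangle\in\Delta$. A signalizer functor of $(\mathcal{L},\Delta,S)$ on elements of order $p$ is a map $\theta$ assigning to each $a\in\mathcal{I}_p(S)$ a normal $p'$-subgroup $\theta(a)$ of $C_{\mathcal{L}}(a)$ such that: (conjugacy) $\theta(a^g)=\theta(a)^g$ for all $g\in\mathcal{L}$ and $a\in\mathcal{I}_p(S)$ such that $a^g$ is defined and in $S$; (balance) $\theta(a)\cap C_{\mathcal{L}}(b)\leq\theta(b)$ for all $a,b\in\mathcal{I}_p(S)$ with $[a,b]=1$. *)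

theory Defs
  imports "HOL-Algebra.Multiplicative_Group" "HOL-Computational_Algebra.Primes"
begin

section \<open>Partial groups\<close>

record 'a pgroup = "'a partial_object" +
  pdom :: "'a list set"
  pprod :: "'a list \<Rightarrow> 'a"
  pinv :: "'a \<Rightarrow> 'a"

definition pone :: "'a pgroup \<Rightarrow> 'a" where
  "pone L = pprod L []"

definition word_inv :: "'a pgroup \<Rightarrow> 'a list \<Rightarrow> 'a list" where
  "word_inv L w = rev (map (pinv L) w)"

locale partial_group =
  fixes L :: "'a pgroup"
  assumes nonempty: "carrier L \<noteq> {}"
    and dom_words: "pdom L \<subseteq> lists (carrier L)"
    and prod_closed: "w \<in> pdom L \<Longrightarrow> pprod L w \<in> carrier L"
    and inv_closed: "x \<in> carrier L \<Longrightarrow> pinv L x \<in> carrier L"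
    and inv_inv: "x \<in> carrier L \<Longrightarrow> pinv L (pinv L x) = x"
    and dom_single: "x \<in> carrier L \<Longrightarrow> [x] \<in> pdom L"
    and dom_append: "u @ v \<in> pdom L \<Longrightarrow> u \<in> pdom L \<and> v \<in> pdom L"
    and prod_single: "x \<in> carrier L \<Longrightarrow> pprod L [x] = x"
    and prod_assoc: "u @ v @ w \<in> pdom L \<Longrightarrow>
          u @ [pprod L v] @ w \<in> pdom L \<and>
          pprod L (u @ v @ w) = pprod L (u @ [pprod L v] @ w)"
    and prod_word_inv: "w \<in> pdom L \<Longrightarrow>
          word_inv L w @ w \<in> pdom L \<and> pprod L (word_inv L w @ w) = pone L"

definition conj_dom :: "'a pgroup \<Rightarrow> 'a \<Rightarrow> 'a set" where
  "conj_dom L g = {x \<in> carrier L. [pinv L g, x, g] \<in> pdom L}"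

text \<open>Meaningful only for \<open>x \<in> conj_dom L g\<close>; this side condition is always stated
  explicitly where conjugates occur.\<close>

definition pconj :: "'a pgroup \<Rightarrow> 'a \<Rightarrow> 'a \<Rightarrow> 'a" where
  "pconj L x g = pprod L [pinv L g, x, g]"

definition pconj_set :: "'a pgroup \<Rightarrow> 'a set \<Rightarrow> 'a \<Rightarrow> 'a set" where
  "pconj_set L H g = (\<lambda>x. pconj L x g) ` H"

definition pnormalizer :: "'a pgroup \<Rightarrow> 'a set \<Rightarrow> 'a set" where
  "pnormalizer L H = {g \<in> carrier L. H \<subseteq> conj_dom L g \<and> pconj_set L H g = H}"

definition pcentralizer :: "'a pgroup \<Rightarrow> 'a set \<Rightarrow> 'a set" where
  "pcentralizer L H = {g \<in> carrier L. H \<subseteq> conj_dom L g \<and> (\<forall>h\<in>H. pconj L h g = h)}"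

definition partial_subgroup :: "'a pgroup \<Rightarrow> 'a set \<Rightarrow> bool" where
  "partial_subgroup L H \<longleftrightarrow>
     H \<noteq> {} \<and> H \<subseteq> carrier L \<and> (\<forall>h\<in>H. pinv L h \<in> H) \<and>
     (\<forall>w \<in> pdom L \<inter> lists H. pprod L w \<in> H)"

definition psubgroup :: "'a pgroup \<Rightarrow> 'a set \<Rightarrow> bool" where
  "psubgroup L H \<longleftrightarrow> partial_subgroup L H \<and> lists H \<subseteq> pdom L"

definition partial_normal :: "'a pgroup \<Rightarrow> 'a set \<Rightarrow> bool" where
  "partial_normal L N \<longleftrightarrow>
     partial_subgroup L N \<and>
     (\<forall>n\<in>N. \<forall>g\<in>carrier L. n \<in> conj_dom L g \<longrightarrow> pconj L n g \<in> N)"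

text \<open>The group structure on a subgroup, as a structure of HOL-Algebra.\<close>

definition grp :: "'a pgroup \<Rightarrow> 'a set \<Rightarrow> 'a monoid" where
  "grp L H = \<lparr>carrier = H, monoid.mult = (\<lambda>x y. pprod L [x, y]), monoid.one = pone L\<rparr>"

definition p_subgroup :: "nat \<Rightarrow> 'a pgroup \<Rightarrow> 'a set \<Rightarrow> bool" where
  "p_subgroup p L H \<longleftrightarrow> psubgroup L H \<and> (\<exists>n. card H = p ^ n)"


section \<open>Localities\<close>

locale locality = partial_group L
  for p :: nat and L :: "'a pgroup" and \<Delta> :: "'a set set" and S :: "'a set" +
  assumes finite_carrier: "finite (carrier L)"
    and S_p_subgroup: "p_subgroup p L S"
    and objects_nonempty: "\<Delta> \<noteq> {}"
    and objects_subgroups: "P \<in> \<Delta> \<Longrightarrow> psubgroup L P \<and> P \<subseteq> S"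
    and S_maximal: "p_subgroup p L T \<Longrightarrow> S \<subseteq> T \<Longrightarrow> T = S"
    and dom_iff: "w \<in> lists (carrier L) \<Longrightarrow>
          w \<in> pdom L \<longleftrightarrow>
            (\<exists>Ps. length Ps = Suc (length w) \<and> set Ps \<subseteq> \<Delta> \<and>
               (\<forall>i < length w. Ps ! i \<subseteq> conj_dom L (w ! i) \<and>
                  pconj_set L (Ps ! i) (w ! i) = Ps ! Suc i))"
    and objects_overgroups:
          "P \<in> \<Delta> \<Longrightarrow> psubgroup L R \<Longrightarrow> P \<subseteq> R \<Longrightarrow> R \<subseteq> S \<Longrightarrow> R \<in> \<Delta>"
    and objects_conj:
          "P \<in> \<Delta> \<Longrightarrow> g \<in> carrier L \<Longrightarrow> P \<subseteq> conj_dom L g \<Longrightarrow>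
             psubgroup L (pconj_set L P g) \<Longrightarrow> pconj_set L P g \<subseteq> S \<Longrightarrow>
             pconj_set L P g \<in> \<Delta>"

definition punctured_group :: "nat \<Rightarrow> 'a pgroup \<Rightarrow> 'a set set \<Rightarrow> 'a set \<Rightarrow> bool" where
  "punctured_group p L \<Delta> S \<longleftrightarrow>
     locality p L \<Delta> S \<and> \<Delta> = {P. psubgroup L P \<and> P \<subseteq> S \<and> P \<noteq> {pone L}}"


section \<open>Fusion systems\<close>

text \<open>A fusion system over a group \<open>S\<close> is given by its morphism sets \<open>F P Q\<close>, for subgroups
  \<open>P\<close> and \<open>Q\<close> of \<open>S\<close>. Morphisms are extensional on their source, so that equality of
  morphisms is equality of functions, and \<open>F P Q\<close> is empty for all other arguments.
  The last clause says that every morphism is an isomorphism of the category followed by an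
  inclusion; identities and inclusions are conjugation maps by the identity of \<open>S\<close>.\<close>

definition fusion_system ::
    "'a monoid \<Rightarrow> ('a set \<Rightarrow> 'a set \<Rightarrow> ('a \<Rightarrow> 'a) set) \<Rightarrow> bool" where
  "fusion_system S F \<longleftrightarrow>
     (\<forall>P Q. \<not> (subgroup P S \<and> subgroup Q S) \<longrightarrow> F P Q = {}) \<and>
     (\<forall>P Q. F P Q \<subseteq> extensional P \<inter> mon (S\<lparr>carrier := P\<rparr>) (S\<lparr>carrier := Q\<rparr>)) \<and>
     (\<forall>P Q. \<forall>x \<in> carrier S. subgroup P S \<and> subgroup Q S \<and>
        (\<lambda>y. inv\<^bsub>S\<^esub> x \<otimes>\<^bsub>S\<^esub> y \<otimes>\<^bsub>S\<^esub> x) ` P \<subseteq> Q \<longrightarrow>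
        restrict (\<lambda>y. inv\<^bsub>S\<^esub> x \<otimes>\<^bsub>S\<^esub> y \<otimes>\<^bsub>S\<^esub> x) P \<in> F P Q) \<and>
     (\<forall>P Q R. \<forall>\<phi> \<in> F P Q. \<forall>\<psi> \<in> F Q R. compose P \<psi> \<phi> \<in> F P R) \<and>
     (\<forall>P Q. \<forall>\<phi> \<in> F P Q.
        \<phi> \<in> F P (\<phi> ` P) \<and> restrict (inv_into P \<phi>) (\<phi> ` P) \<in> F (\<phi> ` P) P)"

text \<open>The smallest fusion system over \<open>S\<close> containing the conjugation maps between objects.\<close>

definition fusion_of ::
    "'a pgroup \<Rightarrow> 'a set set \<Rightarrow> 'a set \<Rightarrow> 'a set \<Rightarrow> 'a set \<Rightarrow> ('a \<Rightarrow> 'a) set" where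
  "fusion_of L \<Delta> S P Q =
     \<Inter> {F P Q | F. fusion_system (grp L S) F \<and>
        (\<forall>R\<in>\<Delta>. \<forall>g\<in>carrier L.
           R \<subseteq> conj_dom L g \<and> psubgroup L (pconj_set L R g) \<and> pconj_set L R g \<subseteq> S \<longrightarrow>
           restrict (\<lambda>x. pconj L x g) R \<in> F R (pconj_set L R g))}"

text \<open>The morphism \<open>r\<^sup>-\<^sup>1 \<phi> r\<close> (maps written on the right) on \<open>r(P)\<close> corresponding to
  \<open>\<phi>\<close> on \<open>P\<close>, for \<open>r\<close> injective on \<open>S\<close> and \<open>P \<subseteq> S\<close>.\<close>

definition transport :: "('a \<Rightarrow> 'b) \<Rightarrow> 'a set \<Rightarrow> 'a set \<Rightarrow> ('a \<Rightarrow> 'a) \<Rightarrow> 'b \<Rightarrow> 'b" where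
  "transport r S P \<phi> = restrict (\<lambda>y. r (\<phi> (inv_into S r y))) (r ` P)"


section \<open>Quotients\<close>

definition pcoset :: "'a pgroup \<Rightarrow> 'a set \<Rightarrow> 'a \<Rightarrow> 'a set" where
  "pcoset L N f = {pprod L [n, f] | n. n \<in> N \<and> [n, f] \<in> pdom L}"

definition max_cosets :: "'a pgroup \<Rightarrow> 'a set \<Rightarrow> 'a set set" where
  "max_cosets L N =
     {C \<in> pcoset L N ` carrier L. \<forall>C' \<in> pcoset L N ` carrier L. C \<subseteq> C' \<longrightarrow> C' = C}"

definition proj :: "'a pgroup \<Rightarrow> 'a set \<Rightarrow> 'a \<Rightarrow> 'a set" where
  "proj L N f = (THE C. C \<in> max_cosets L N \<and> f \<in> C)"

text \<open>For \<open>N\<close> partial normal in a locality, the maximal cosets partition \<open>L\<close>, and product and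
  inversion descend along \<open>proj\<close>, so that the definite descriptions here and above are proper.\<close>

definition quot :: "'a pgroup \<Rightarrow> 'a set \<Rightarrow> 'a set pgroup" where
  "quot L N =
     \<lparr>carrier = max_cosets L N,
      pdom = map (proj L N) ` pdom L,
      pprod = (\<lambda>u. THE C. \<exists>w \<in> pdom L. map (proj L N) w = u \<and> C = proj L N (pprod L w)),
      pinv = (\<lambda>X. THE C. \<exists>f \<in> carrier L. proj L N f = X \<and> C = proj L N (pinv L f))\<rparr>"


section \<open>Signalizer functors\<close>

definition order_p_elems :: "nat \<Rightarrow> 'a pgroup \<Rightarrow> 'a set \<Rightarrow> 'a set" where
  "order_p_elems p L P = {x \<in> P. group.ord (grp L P) x = p}"

definition signalizer_functor ::
    "nat \<Rightarrow> 'a pgroup \<Rightarrow> 'a set \<Rightarrow> ('a \<Rightarrow> 'a set) \<Rightarrow> bool" where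
  "signalizer_functor p L S \<theta> \<longleftrightarrow>
     (\<forall>a \<in> order_p_elems p L S.
        \<theta> a \<lhd> grp L (pcentralizer L {a}) \<and> \<not> p dvd card (\<theta> a)) \<and>
     (\<forall>a \<in> order_p_elems p L S. \<forall>g \<in> carrier L.
        a \<in> conj_dom L g \<and> pconj L a g \<in> S \<longrightarrow>
        \<theta> a \<subseteq> conj_dom L g \<and> \<theta> (pconj L a g) = pconj_set L (\<theta> a) g) \<and>
     (\<forall>a \<in> order_p_elems p L S. \<forall>b \<in> order_p_elems p L S.
        pprod L [pinv L a, pinv L b, a, b] = pone L \<longrightarrow>
        \<theta> a \<inter> pcentralizer L {b} \<subseteq> \<theta> b)"

definition Theta_hat :: "nat \<Rightarrow> 'a pgroup \<Rightarrow> 'a set \<Rightarrow> ('a \<Rightarrow> 'a set) \<Rightarrow> 'a set" where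
  "Theta_hat p L S \<theta> = (\<Union>x \<in> order_p_elems p L S. \<theta> x)"

definition Theta :: "nat \<Rightarrow> 'a pgroup \<Rightarrow> ('a \<Rightarrow> 'a set) \<Rightarrow> 'a set \<Rightarrow> 'a set" where
  "Theta p L \<theta> P = (\<Inter>x \<in> order_p_elems p L P. \<theta> x) \<inter> pcentralizer L P"

end

theory Submission
  imports Defs "HOL-Algebra.Group_Action" "HOL-Algebra.Sylow"
begin

text \<open>For \<open>P \<in> \<Delta>\<close> let \<open>\<Theta>(P)\<close> be the normal \<open>p'\<close>-subgroup of the statement. Call \<open>f\<close> and \<open>g\<close>
  congruent over \<open>P\<close> if \<open>f = n g\<close> with \<open>n \<in> \<Theta>(P)\<close>; this is a congruence on the groupoid of
  conjugations between objects. Since \<open>\<Theta>(P) \<inter> S = 1\<close>, elements congruent over some object induce the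
  same map on \<open>S\<^sub>f \<inter> S\<^sub>g\<close> and are congruent over all of it (the elements of \<open>S\<^sub>f \<inter> S\<^sub>g\<close> normalizing a
  smaller such object commute with \<open>n\<close>, and normalizers grow). So \<open>n \<in> \<Theta>(S\<^sub>n)\<close> for every \<open>n\<close> in the
  union of the signalizers, whence partial normality.

  The coset of \<open>g\<close> is the set of elements congruent to \<open>g\<close>. In each class there are elements
  \<open>f\<close> with \<open>S\<^sub>f\<close> maximal. Conjugacy in \<open>\<Theta>(P) N\<^sub>S(P)\<close> of \<open>p\<close>-subgroups into \<open>N\<^sub>S(P)\<close>
  shows that such an \<open>S\<^sub>f\<close> contains \<open>S\<^sub>h\<close> for all \<open>h\<close> congruent to \<open>f\<close>, and
  also that \<open>S\<^sub>f\<close> is the set of all elements of \<open>S\<close> that the image of \<open>f\<close> in the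
  quotient conjugates into the image of \<open>S\<close>. This transfers all questions on the quotient to maximal
  representatives in \<open>L\<close>.\<close>

section \<open>Actions of p-groups\<close>

text \<open>Congruence over one fixed object is an equivalence relation, but congruence over some
  object is not evidently transitive: the objects witnessing two congruences may meet trivially,
  leaving nothing over which to compose them. Hence the effort to extend each congruence to the
  largest possible object \<open>Sdom f \<inter> Sdom g\<close>, and to find elements whose domain
  contains the domains of all elements congruent to them: comparison with such an element always
  leaves a common object. Extending a congruence requires \<open>n\<close> to lie in \<Theta> of
  objects larger than the one it was found for. Balance relates \<theta> only at commuting elements,
  but every object has a central element of order \<open>p\<close>, so membership in \<theta> at one
  element of order \<open>p\<close> of an object that \<open>n\<close> centralizes already gives
  membership in \<Theta>. That all nontrivial subgroups of \<open>S\<close> are objects enters when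
  \<open>n\<close> is given in \<theta> at some \<open>x\<close>: the subgroup of \<open>S\<close>
  that \<open>n\<close> centralizes contains \<open>x\<close>, hence is an object.\<close>

lemma (in group) p_group_fixed_points:
  fixes \<phi> :: "'a \<Rightarrow> 'c \<Rightarrow> 'c"
  assumes p: "prime p" and card_G: "card (carrier G) = p ^ n" and E: "finite E"
    and closed: "\<And>g x. g \<in> carrier G \<Longrightarrow> x \<in> E \<Longrightarrow> \<phi> g x \<in> E"
    and one: "\<And>x. x \<in> E \<Longrightarrow> \<phi> \<one> x = x"
    and mult: "\<And>g h x. g \<in> carrier G \<Longrightarrow> h \<in> carrier G \<Longrightarrow> x \<in> E \<Longrightarrow> \<phi> (g \<otimes> h) x = \<phi> g (\<phi> h x)"
  shows "card E mod p = card {x \<in> E. \<forall>g \<in> carrier G. \<phi> g x = x} mod p"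
proof -
  \<comment> \<open>\<open>\<phi>\<close> is a bare function obeying the laws on \<open>E\<close>,
    as translations of cosets and conjugations are; an action by elements of
    \<open>BijGroup E\<close> has to be extensional.\<close>
  define \<psi> where "\<psi> g = restrict (\<phi> g) E" for g
  have fin: "finite (carrier G)"
    using card_G p by (metis card.infinite not_prime_0 power_not_zero)
  have bij: "\<psi> g \<in> Bij E" if g: "g \<in> carrier G" for g
  proof -
    have "bij_betw (\<psi> g) E E"
      by (rule bij_betw_byWitness[where f' = "\<phi> (inv g)"])
        (use g in \<open>auto simp: \<psi>_def closed one mult[symmetric]\<close>)
    then show ?thesis by (auto simp: Bij_def \<psi>_def)
  qed
  interpret act: group_action G E \<psi>
  proof (unfold_locales, unfold hom_def, safe)
    show "\<psi> g \<in> carrier (BijGroup E)" if "g \<in> carrier G" for g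
      using bij[OF that] by (simp add: BijGroup_def)
    show "\<psi> (g \<otimes> h) = \<psi> g \<otimes>\<^bsub>BijGroup E\<^esub> \<psi> h" if "g \<in> carrier G" "h \<in> carrier G" for g h
      using that bij by (auto simp: BijGroup_def compose_def \<psi>_def mult closed fun_eq_iff)
  qed (auto simp: group_BijGroup[unfolded group_def group_axioms_def] group_BijGroup group.Units_eq
      group.axioms monoid.m_closed monoid.m_assoc)
  define F where "F = {x \<in> E. \<forall>g \<in> carrier G. \<phi> g x = x}"
  have orb: "orbit G \<psi> x \<subseteq> E" if "x \<in> E" for x
    using that closed by (auto simp: orbit_def \<psi>_def)
  have singleton: "x \<in> F \<longleftrightarrow> card (orbit G \<psi> x) = 1" if x: "x \<in> E" for x
  proof
    assume "x \<in> F"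
    then have "orbit G \<psi> x = {x}" using x one by (auto simp: F_def orbit_def \<psi>_def intro!: exI[of _ \<one>])
    then show "card (orbit G \<psi> x) = 1" by simp
  next
    assume "card (orbit G \<psi> x) = 1"
    then have "orbit G \<psi> x = {x}" using act.orbit_refl[OF x] by (metis card_1_singletonE singletonD)
    then show "x \<in> F" using x by (auto simp: F_def orbit_def \<psi>_def)
  qed
  have dvd: "p dvd card orb" if O: "orb \<in> orbits G E \<psi>" "card orb \<noteq> 1" for orb
  proof -
    obtain x where x: "x \<in> E" "orb = orbit G \<psi> x" using O by (auto simp: orbits_def)
    have "card orb dvd p ^ n"
      using act.orbit_stabilizer_theorem[OF x(1)] x(2) card_G by (metis dvd_triv_left order_def)
    then obtain k where "card orb = p ^ k" using divides_primepow_nat[OF p] by blast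
    then show ?thesis using O(2) by (cases k) auto
  qed
  \<comment> \<open>An orbit is a single fixed point, or it contains none and has size divisible by
    \<open>p\<close>; either way its fixed points count its size modulo \<open>p\<close>.\<close>
  have sum1: "(\<Sum>x\<in>orb. if x \<in> F then 1 else 0) mod p = card orb mod p"
    if O: "orb \<in> orbits G E \<psi>" for orb :: "'c set"
  proof -
    obtain y where y: "y \<in> E" "orb = orbit G \<psi> y" using O by (auto simp: orbits_def)
    have sub: "orb \<subseteq> E" using orb y by auto
    have same: "orbit G \<psi> x = orb" if "x \<in> orb" for x
    proof -
      have "x \<in> E" using that sub by auto
      then have "orbit G \<psi> x \<in> orbits G E \<psi>" by (auto simp: orbits_def)
      then show ?thesis using act.disjoint_union[OF _ O] act.orbit_refl[OF \<open>x \<in> E\<close>] that by blast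
    qed
    show ?thesis
    proof (cases "card orb = 1")
      case True
      then have "\<forall>x\<in>orb. x \<in> F" using singleton same sub by auto
      then show ?thesis by simp
    next
      case False
      then have "\<forall>x\<in>orb. x \<notin> F" using singleton same sub by auto
      then show ?thesis using dvd[OF O False] by simp
    qed
  qed
  have "card E mod p = (\<Sum>orb\<in>orbits G E \<psi>. card orb) mod p"
    using act.disjoint_sum[OF E, of "\<lambda>_. 1 :: nat"] by simp
  also have "\<dots> = (\<Sum>orb\<in>orbits G E \<psi>. card orb mod p) mod p"
    by (simp add: mod_sum_eq)
  also have "\<dots> = (\<Sum>orb\<in>orbits G E \<psi>. (\<Sum>x\<in>orb. if x \<in> F then 1 else 0) mod p) mod p"
    by (simp only: sum1 cong: sum.cong)
  also have "\<dots> = (\<Sum>orb\<in>orbits G E \<psi>. (\<Sum>x\<in>orb. if x \<in> F then 1 else 0)) mod p"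
    by (simp add: mod_sum_eq)
  also have "\<dots> = (\<Sum>x\<in>E. if x \<in> F then 1 else 0) mod p"
    by (simp only: act.disjoint_sum[OF E])
  also have "(\<Sum>x\<in>E. if x \<in> F then 1 else 0) = card {x \<in> E. x \<in> F}"
    using sum.inter_filter[OF E, of "\<lambda>_. 1 :: nat" "\<lambda>x. x \<in> F"] by simp
  also have "{x \<in> E. x \<in> F} = F" by (auto simp: F_def)
  finally show ?thesis by (simp add: F_def)
qed

lemma prime_dvd_card_other_element:
  assumes "prime p" "p dvd card F" "x \<in> F"
  obtains y where "y \<in> F" "y \<noteq> x"
proof -
  have "F \<noteq> {x}" using assms(1,2) by (auto simp: prime_nat_iff)
  then show ?thesis using assms(3) that by blast
qed

text \<open>\<open>H\<close> acts by translation on its right cosets. Their number is a power of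
  \<open>p\<close> other than 1 and the coset \<open>H\<close> is fixed, so a second coset is fixed
  as well; its representative normalizes \<open>H\<close>.\<close>

lemma (in group) p_group_normalizer_grows:
  assumes p: "prime p" and card_G: "card (carrier G) = p ^ n"
    and H: "subgroup H G" "H \<noteq> carrier G"
  obtains g where "g \<in> carrier G" "g \<notin> H" "\<And>h. h \<in> H \<Longrightarrow> g \<otimes> h \<otimes> inv g \<in> H"
proof -
  interpret H: subgroup H G by (fact H)
  have fin: "finite (carrier G)"
    using card_G p by (metis card.infinite not_prime_0 power_not_zero)
  have H_grp: "group (G\<lparr>carrier := H\<rparr>)" by (rule H.subgroup_is_group[OF is_group])
  have lag: "card H * card (rcosets H) = p ^ n"
    using lagrange[OF H(1)] card_G by (simp add: order_def mult.commute)
  then obtain k where k: "card H = p ^ k" using divides_primepow_nat[OF p] by (metis dvd_triv_left)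
  obtain l where l: "card (rcosets H) = p ^ l" using lag divides_primepow_nat[OF p]
    by (metis dvd_triv_right)
  have "card H < card (carrier G)" using H fin by (metis H.subset psubsetI psubset_card_mono)
  then have "l \<noteq> 0" using lag l card_G by (intro notI) simp
  \<comment> \<open>Right translation reverses products, hence the inverse in the action.\<close>
  define F where "F = {C \<in> rcosets H. \<forall>h \<in> H. C #> inv h = C}"
  have "card (rcosets H) mod p = card {C \<in> rcosets H. \<forall>h \<in> carrier (G\<lparr>carrier := H\<rparr>). C #> inv h = C} mod p"
  proof (rule group.p_group_fixed_points[OF H_grp p, where \<phi> = "\<lambda>h C. C #> inv h" and n = k])
    show "finite (rcosets H)" using fin by (simp add: RCOSETS_def)
    have rep: "\<exists>c\<in>carrier G. C = H #> c" if "C \<in> rcosets H" for C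
      using that by (auto simp: RCOSETS_def)
    show "C #> inv h \<in> rcosets H" if h: "h \<in> carrier (G\<lparr>carrier := H\<rparr>)" and C: "C \<in> rcosets H" for h C
    proof -
      obtain c where c: "c \<in> carrier G" "C = H #> c" using rep[OF C] by blast
      have "C #> inv h = H #> (c \<otimes> inv h)" using c h H.subset by (simp add: coset_mult_assoc)
      then show ?thesis using c h by (simp add: rcosetsI H.subset)
    qed
    show "C #> inv \<one>\<^bsub>G\<lparr>carrier := H\<rparr>\<^esub> = C" if C: "C \<in> rcosets H" for C
      using rep[OF C] H.subset r_coset_subset_G by auto
    show "C #> inv (g \<otimes>\<^bsub>G\<lparr>carrier := H\<rparr>\<^esub> h) = C #> inv h #> inv g"
      if gh: "g \<in> carrier (G\<lparr>carrier := H\<rparr>)" "h \<in> carrier (G\<lparr>carrier := H\<rparr>)" and C: "C \<in> rcosets H"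
        for g h C
    proof -
      obtain c where c: "c \<in> carrier G" "C = H #> c" using rep[OF C] by blast
      show ?thesis using c gh H.subset by (simp add: coset_mult_assoc inv_mult_group m_assoc)
    qed
  qed (simp add: k)
  then have F: "p dvd card F" using l \<open>l \<noteq> 0\<close> by (cases l) (simp_all add: F_def dvd_eq_mod_eq_0)
  have "H #> \<one> \<in> F"
    using coset_join2[OF _ H(1)] H.subset rcosetsI[OF H.subset one_closed] by (auto simp: F_def)
  obtain C where "C \<in> F" "C \<noteq> H #> \<one>"
    using prime_dvd_card_other_element[OF p F \<open>H #> \<one> \<in> F\<close>] .
  then obtain g where g: "g \<in> carrier G" "H #> g \<noteq> H #> \<one>" "H #> g \<in> F"
    by (auto simp: F_def RCOSETS_def)
  have gH: "g \<notin> H" using g H.subset by (metis coset_join2 H(1) one_closed H.one_closed)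
  have "g \<otimes> h \<otimes> inv g \<in> H" if h: "h \<in> H" for h
  proof -
    have "H #> (g \<otimes> h) = H #> g"
    proof -
      have "H #> g #> inv (inv h) = H #> g"
        using g(3) H.m_inv_closed[OF h] unfolding F_def by blast
      then show ?thesis using h g(1) by (simp add: coset_mult_assoc H.subset)
    qed
    then have "g \<otimes> h \<in> H #> g" using rcos_self[OF _ H(1)] g h by (metis H.mem_carrier m_closed)
    then show ?thesis using H.rcos_module_imp[OF is_group g(1)] by blast
  qed
  with g gH that show ?thesis by blast
qed

text \<open>The centre is the fixed point set of conjugation, so \<open>p\<close> divides its order.
  A nontrivial central element has order \<open>p ^ Suc j\<close> for some \<open>j\<close>; its
  power with exponent \<open>p ^ j\<close> has order \<open>p\<close>.\<close>

lemma (in group) p_group_central_element: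
  assumes p: "prime p" and card_G: "card (carrier G) = p ^ n" and nontriv: "carrier G \<noteq> {\<one>}"
  obtains z where "z \<in> carrier G" "ord z = p" "\<And>g. g \<in> carrier G \<Longrightarrow> g \<otimes> z = z \<otimes> g"
proof -
  have fin: "finite (carrier G)"
    using card_G p by (metis card.infinite not_prime_0 power_not_zero)
  define Z where "Z = {x \<in> carrier G. \<forall>g \<in> carrier G. g \<otimes> x \<otimes> inv g = x}"
  have "card (carrier G) mod p = card Z mod p" unfolding Z_def
    by (rule p_group_fixed_points[OF p card_G fin,
      where \<phi> = "\<lambda>g x. g \<otimes> x \<otimes> inv g"]) (auto simp: m_assoc inv_mult_group)
  moreover have "n \<noteq> 0"
  proof
    assume "n = 0"
    then have "card (carrier G) = 1" using card_G by simp
    then show False using nontriv by (metis card_1_singletonE one_closed singletonD)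
  qed
  ultimately have "p dvd card Z" using card_G by (cases n) (simp_all add: dvd_eq_mod_eq_0)
  moreover have "\<one> \<in> Z" by (auto simp: Z_def)
  ultimately obtain y where y: "y \<in> Z" "y \<noteq> \<one>"
    using prime_dvd_card_other_element[OF p] by metis
  have yG: "y \<in> carrier G" using y by (simp add: Z_def)
  obtain k where k: "ord y = p ^ k"
    using ord_dvd_group_order[OF yG] card_G divides_primepow_nat[OF p] by (metis order_def)
  have "k \<noteq> 0" using k y yG ord_eq_1 by (intro notI) simp
  then obtain j where j: "k = Suc j" using not0_implies_Suc by blast
  define z where "z = y [^] (p ^ j)"
  have "ord z = ord y div p ^ j" unfolding z_def using k j p
    by (intro ord_pow yG) (auto simp: prime_gt_0_nat)
  then have "ord z = p" using k j p by (simp add: prime_gt_0_nat)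
  moreover have "g \<otimes> z = z \<otimes> g" if g: "g \<in> carrier G" for g
  proof -
    have "g \<otimes> y \<otimes> inv g = y" using y g by (auto simp: Z_def)
    then have "g \<otimes> y = y \<otimes> g" using g yG inv_solve_right'[of y "g \<otimes> y" g] by simp
    then have "y \<otimes> g = g \<otimes> y" by simp
    then have "y [^] (p ^ j) \<otimes> g = g \<otimes> y [^] (p ^ j)" by (rule group_commutes_pow) (simp_all add: g yG)
    then show ?thesis by (simp add: z_def)
  qed
  moreover have "z \<in> carrier G" using yG by (simp add: z_def)
  ultimately show ?thesis using that by blast
qed

lemma (in group) lcos_self: "g \<in> carrier G \<Longrightarrow> subgroup H G \<Longrightarrow> g \<in> g <# H"
  by (force simp: l_coset_def dest: subgroup.one_closed)

text \<open>Sylow conjugacy in the product of \<open>N\<close> with an arbitrary subgroup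
  \<open>B\<close> meeting it trivially: \<open>A\<close> permutes the cosets \<open>n <# B\<close>
  with \<open>n\<close> in \<open>N\<close>, and their number \<open>card N\<close> is prime to
  \<open>p\<close>. A fixed coset supplies the conjugating element.\<close>

lemma (in group) p_subgroup_conj_into_complement:
  assumes p: "prime p" and fin: "finite (carrier G)"
    and N: "N \<lhd> G" "\<not> p dvd card N" and A: "subgroup A G" "card A = p ^ k"
    and B: "subgroup B G" "N \<inter> B = {\<one>}"
    and AB: "\<And>a. a \<in> A \<Longrightarrow> \<exists>n\<in>N. \<exists>b\<in>B. a = n \<otimes> b"
  obtains n where "n \<in> N" "\<And>a. a \<in> A \<Longrightarrow> inv n \<otimes> a \<otimes> n \<in> B"
proof -
  interpret N: normal N G by (fact N)
  interpret A: subgroup A G by (fact A)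
  interpret B: subgroup B G by (fact B)
  have A_grp: "group (G\<lparr>carrier := A\<rparr>)" by (rule A.subgroup_is_group[OF is_group])
  define E where "E = (\<lambda>n. n <# B) ` N"
  have finN: "finite N" using fin N.subset finite_subset by blast
  have inj: "inj_on (\<lambda>n. n <# B) N"
  proof (rule inj_onI)
    fix n m assume nm: "n \<in> N" "m \<in> N" "n <# B = m <# B"
    then have "n \<in> m <# B" using lcos_self[OF _ B(1)] N.mem_carrier by metis
    then obtain b where b: "b \<in> B" "n = m \<otimes> b" by (auto simp: l_coset_def)
    then have "b = inv m \<otimes> n" using nm by (simp add: inv_solve_left N.mem_carrier B.mem_carrier)
    then have "b \<in> N" using nm by simp
    then have "b \<in> N \<inter> B" using b by simp
    then show "n = m" using B b nm by (auto simp: N.mem_carrier)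
  qed
  have fix0: "\<exists>C\<in>E. \<forall>a\<in>A. a <# C = C"
  proof -
    have "card E mod p = card {C \<in> E. \<forall>a \<in> carrier (G\<lparr>carrier := A\<rparr>). a <# C = C} mod p"
    proof (rule group.p_group_fixed_points[OF A_grp p, where \<phi> = "l_coset G" and n = k])
      show "card (carrier (G\<lparr>carrier := A\<rparr>)) = p ^ k" using A by simp
      show "finite E" using finN by (simp add: E_def)
      show "a <# C \<in> E" if aC: "a \<in> carrier (G\<lparr>carrier := A\<rparr>)" "C \<in> E" for a C
      proof -
        obtain m where m: "m \<in> N" "C = m <# B" using aC by (auto simp: E_def)
        have a: "a \<in> A" "a \<in> carrier G" using aC by auto
        obtain n b where nb: "n \<in> N" "b \<in> B" "a = n \<otimes> b" using AB a by blast
        have c: "n \<in> carrier G" "b \<in> carrier G" "m \<in> carrier G" using nb m by (auto simp: N.mem_carrier)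
        have "a <# C = (a \<otimes> m) <# B" using m a c B.subset by (simp add: lcos_m_assoc)
        \<comment> \<open>With \<open>a\<close> written as \<open>n \<otimes> b\<close>, the factor
          \<open>b\<close> is moved past \<open>m\<close>, which remains in \<open>N\<close> by
          normality, and is then absorbed by \<open>B\<close>.\<close>
        also have "a \<otimes> m = (n \<otimes> (b \<otimes> m \<otimes> inv b)) \<otimes> b" using c nb by (simp add: m_assoc)
        also have "\<dots> <# B = (n \<otimes> (b \<otimes> m \<otimes> inv b)) <# (b <# B)"
          using c B.subset by (simp add: lcos_m_assoc)
        also have "b <# B = B" using nb B(1) coset_join3 c by blast
        finally show ?thesis using N.inv_op_closed2[OF c(2) m(1)] nb by (auto simp: E_def)
      qed
      have sub: "C \<subseteq> carrier G" if "C \<in> E" for C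
        using that B.subset N.mem_carrier by (auto simp: E_def l_coset_def)
      show "\<one>\<^bsub>G\<lparr>carrier := A\<rparr>\<^esub> <# C = C" if "C \<in> E" for C
        using sub[OF that] by (simp add: lcos_mult_one)
      show "(g \<otimes>\<^bsub>G\<lparr>carrier := A\<rparr>\<^esub> h) <# C = g <# (h <# C)"
        if "g \<in> carrier (G\<lparr>carrier := A\<rparr>)" "h \<in> carrier (G\<lparr>carrier := A\<rparr>)" "C \<in> E" for g h C
        using sub[OF that(3)] that by (simp add: lcos_m_assoc)
    qed
    moreover have "card E = card N" using inj by (simp add: E_def card_image)
    ultimately have "\<not> p dvd card {C \<in> E. \<forall>a \<in> A. a <# C = C}"
      using N(2) by (simp add: dvd_eq_mod_eq_0)
    then have "{C \<in> E. \<forall>a \<in> A. a <# C = C} \<noteq> {}" by (metis card.empty dvd_0_right)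
    then show ?thesis by blast
  qed
  then obtain n where n: "n \<in> N" "\<And>a. a \<in> A \<Longrightarrow> a <# (n <# B) = n <# B" by (auto simp: E_def)
  have nG: "n \<in> carrier G" using n by auto
  have "inv n \<otimes> a \<otimes> n \<in> B" if a: "a \<in> A" for a
  proof -
    have aG: "a \<in> carrier G" using a by simp
    have "a \<otimes> n \<in> (a \<otimes> n) <# B" using lcos_self[OF _ B(1)] aG nG by simp
    also have "\<dots> = n <# B" using n(2)[OF a] aG nG B.subset by (simp add: lcos_m_assoc)
    finally obtain b where "b \<in> B" "a \<otimes> n = n \<otimes> b" by (auto simp: l_coset_def)
    then have "inv n \<otimes> (a \<otimes> n) = b" using nG by (simp add: inv_solve_left' B.mem_carrier aG)
    then show ?thesis using \<open>b \<in> B\<close> aG nG by (simp add: m_assoc)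
  qed
  with n(1) that show ?thesis by blast
qed

section \<open>Partial groups and localities\<close>

context partial_group
begin

abbreviation mult (infixl "\<cdot>" 70) where
  "x \<cdot> y \<equiv> pprod L [x, y]"

lemma dom_appendD1: "u @ v \<in> pdom L \<Longrightarrow> u \<in> pdom L"
  and dom_appendD2: "u @ v \<in> pdom L \<Longrightarrow> v \<in> pdom L"
  using dom_append by blast+

lemma dom_set: "w \<in> pdom L \<Longrightarrow> set w \<subseteq> carrier L"
  using dom_words by auto

lemma dom_Nil: "[] \<in> pdom L"
  using dom_single nonempty dom_appendD1[of "[]"] by fastforce

lemma one_carrier [simp]: "pone L \<in> carrier L"
  using prod_closed[OF dom_Nil] by (simp add: pone_def)

lemma dom_unit: "u @ v \<in> pdom L \<Longrightarrow> u @ [pone L] @ v \<in> pdom L"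
  and prod_unit: "u @ v \<in> pdom L \<Longrightarrow> pprod L (u @ [pone L] @ v) = pprod L (u @ v)"
  using prod_assoc[of u "[]" v] by (simp_all add: pone_def)

lemma word_inv_append: "word_inv L (u @ v) = word_inv L v @ word_inv L u"
  by (simp add: word_inv_def)

lemma word_inv_word_inv: "set w \<subseteq> carrier L \<Longrightarrow> word_inv L (word_inv L w) = w"
  by (induction w) (simp_all add: word_inv_def inv_inv)

lemma dom_word_inv: "w \<in> pdom L \<Longrightarrow> word_inv L w \<in> pdom L"
  using prod_word_inv dom_append by blast

lemma prod_word_inv_right:
  assumes "w \<in> pdom L"
  shows "w @ word_inv L w \<in> pdom L \<and> pprod L (w @ word_inv L w) = pone L"
  using prod_word_inv[OF dom_word_inv[OF assms]] word_inv_word_inv[OF dom_set[OF assms]] by simp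

text \<open>The longer word is a prefix of \<open>u @ v\<close> followed by its inverse.\<close>

lemma dom_extend_right: "u @ v \<in> pdom L \<Longrightarrow> u @ v @ word_inv L v \<in> pdom L"
  using prod_word_inv_right[of "u @ v"] dom_appendD1[of "u @ v @ word_inv L v" "word_inv L u"]
  by (simp add: word_inv_append)

lemma dom_extend_left: "u @ v \<in> pdom L \<Longrightarrow> word_inv L u @ u @ v \<in> pdom L"
  using prod_word_inv[of "u @ v"] dom_appendD2[of "word_inv L v" "word_inv L u @ u @ v"]
  by (simp add: word_inv_append)

lemma
  assumes "x \<in> carrier L"
  shows dom_inv_left: "[pinv L x, x] \<in> pdom L" and inv_left: "pinv L x \<cdot> x = pone L"
    and dom_inv_right: "[x, pinv L x] \<in> pdom L" and inv_right: "x \<cdot> pinv L x = pone L"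
  using prod_word_inv[OF dom_single[OF assms]] prod_word_inv_right[OF dom_single[OF assms]]
  by (simp_all add: word_inv_def)

lemma
  assumes "x \<in> carrier L"
  shows dom_one_left: "[pone L, x] \<in> pdom L" and one_left: "pone L \<cdot> x = x"
    and one_right: "x \<cdot> pone L = x"
  using dom_unit[of "[]" "[x]"] prod_unit[of "[]" "[x]"] prod_unit[of "[x]" "[]"]
    dom_single[OF assms] prod_single[OF assms] by simp_all

lemma inv_one [simp]: "pinv L (pone L) = pone L"
  using inv_left[of "pone L"] one_right[OF inv_closed[of "pone L"]] by simp

lemma inv_unique:
  assumes "[a, b] \<in> pdom L" "a \<cdot> b = pone L"
  shows "a = pinv L b"
proof -
  have c: "a \<in> carrier L" "b \<in> carrier L" using dom_set[OF assms(1)] by auto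
  have d: "[a, b, pinv L b] \<in> pdom L"
    using dom_extend_right[of "[a]" "[b]"] assms(1) by (simp add: word_inv_def)
  have "pprod L [a, b, pinv L b] = pinv L b"
    using prod_assoc[of "[]" "[a, b]" "[pinv L b]"] d assms(2) one_left[OF inv_closed[OF c(2)]] by simp
  moreover have "pprod L [a, b, pinv L b] = a"
    using prod_assoc[of "[a]" "[b, pinv L b]" "[]"] d inv_right[OF c(2)] one_right[OF c(1)] by simp
  ultimately show ?thesis by simp
qed

lemma inv_prod:
  assumes "w \<in> pdom L" shows "pinv L (pprod L w) = pprod L (word_inv L w)"
proof -
  have 1: "word_inv L w @ w \<in> pdom L" "pprod L (word_inv L w @ w) = pone L"
    using prod_word_inv[OF assms] by auto
  have 2: "pprod L (word_inv L w) # w \<in> pdom L" "pprod L (pprod L (word_inv L w) # w) = pone L"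
    using prod_assoc[of "[]" "word_inv L w" w] 1 by simp_all
  have "[pprod L (word_inv L w), pprod L w] \<in> pdom L"
       "pprod L (word_inv L w) \<cdot> pprod L w = pone L"
    using prod_assoc[of "[pprod L (word_inv L w)]" w "[]"] 2 by simp_all
  from inv_unique[OF this] show ?thesis by simp
qed

lemma conj_domD: "x \<in> conj_dom L g \<Longrightarrow> x \<in> carrier L \<and> g \<in> carrier L \<and> [pinv L g, x, g] \<in> pdom L"
  using dom_set by (force simp: conj_dom_def)

lemma conj_domI: "[pinv L g, x, g] \<in> pdom L \<Longrightarrow> x \<in> conj_dom L g"
  using dom_set by (force simp: conj_dom_def)

lemma pconj_carrier: "x \<in> conj_dom L g \<Longrightarrow> pconj L x g \<in> carrier L"
  using conj_domD prod_closed by (auto simp: pconj_def)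

lemma pconj_inv:
  assumes "x \<in> conj_dom L g"
  shows "pconj L x g \<in> conj_dom L (pinv L g)" "pconj L (pconj L x g) (pinv L g) = x"
proof -
  have c: "x \<in> carrier L" "g \<in> carrier L" and d: "[pinv L g, x, g] \<in> pdom L"
    using conj_domD[OF assms] by auto
  have "[pinv L g, x, g, pinv L g] \<in> pdom L"
    using dom_extend_right[of "[pinv L g, x]" "[g]"] d by (simp add: word_inv_def)
  \<comment> \<open>Bracketing the inner three letters gives the conjugate of
    \<open>pconj L x g\<close> by the inverse of \<open>g\<close>; cancelling both ends gives
    \<open>x\<close>.\<close>
  then have w: "[g, pinv L g, x, g, pinv L g] \<in> pdom L"
    using dom_extend_left[of "[pinv L g]" "[x, g, pinv L g]"] c by (simp add: word_inv_def inv_inv)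
  have 1: "[g, pconj L x g, pinv L g] \<in> pdom L"
    "pprod L [g, pconj L x g, pinv L g] = pprod L [g, pinv L g, x, g, pinv L g]"
    using prod_assoc[of "[g]" "[pinv L g, x, g]" "[pinv L g]"] w by (simp_all add: pconj_def)
  show "pconj L x g \<in> conj_dom L (pinv L g)" using 1 c by (intro conj_domI) (simp add: inv_inv)
  have w1: "[x, g, pinv L g] \<in> pdom L" using dom_appendD2[of "[g, pinv L g]"] w by simp
  have "pprod L [g, pinv L g, x, g, pinv L g] = pprod L [x, g, pinv L g]"
    using prod_assoc[of "[]" "[g, pinv L g]" "[x, g, pinv L g]"] w prod_unit[of "[]"
      "[x, g, pinv L g]"] w1
    by (simp add: inv_right c)
  also have "\<dots> = x"
    using prod_assoc[of "[x]" "[g, pinv L g]" "[]"] w1 one_right[OF c(1)] by (simp add: inv_right c)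
  finally show "pconj L (pconj L x g) (pinv L g) = x" using 1 c by (simp add: pconj_def inv_inv)
qed

lemma pconj_inverse_elem:
  assumes "x \<in> conj_dom L g"
  shows "pinv L x \<in> conj_dom L g" "pconj L (pinv L x) g = pinv L (pconj L x g)"
proof -
  have d: "[pinv L g, x, g] \<in> pdom L" and c: "g \<in> carrier L" using conj_domD[OF assms] by auto
  have "word_inv L [pinv L g, x, g] = [pinv L g, pinv L x, g]" using c
    by (simp add: word_inv_def inv_inv)
  then show "pinv L x \<in> conj_dom L g" "pconj L (pinv L x) g = pinv L (pconj L x g)"
    using dom_word_inv[OF d] inv_prod[OF d] by (auto simp: pconj_def intro: conj_domI)
qed

lemma pconj_one:
  assumes "g \<in> carrier L" shows "pone L \<in> conj_dom L g" "pconj L (pone L) g = pone L"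
  using dom_unit[of "[pinv L g]" "[g]"] prod_unit[of "[pinv L g]"
    "[g]"] dom_inv_left[OF assms] inv_left[OF assms]
  by (auto simp: pconj_def intro: conj_domI)

lemma pconj_inj: "inj_on (\<lambda>x. pconj L x g) (conj_dom L g)"
  by (rule inj_onI) (metis pconj_inv(2))

lemma mult_eq_conj:
  assumes "x \<in> conj_dom L g" shows "x \<cdot> g = g \<cdot> pconj L x g"
proof -
  have c: "x \<in> carrier L" "g \<in> carrier L" and d: "[pinv L g, x, g] \<in> pdom L"
    using conj_domD[OF assms] by auto
  have w: "[g, pinv L g, x, g] \<in> pdom L"
    using dom_extend_left[of "[pinv L g]" "[x, g]"] d c by (simp add: word_inv_def inv_inv)
  have w1: "[x, g] \<in> pdom L" using dom_appendD2[of "[g, pinv L g]"] w by simp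
  have "pprod L [g, pinv L g, x, g] = x \<cdot> g"
    using prod_assoc[of "[]" "[g, pinv L g]" "[x, g]"] w prod_unit[of "[]" "[x, g]"] w1
    by (simp add: inv_right c)
  moreover have "pprod L [g, pinv L g, x, g] = g \<cdot> pconj L x g"
    using prod_assoc[of "[g]" "[pinv L g, x, g]" "[]"] w by (simp add: pconj_def)
  ultimately show ?thesis by simp
qed

lemma psubgroupD:
  assumes "psubgroup L H"
  shows "H \<subseteq> carrier L" "H \<noteq> {}" "\<And>x. x \<in> H \<Longrightarrow> pinv L x \<in> H"
    "\<And>w. set w \<subseteq> H \<Longrightarrow> w \<in> pdom L" "\<And>w. set w \<subseteq> H \<Longrightarrow> pprod L w \<in> H"
    "pone L \<in> H"
proof -
  show *: "H \<subseteq> carrier L" "H \<noteq> {}" "\<And>x. x \<in> H \<Longrightarrow> pinv L x \<in> H"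
    "\<And>w. set w \<subseteq> H \<Longrightarrow> w \<in> pdom L" "\<And>w. set w \<subseteq> H \<Longrightarrow> pprod L w \<in> H"
    using assms by (auto simp: psubgroup_def partial_subgroup_def in_lists_conv_set subset_iff)
  show "pone L \<in> H" using *(5)[of "[]"] by (simp add: pone_def)
qed

lemma psubgroup_assoc:
  assumes "psubgroup L H" "x \<in> H" "y \<in> H" "z \<in> H"
  shows "x \<cdot> y \<cdot> z = pprod L [x, y, z]" "x \<cdot> (y \<cdot> z) = pprod L [x, y, z]"
  using psubgroupD(4)[OF assms(1), of "[x, y, z]"] assms(2-)
    prod_assoc[of "[]" "[x, y]" "[z]"] prod_assoc[of "[x]" "[y, z]" "[]"] by simp_all

lemma psubgroup_group:
  assumes "psubgroup L H" shows "group (grp L H)"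
proof (rule groupI)
  note H = psubgroupD[OF assms]
  show "\<one>\<^bsub>grp L H\<^esub> \<in> carrier (grp L H)" using H by (simp add: grp_def)
  fix x y z assume x: "x \<in> carrier (grp L H)"
  show "\<one>\<^bsub>grp L H\<^esub> \<otimes>\<^bsub>grp L H\<^esub> x = x" using H x by (simp add: grp_def one_left subset_iff)
  show "\<exists>y\<in>carrier (grp L H). y \<otimes>\<^bsub>grp L H\<^esub> x = \<one>\<^bsub>grp L H\<^esub>"
    using H(1,3) x by (auto simp: grp_def intro!: bexI[of _ "pinv L x"] inv_left)
  assume y: "y \<in> carrier (grp L H)"
  show "x \<otimes>\<^bsub>grp L H\<^esub> y \<in> carrier (grp L H)" using H x y by (simp add: grp_def)
  assume z: "z \<in> carrier (grp L H)"
  show "x \<otimes>\<^bsub>grp L H\<^esub> y \<otimes>\<^bsub>grp L H\<^esub> z = x \<otimes>\<^bsub>grp L H\<^esub> (y \<otimes>\<^bsub>grp L H\<^esub> z)"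
    using psubgroup_assoc[OF assms] x y z by (simp add: grp_def)
qed

lemma grp_inv:
  assumes "psubgroup L H" "x \<in> H" shows "inv\<^bsub>grp L H\<^esub> x = pinv L x"
proof (rule group.inv_equality[OF psubgroup_group[OF assms(1)]])
  show "pinv L x \<otimes>\<^bsub>grp L H\<^esub> x = \<one>\<^bsub>grp L H\<^esub>"
    using assms psubgroupD(1)[OF assms(1)] by (auto simp: grp_def inv_left)
qed (use assms psubgroupD(3)[OF assms(1)] in \<open>auto simp: grp_def\<close>)

lemma subgroup_grp_iff:
  assumes K: "psubgroup L K"
  shows "subgroup H (grp L K) \<longleftrightarrow> psubgroup L H \<and> H \<subseteq> K"
proof
  interpret G: group "grp L K" by (rule psubgroup_group[OF K])
  note K' = psubgroupD[OF K]
  assume "subgroup H (grp L K)"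
  then interpret H: subgroup H "grp L K" .
  have HK: "H \<subseteq> K" using H.subset by (simp add: grp_def)
  have one: "pone L \<in> H" using H.one_closed by (simp add: grp_def)
  have inv: "pinv L x \<in> H" if "x \<in> H" for x
    using H.m_inv_closed[OF that] grp_inv[OF K subsetD[OF HK that]] by simp
  have mult: "x \<cdot> y \<in> H" if "x \<in> H" "y \<in> H" for x y
    using H.m_closed that by (simp add: grp_def)
  have prod: "pprod L w \<in> H" if "set w \<subseteq> H" for w
    using that
  proof (induction w)
    case Nil
    then show ?case using one by (simp add: pone_def)
  next
    case (Cons x w)
    have "pprod L (x # w) = x \<cdot> pprod L w"
      using prod_assoc[of "[x]" w "[]"] K'(4)[of "x # w"] Cons.prems HK by auto
    then show ?case using mult Cons by auto
  qed
  show "psubgroup L H \<and> H \<subseteq> K"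
    using one inv prod HK K'(1,4)
      by (auto simp: psubgroup_def partial_subgroup_def in_lists_conv_set subset_iff)
next
  assume "psubgroup L H \<and> H \<subseteq> K"
  then have H: "psubgroup L H" "H \<subseteq> K" by auto
  note H' = psubgroupD[OF H(1)]
  show "subgroup H (grp L K)"
    by (rule subgroup.intro) (use H H' grp_inv[OF K] in \<open>auto simp: grp_def subset_iff\<close>)
qed

lemma psubgroupI_sub:
  assumes K: "psubgroup L K" and "H \<subseteq> K" "pone L \<in> H" "\<And>x. x \<in> H \<Longrightarrow> pinv L x \<in> H"
    "\<And>x y. x \<in> H \<Longrightarrow> y \<in> H \<Longrightarrow> x \<cdot> y \<in> H"
  shows "psubgroup L H"
proof -
  have "subgroup H (grp L K)"
    by (rule subgroup.intro) (use assms grp_inv[OF K] in \<open>auto simp: grp_def subset_iff\<close>)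
  then show ?thesis using subgroup_grp_iff[OF K] by blast
qed

lemma psubgroup_Int:
  assumes "psubgroup L H" "psubgroup L K" shows "psubgroup L (H \<inter> K)"
  by (rule psubgroupI_sub[OF assms(1)]) (use psubgroupD[OF assms(1)] psubgroupD[OF assms(2)] in auto)

lemma grp_pow: "x [^]\<^bsub>grp L H\<^esub> (n::nat) = x [^]\<^bsub>grp L K\<^esub> n"
  by (simp add: nat_pow_def grp_def)

text \<open>Powers of \<open>x\<close> are computed alike in both groups, so the order of
  \<open>x\<close> divides both cardinalities. The two groups need not lie in a common one.\<close>

lemma coprime_Int_trivial:
  assumes "group (grp L H)" "group (grp L K)" "coprime (card H) (card K)" and x: "x \<in> H" "x \<in> K"
  shows "x = pone L"
proof -
  interpret H: group "grp L H" by (fact assms(1))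
  interpret K: group "grp L K" by (fact assms(2))
  have xH: "x \<in> carrier (grp L H)" and xK: "x \<in> carrier (grp L K)" using x by (auto simp: grp_def)
  have "x [^]\<^bsub>grp L H\<^esub> card H = pone L" using H.pow_order_eq_1[OF xH] by (simp add: order_def grp_def)
  then have "x [^]\<^bsub>grp L K\<^esub> card H = \<one>\<^bsub>grp L K\<^esub>"
    using grp_pow[where H = H and K = K] by (simp add: grp_def)
  then have "K.ord x dvd card H" using K.pow_eq_id[OF xK] by blast
  moreover have "K.ord x dvd card K" using K.ord_dvd_group_order[OF xK] by (simp add: order_def grp_def)
  ultimately have "K.ord x = 1" using assms(3) by (metis coprime_common_divisor_nat nat_dvd_1_iff_1)
  then show ?thesis using K.ord_eq_1[OF xK] by (simp add: grp_def)
qed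

lemma card_pconj_set: "P \<subseteq> conj_dom L g \<Longrightarrow> card (pconj_set L P g) = card P"
  unfolding pconj_set_def by (rule card_image[OF inj_on_subset[OF pconj_inj]])

end

section \<open>The groupoid of conjugations between objects\<close>

context locality
begin

text \<open>Arrows of the groupoid. Source and target are both required to be objects, so that
  arrows compose and reverse without side conditions.\<close>

definition moves :: "'a set \<Rightarrow> 'a \<Rightarrow> 'a set \<Rightarrow> bool" where
  "moves P f Q \<longleftrightarrow> P \<in> \<Delta> \<and> Q \<in> \<Delta> \<and> f \<in> carrier L \<and> P \<subseteq> conj_dom L f \<and> pconj_set L P f = Q"

fun path :: "'a set \<Rightarrow> 'a list \<Rightarrow> 'a set \<Rightarrow> bool" where
  "path P [] Q \<longleftrightarrow> P \<in> \<Delta> \<and> P = Q"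
| "path P (f # w) Q \<longleftrightarrow> (\<exists>R. moves P f R \<and> path R w Q)"

lemma movesD: "moves P f Q \<Longrightarrow> P \<in> \<Delta>" "moves P f Q \<Longrightarrow> Q \<in> \<Delta>" "moves P f Q \<Longrightarrow> f \<in> carrier L"
  "moves P f Q \<Longrightarrow> x \<in> P \<Longrightarrow> x \<in> conj_dom L f" "moves P f Q \<Longrightarrow> x \<in> P \<Longrightarrow> pconj L x f \<in> Q"
  by (auto simp: moves_def pconj_set_def)

lemma moves_image: "moves P f Q \<Longrightarrow> Q = (\<lambda>x. pconj L x f) ` P"
  by (auto simp: moves_def pconj_set_def)

lemma moves_unique: "moves P f Q \<Longrightarrow> moves P f Q' \<Longrightarrow> Q = Q'"
  by (auto simp: moves_def)

lemma path_single [simp]: "path P [f] Q \<longleftrightarrow> moves P f Q"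
  by (auto dest: movesD(2))

lemma path_ConsI: "moves P f R \<Longrightarrow> path R w Q \<Longrightarrow> path P (f # w) Q"
  by auto

lemma path_oneI: "moves P f Q \<Longrightarrow> path P [f] Q"
  by (simp add: movesD)

text \<open>Replaces the indexed list of objects in the axiom on domains by a recursion along the
  word: facts on words then follow by induction, and chains are built one arrow at a time.\<close>

lemma dom_iff_path: "w \<in> pdom L \<longleftrightarrow> (\<exists>P Q. path P w Q)"
proof -
  have 1: "\<exists>Q. path (Ps ! 0) w Q"
    if "length Ps = Suc (length w)" "set Ps \<subseteq> \<Delta>" "set w \<subseteq> carrier L"
      "\<forall>i < length w. Ps ! i \<subseteq> conj_dom L (w ! i) \<and> pconj_set L (Ps ! i) (w ! i) = Ps ! Suc i" for Ps w
    using that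
  proof (induction w arbitrary: Ps)
    case Nil
    then show ?case by (cases Ps) auto
  next
    case (Cons f w)
    then obtain P Qs where Ps: "Ps = P # Qs" by (cases Ps) auto
    have "\<exists>Q. path (Qs ! 0) w Q"
    proof (rule Cons.IH)
      show "\<forall>i < length w. Qs ! i \<subseteq> conj_dom L (w ! i) \<and> pconj_set L (Qs ! i) (w ! i) = Qs ! Suc i"
      proof (intro allI impI)
        fix i assume "i < length w"
        then show "Qs ! i \<subseteq> conj_dom L (w ! i) \<and> pconj_set L (Qs ! i) (w ! i) = Qs ! Suc i"
          using Cons.prems(4)[rule_format, of "Suc i"] by (simp add: Ps)
      qed
    qed (use Cons.prems in \<open>auto simp: Ps\<close>)
    moreover have "moves P f (Qs ! 0)"
      using Cons.prems(1-3) Cons.prems(4)[rule_format, of 0] by (cases Qs) (auto simp: Ps moves_def)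
    ultimately show ?case by (auto simp: Ps)
  qed
  have 2: "set w \<subseteq> carrier L \<and> (\<exists>Ps. length Ps = Suc (length w) \<and> Ps ! 0 = P \<and> set Ps \<subseteq> \<Delta> \<and>
      (\<forall>i < length w. Ps ! i \<subseteq> conj_dom L (w ! i) \<and> pconj_set L (Ps ! i) (w ! i) = Ps ! Suc i))"
    if "path P w Q" for P w Q
    using that
  proof (induction w arbitrary: P)
    case Nil
    then show ?case by (auto intro!: exI[of _ "[P]"])
  next
    case (Cons f w)
    then obtain R where R: "moves P f R" "path R w Q" by auto
    from Cons.IH[OF R(2)] obtain Ps where Ps: "length Ps = Suc (length w)" "Ps ! 0 = R" "set Ps \<subseteq> \<Delta>"
      "\<forall>i < length w. Ps ! i \<subseteq> conj_dom L (w ! i) \<and> pconj_set L (Ps ! i) (w ! i) = Ps ! Suc i"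
        and w: "set w \<subseteq> carrier L"
      by blast
    have "\<forall>i < length (f # w). (P # Ps) ! i \<subseteq> conj_dom L ((f # w) ! i) \<and>
       pconj_set L ((P # Ps) ! i) ((f # w) ! i) = (P # Ps) ! Suc i"
      using Ps R by (auto simp: nth_Cons' moves_def)
    then show ?case using R Ps w movesD(1,3)[OF R(1)] by (intro conjI exI[of _ "P # Ps"]) auto
  qed
  show ?thesis
  proof
    assume w: "w \<in> pdom L"
    then have "w \<in> lists (carrier L)" using dom_words by blast
    with w dom_iff[OF this] 1[of _ w] show "\<exists>P Q. path P w Q" by (metis in_listsD subsetI)
  next
    assume "\<exists>P Q. path P w Q"
    then obtain P Q where "path P w Q" by blast
    from 2[OF this] show "w \<in> pdom L" using dom_iff[of w] by (auto simp: in_lists_conv_set)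
  qed
qed

lemma path_dom: "path P w Q \<Longrightarrow> w \<in> pdom L"
  using dom_iff_path by blast

lemma object_psubgroup: "P \<in> \<Delta> \<Longrightarrow> psubgroup L P" and object_subset: "P \<in> \<Delta> \<Longrightarrow> P \<subseteq> S"
  using objects_subgroups by auto

lemma S_psubgroup: "psubgroup L S"
  using S_p_subgroup by (simp add: p_subgroup_def)

lemma S_object: "S \<in> \<Delta>"
  using objects_nonempty objects_overgroups[OF _ S_psubgroup] object_subset by blast

lemma moves_inv:
  assumes "moves P f Q" shows "moves Q (pinv L f) P"
proof -
  have "pconj L x f \<in> conj_dom L (pinv L f)" "pconj L (pconj L x f) (pinv L f) = x" if "x \<in> P" for x
    using pconj_inv[OF movesD(4)[OF assms that]] by auto
  then show ?thesis using assms by (force simp: moves_def pconj_set_def inv_closed image_image)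
qed

lemma moves_self:
  assumes P: "P \<in> \<Delta>" "x \<in> P" shows "moves P x P"
proof -
  note P' = psubgroupD[OF object_psubgroup[OF P(1)]]
  have 1: "y \<in> conj_dom L z \<and> pconj L y z \<in> P" if "y \<in> P" "z \<in> P" for y z
    using P'(3)[OF that(2)] that P'(4)[of "[pinv L z, y, z]"] P'(5)[of "[pinv L z, y, z]"] P'(1)
    by (auto simp: pconj_def intro: conj_domI)
  have "y \<in> (\<lambda>y. pconj L y x) ` P" if "y \<in> P" for y
  proof -
    have "pconj L (pconj L y (pinv L x)) (pinv L (pinv L x)) = y" "pconj L y (pinv L x) \<in> P"
      using 1[OF that P'(3)[OF P(2)]] pconj_inv by blast+
    then show ?thesis using inv_inv P' P by (metis image_eqI subsetD)
  qed
  then show ?thesis using 1 P P' by (auto simp: moves_def pconj_set_def)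
qed

lemma moves_one: "P \<in> \<Delta> \<Longrightarrow> moves P (pone L) P"
  by (rule moves_self) (use object_psubgroup psubgroupD in auto)

lemma
  assumes f: "moves P f Q" and g: "moves Q g R"
  shows moves_mult: "moves P (f \<cdot> g) R"
    and pconj_mult: "\<And>x. x \<in> P \<Longrightarrow> pconj L x (f \<cdot> g) = pconj L (pconj L x f) g"
proof -
  have c: "f \<in> carrier L" "g \<in> carrier L" using movesD f g by auto
  have fg: "[f, g] \<in> pdom L" by (rule path_dom[OF path_ConsI[OF f path_oneI[OF g]]])
  have inv: "pinv L (f \<cdot> g) = pinv L g \<cdot> pinv L f"
    using inv_prod[OF fg] by (simp add: word_inv_def)
  have *: "x \<in> conj_dom L (f \<cdot> g) \<and> pconj L x (f \<cdot> g) = pconj L (pconj L x f) g"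
    if x: "x \<in> P" for x
  proof -
    \<comment> \<open>An element \<open>x\<close> of the object \<open>P\<close> is an arrow from
      \<open>P\<close> to itself, so it fits between the reversed chain and the chain of
      \<open>[f, g]\<close>.\<close>
    have w: "[pinv L g, pinv L f, x, f, g] \<in> pdom L"
      by (rule path_dom[OF path_ConsI[OF moves_inv[OF g] path_ConsI[OF moves_inv[OF f]
            path_ConsI[OF moves_self[OF movesD(1)[OF f] x] path_ConsI[OF f path_oneI[OF g]]]]]])
    have 1: "[pinv L g \<cdot> pinv L f, x, f, g] \<in> pdom L"
      "pprod L [pinv L g \<cdot> pinv L f, x, f, g] = pprod L [pinv L g, pinv L f, x, f, g]"
      using prod_assoc[of "[]" "[pinv L g, pinv L f]" "[x, f, g]"] w by simp_all
    have 2: "[pinv L g \<cdot> pinv L f, x, f \<cdot> g] \<in> pdom L"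
      "pprod L [pinv L g \<cdot> pinv L f, x, f \<cdot> g] = pprod L [pinv L g, pinv L f, x, f, g]"
      using prod_assoc[of "[pinv L g \<cdot> pinv L f, x]" "[f, g]" "[]"] 1 by simp_all
    have "pprod L [pinv L g, pinv L f, x, f, g] = pconj L (pconj L x f) g"
      using prod_assoc[of "[pinv L g]" "[pinv L f, x, f]" "[g]"] w by (simp add: pconj_def)
    with 2 show ?thesis using inv by (auto simp: pconj_def intro!: conj_domI)
  qed
  then show "\<And>x. x \<in> P \<Longrightarrow> pconj L x (f \<cdot> g) = pconj L (pconj L x f) g" by blast
  have "pconj_set L P (f \<cdot> g) = (\<lambda>x. pconj L (pconj L x f) g) ` P"
    using * by (simp add: pconj_set_def)
  also have "\<dots> = R" using moves_image[OF f] moves_image[OF g] by (simp add: image_image)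
  finally show "moves P (f \<cdot> g) R"
    using * prod_closed[OF fg] movesD(1)[OF f] movesD(2)[OF g] by (auto simp: moves_def)
qed

lemma path_prod: "path P w Q \<Longrightarrow> moves P (pprod L w) Q"
proof (induction w arbitrary: P)
  case Nil
  then show ?case using moves_one by (auto simp: pone_def)
next
  case (Cons f w)
  then obtain R where R: "moves P f R" "path R w Q" by auto
  have "pprod L (f # w) = f \<cdot> pprod L w"
    using prod_assoc[of "[f]" w "[]"] path_dom[OF Cons.prems] by simp
  then show ?case using moves_mult[OF R(1) Cons.IH[OF R(2)]] by simp
qed

lemma moves_mult_dom: "moves P f Q \<Longrightarrow> moves Q g R \<Longrightarrow> [f, g] \<in> pdom L"
  by (rule path_dom[OF path_ConsI[OF _ path_oneI]])

lemma
  assumes "moves P f Q" "moves Q g R" "moves R h T"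
  shows moves_assoc: "f \<cdot> g \<cdot> h = f \<cdot> (g \<cdot> h)"
    and moves_assoc3: "pprod L [f, g, h] = f \<cdot> g \<cdot> h"
proof -
  have "[f, g, h] \<in> pdom L"
    by (rule path_dom[OF path_ConsI[OF assms(1) path_ConsI[OF assms(2) path_oneI[OF assms(3)]]]])
  then show "f \<cdot> g \<cdot> h = f \<cdot> (g \<cdot> h)"
    "pprod L [f, g, h] = f \<cdot> g \<cdot> h"
    using prod_assoc[of "[]" "[f, g]" "[h]"] prod_assoc[of "[f]" "[g, h]" "[]"] by simp_all
qed

lemma moves_cancel_left:
  assumes "moves P f Q" "moves Q g R" shows "pinv L f \<cdot> (f \<cdot> g) = g"
  using moves_assoc[OF moves_inv[OF assms(1)] assms]
    by (simp add: inv_left one_left assms[THEN movesD(3)])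

lemma moves_cancel_left':
  assumes "moves P f Q" "moves P g R" shows "f \<cdot> (pinv L f \<cdot> g) = g"
  using moves_cancel_left[OF moves_inv[OF assms(1)] assms(2)]
    by (simp add: inv_inv assms[THEN movesD(3)])

lemma moves_cancel_right:
  assumes "moves P g Q" "moves Q f R" shows "g \<cdot> f \<cdot> pinv L f = g"
  using moves_assoc[OF assms moves_inv[OF assms(2)]]
    by (simp add: inv_right one_right assms[THEN movesD(3)])

lemma moves_cancel_right':
  assumes "moves P g Q" "moves R f Q" shows "g \<cdot> pinv L f \<cdot> f = g"
  using moves_cancel_right[OF assms(1) moves_inv[OF assms(2)]]
    by (simp add: inv_inv assms[THEN movesD(3)])

lemma moves_conj:
  assumes "moves P x P'" "moves P f Q" "moves P' f Q'"
  shows "x \<in> conj_dom L f" "moves Q (pconj L x f) Q'" "pconj L x f = pinv L f \<cdot> x \<cdot> f"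
proof -
  have p: "path Q [pinv L f, x, f] Q'"
    by (rule path_ConsI[OF moves_inv[OF assms(2)] path_ConsI[OF assms(1) path_oneI[OF assms(3)]]])
  show "x \<in> conj_dom L f" using path_dom[OF p] by (rule conj_domI)
  show "moves Q (pconj L x f) Q'" using path_prod[OF p] by (simp add: pconj_def)
  show "pconj L x f = pinv L f \<cdot> x \<cdot> f"
    using moves_assoc3[OF moves_inv[OF assms(2)] assms(1,3)] by (simp add: pconj_def)
qed

lemma normalizer_iff: "P \<in> \<Delta> \<Longrightarrow> f \<in> pnormalizer L P \<longleftrightarrow> moves P f P"
  by (auto simp: pnormalizer_def moves_def)

lemma normalizer_psubgroup:
  assumes P: "P \<in> \<Delta>" shows "psubgroup L (pnormalizer L P)"
proof -
  have p: "path P w P" if "set w \<subseteq> pnormalizer L P" for w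
    using that by (induction w) (use P normalizer_iff in auto)
  have "w \<in> pdom L" "pprod L w \<in> pnormalizer L P" if "w \<in> lists (pnormalizer L P)" for w
    using path_dom[OF p] path_prod[OF p] that normalizer_iff[OF P] by auto
  moreover have "pone L \<in> pnormalizer L P" "pnormalizer L P \<subseteq> carrier L"
    "\<And>f. f \<in> pnormalizer L P \<Longrightarrow> pinv L f \<in> pnormalizer L P"
    using moves_one[OF P] moves_inv[of P _ P] by (auto simp: normalizer_iff[OF P] dest: movesD(3))
  ultimately show ?thesis by (auto simp: psubgroup_def partial_subgroup_def)
qed

text \<open>The set usually written \<open>S\<^sub>f\<close>.\<close>

definition Sdom :: "'a \<Rightarrow> 'a set" where
  "Sdom f = {s \<in> S. s \<in> conj_dom L f \<and> pconj L s f \<in> S}"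

lemma Sdom_subset: "Sdom f \<subseteq> S"
  by (auto simp: Sdom_def)

lemma moves_subset_Sdom: "moves P f Q \<Longrightarrow> P \<subseteq> Sdom f"
  using object_subset[of P] object_subset[of Q] by (auto simp: Sdom_def moves_def pconj_set_def)

lemma moves_exists: "f \<in> carrier L \<Longrightarrow> \<exists>P Q. moves P f Q"
  using dom_single dom_iff_path[of "[f]"] by auto

lemma pconj_S_psubgroup:
  assumes "P \<subseteq> S" "psubgroup L P" "P \<subseteq> conj_dom L f" "pconj_set L P f \<subseteq> S"
    "\<And>x y. x \<in> P \<Longrightarrow> y \<in> P \<Longrightarrow> pconj L (x \<cdot> y) f = pconj L x f \<cdot> pconj L y f"
    "f \<in> carrier L"
  shows "psubgroup L (pconj_set L P f)"
proof (rule psubgroupI_sub[OF S_psubgroup assms(4)])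
  note P = psubgroupD[OF assms(2)]
  show "pone L \<in> pconj_set L P f" using pconj_one[OF assms(6)] P(6)
    by (auto simp: pconj_set_def intro: rev_image_eqI)
  show "pinv L x \<in> pconj_set L P f" if "x \<in> pconj_set L P f" for x
    using that P(3) assms(3) by (auto simp: pconj_set_def pconj_inverse_elem(2)[symmetric])
  show "x \<cdot> y \<in> pconj_set L P f" if "x \<in> pconj_set L P f" "y \<in> pconj_set L P f" for x y
    using that P(5)[of "[_, _]"] by (auto simp: pconj_set_def assms(5)[symmetric])
qed

text \<open>Closure of the objects under conjugation asks first that the conjugate be a subgroup.
  Inside the group \<open>S\<close> conjugation by \<open>s\<close> is a homomorphism, which settles
  this.\<close>

lemma moves_S:
  assumes P: "P \<in> \<Delta>" and s: "s \<in> S" shows "moves P s (pconj_set L P s)"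
proof -
  have sc: "s \<in> carrier L" using psubgroupD(1)[OF S_psubgroup] s by blast
  have S: "moves S s S" using moves_self[OF S_object s] .
  have PS: "P \<subseteq> S" using object_subset[OF P] .
  have dom: "P \<subseteq> conj_dom L s" "pconj_set L P s \<subseteq> S" using S PS movesD by (auto simp: pconj_set_def)
  have "pconj L (x \<cdot> y) s = pconj L x s \<cdot> pconj L y s" if "x \<in> P" "y \<in> P" for x y
  proof -
    interpret G: group "grp L S" by (rule psubgroup_group[OF S_psubgroup])
    have xy: "x \<in> S" "y \<in> S" using that PS by auto
    have i: "pinv L s \<in> S" using psubgroupD(3)[OF S_psubgroup] s by blast
    have c: "pconj L u s = inv\<^bsub>grp L S\<^esub> s \<otimes>\<^bsub>grp L S\<^esub> u \<otimes>\<^bsub>grp L S\<^esub> s" if "u \<in> S" for u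
      using psubgroup_assoc(1)[OF S_psubgroup i that s] grp_inv[OF S_psubgroup s]
        by (simp add: pconj_def grp_def)
    have cc: "x \<in> carrier (grp L S)" "y \<in> carrier (grp L S)" "s \<in> carrier (grp L S)" using xy s
      by (auto simp: grp_def)
    have m: "u \<cdot> v = u \<otimes>\<^bsub>grp L S\<^esub> v" for u v by (simp add: grp_def)
    have xyS: "x \<otimes>\<^bsub>grp L S\<^esub> y \<in> S" using G.m_closed[OF cc(1,2)] by (simp add: grp_def)
    have e: "a \<otimes>\<^bsub>grp L S\<^esub> (inv\<^bsub>grp L S\<^esub> a \<otimes>\<^bsub>grp L S\<^esub> b) = b"
      if "a \<in> carrier (grp L S)" "b \<in> carrier (grp L S)" for a b
      using that by (simp add: G.m_assoc[symmetric])
    show ?thesis unfolding m c[OF xy(1)] c[OF xy(2)] c[OF xyS] using cc by (simp add: G.m_assoc e)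
  qed
  from pconj_S_psubgroup[OF PS object_psubgroup[OF P] dom this sc]
  show ?thesis using objects_conj[OF P sc dom(1) _ dom(2)] P sc dom by (auto simp: moves_def)
qed

text \<open>\<open>f\<close> equals the product of its conjugating word
  \<open>[pinv L x, f, pconj L x f]\<close>, whose letters carry the conjugate of \<open>P\<close>
  back to \<open>P\<close>, then to \<open>Q\<close>, then on to the conjugate of
  \<open>Q\<close>.\<close>

lemma moves_shift:
  assumes x: "x \<in> Sdom f" and moves: "moves P f Q"
  shows "moves (pconj_set L P x) f (pconj_set L Q (pconj L x f))"
proof -
  have xS: "x \<in> S" "x \<in> conj_dom L f" "pconj L x f \<in> S" using x by (auto simp: Sdom_def)
  have c: "x \<in> carrier L" "f \<in> carrier L" using conj_domD[OF xS(2)] by auto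
  define x' where "x' = pconj L x f"
  have 1: "moves (pconj_set L P x) (pinv L x) P" using moves_inv moves_S movesD(1)[OF moves] xS by blast
  have 2: "moves Q x' (pconj_set L Q x')" using moves_S movesD(2)[OF moves] xS by (simp add: x'_def)
  have p: "path (pconj_set L P x) [pinv L x, f, x'] (pconj_set L Q x')"
    by (rule path_ConsI[OF 1 path_ConsI[OF moves path_oneI[OF 2]]])
  \<comment> \<open>The chain on which the conjugate of \<open>x\<close> is defined is unrelated to
    \<open>P\<close> and \<open>Q\<close>; it only serves to show that the product is
    \<open>f\<close>.\<close>
  obtain A B C D where A: "moves A (pinv L f) B" "moves B x C" "moves C f D"
    using conj_domD[OF xS(2)] dom_iff_path[of "[pinv L f, x, f]"] by auto
  have A': "moves C (pinv L x) B" "moves B f A" using moves_inv[OF A(2)] moves_inv[OF A(1)] c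
    by (auto simp: inv_inv)
  have w: "[pinv L x, f, pinv L f, x, f] \<in> pdom L"
    by (rule path_dom[OF path_ConsI[OF A'(1) path_ConsI[OF A'(2) path_ConsI[OF A(1) path_ConsI[OF A(2)
      path_oneI[OF A(3)]]]]]])
  have 3: "pprod L [pinv L x, f, pinv L f, x, f] = pprod L [pinv L x, f, x']"
    using prod_assoc[of "[pinv L x, f]" "[pinv L f, x, f]" "[]"] w by (simp add: x'_def pconj_def)
  have w2: "[pinv L x, x, f] \<in> pdom L"
    by (rule path_dom[OF path_ConsI[OF A'(1) path_ConsI[OF A(2) path_oneI[OF A(3)]]]])
  have "pprod L [pinv L x, f, pinv L f, x, f] = pprod L [pinv L x, x, f]"
    using prod_assoc[of "[pinv L x]" "[f, pinv L f]" "[x, f]"] w prod_unit[of "[pinv L x]" "[x, f]"] w2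
    by (simp add: inv_right c)
  also have "\<dots> = f"
    using prod_assoc[of "[]" "[pinv L x, x]" "[f]"] w2 by (simp add: inv_left one_left c)
  finally have "pprod L [pinv L x, f, x'] = f" using 3 by simp
  then show ?thesis using path_prod[OF p] by (simp add: x'_def)
qed

text \<open>The conjugates of \<open>x\<close> and of \<open>y\<close> may be witnessed by different
  chains of objects. Shifting one arrow of \<open>f\<close> by \<open>x\<close> and then by
  \<open>y\<close> yields a single chain on which both conjugations are performed in succession, and
  there the inner factors \<open>f\<close> and its inverse cancel.\<close>

lemma Sdom_mult:
  assumes x: "x \<in> Sdom f" and y: "y \<in> Sdom f"
  shows "x \<cdot> y \<in> Sdom f" "pconj L (x \<cdot> y) f = pconj L x f \<cdot> pconj L y f"
proof -
  have c: "x \<in> S" "y \<in> S" "x \<in> carrier L" "f \<in> carrier L" "y \<in> carrier L" "pconj L x f \<in> S"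
    "pconj L y f \<in> S"
    using conj_domD x y by (auto simp: Sdom_def)
  obtain P Q where PQ: "moves P f Q" using moves_exists[OF c(4)] by blast
  have x1: "moves P x (pconj_set L P x)" using moves_S movesD PQ c by blast
  note x2 = moves_shift[OF x PQ]
  have y1: "moves (pconj_set L P x) y (pconj_set L (pconj_set L P x) y)" using moves_S movesD(2)[OF x1] c
    by blast
  note y2 = moves_shift[OF y x2]
  have p: "path Q [pinv L f, x, f, pinv L f, y, f] (pconj_set L (pconj_set L Q (pconj L x f)) (pconj L y f))"
    by (rule path_ConsI[OF moves_inv[OF PQ] path_ConsI[OF x1 path_ConsI[OF x2 path_ConsI[OF moves_inv[OF x2]
          path_ConsI[OF y1 path_oneI[OF y2]]]]]])
  have p': "path Q [pinv L f, x, y, f] (pconj_set L (pconj_set L Q (pconj L x f)) (pconj L y f))"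
    by (rule path_ConsI[OF moves_inv[OF PQ] path_ConsI[OF x1 path_ConsI[OF y1 path_oneI[OF y2]]]])
  note w = path_dom[OF p] and w' = path_dom[OF p']
  have 1: "pprod L [pinv L f, x, f, pinv L f, y, f] = pprod L [pinv L f, x, y, f]"
    using prod_assoc[of "[pinv L f, x]" "[f, pinv L f]" "[y, f]"] w prod_unit[of "[pinv L f, x]"
      "[y, f]"] w'
    by (simp add: inv_right c)
  have 2: "[pinv L f, x \<cdot> y, f] \<in> pdom L"
    "pprod L [pinv L f, x \<cdot> y, f] = pprod L [pinv L f, x, y, f]"
    using prod_assoc[of "[pinv L f]" "[x, y]" "[f]"] w' by auto
  have 3: "[pconj L x f, pinv L f, y, f] \<in> pdom L"
     "pprod L [pinv L f, x, f, pinv L f, y, f] = pprod L [pconj L x f, pinv L f, y, f]"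
    using prod_assoc[of "[]" "[pinv L f, x, f]" "[pinv L f, y, f]"] w by (simp_all add: pconj_def)
  have 4: "pprod L [pconj L x f, pinv L f, y, f] = pconj L x f \<cdot> pconj L y f"
    using prod_assoc[of "[pconj L x f]" "[pinv L f, y, f]" "[]"] 3 by (simp_all add: pconj_def)
  show e: "pconj L (x \<cdot> y) f = pconj L x f \<cdot> pconj L y f"
    using 1 2 3 4 by (simp add: pconj_def)
  show "x \<cdot> y \<in> Sdom f"
    using 2 c e psubgroupD(5)[OF S_psubgroup, of "[_, _]"] by (auto simp: Sdom_def intro: conj_domI)
qed

lemma Sdom_psubgroup: "f \<in> carrier L \<Longrightarrow> psubgroup L (Sdom f)"
  by (rule psubgroupI_sub[OF S_psubgroup])
    (auto simp: Sdom_def pconj_one pconj_inverse_elem psubgroupD[OF S_psubgroup]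
      Sdom_mult[unfolded Sdom_def, simplified])

lemma Sdom_object: "f \<in> carrier L \<Longrightarrow> Sdom f \<in> \<Delta>"
proof -
  assume f: "f \<in> carrier L"
  then obtain P Q where "moves P f Q" using moves_exists by blast
  from objects_overgroups[OF movesD(1)[OF this] Sdom_psubgroup[OF f] moves_subset_Sdom[OF this]]
  show ?thesis using Sdom_subset by blast
qed

text \<open>Turns an inclusion of subsets of \<open>S\<close> into an arrow: by
  \<open>Sdom_mult\<close> the image is a subgroup, so it is an object.\<close>

lemma moves_Sdom:
  assumes f: "f \<in> carrier L" and P: "P \<in> \<Delta>" "P \<subseteq> Sdom f"
  shows "moves P f (pconj_set L P f)"
proof -
  have 1: "P \<subseteq> conj_dom L f" "pconj_set L P f \<subseteq> S" using P(2) by (auto simp: Sdom_def pconj_set_def)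
  have "psubgroup L (pconj_set L P f)"
    by (rule pconj_S_psubgroup[OF object_subset[OF P(1)] object_psubgroup[OF P(1)] 1 _ f])
      (use P(2) Sdom_mult(2) in blast)
  then show ?thesis using objects_conj[OF P(1) f 1(1) _ 1(2)] P(1) f 1 by (auto simp: moves_def)
qed

lemma Sdom_S: "s \<in> S \<Longrightarrow> Sdom s = S"
  using moves_subset_Sdom[OF moves_self[OF S_object]] Sdom_subset by blast

lemma finite_S: "finite S"
  using finite_subset[OF psubgroupD(1)[OF S_psubgroup] finite_carrier] .

lemma finite_object: "P \<in> \<Delta> \<Longrightarrow> finite P"
  using finite_subset object_subset finite_S by blast

lemma card_object: "prime p \<Longrightarrow> psubgroup L P \<Longrightarrow> P \<subseteq> S \<Longrightarrow> \<exists>n. card P = p ^ n"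
proof -
  assume p: "prime p" and P: "psubgroup L P" "P \<subseteq> S"
  interpret G: group "grp L S" by (rule psubgroup_group[OF S_psubgroup])
  have "subgroup P (grp L S)" using subgroup_grp_iff[OF S_psubgroup] P by blast
  then have "card P dvd card S" using G.lagrange
    by (metis dvd_triv_right order_def partial_object.select_convs(1) grp_def)
  then show ?thesis using S_p_subgroup divides_primepow_nat[OF p] by (metis p_subgroup_def)
qed

end

section \<open>Signalizer functors\<close>

context locality
begin

lemma pcentralizerD: "f \<in> pcentralizer L H \<Longrightarrow> x \<in> H \<Longrightarrow> x \<in> conj_dom L f"
  "f \<in> pcentralizer L H \<Longrightarrow> x \<in> H \<Longrightarrow> pconj L x f = x" "f \<in> pcentralizer L H \<Longrightarrow> f \<in> carrier L"
  by (auto simp: pcentralizer_def)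

lemma pcentralizer_mono: "f \<in> pcentralizer L H \<Longrightarrow> K \<subseteq> H \<Longrightarrow> f \<in> pcentralizer L K"
  by (auto simp: pcentralizer_def)

lemma pcentralizer_moves: "P \<in> \<Delta> \<Longrightarrow> f \<in> pcentralizer L P \<Longrightarrow> moves P f P"
  by (auto simp: pcentralizer_def moves_def pconj_set_def)

lemma pcentralizer_inv: "f \<in> pcentralizer L H \<Longrightarrow> pinv L f \<in> pcentralizer L H"
  using pconj_inv inv_closed by (force simp: pcentralizer_def)

lemma pconj_by_one:
  assumes "x \<in> carrier L" shows "x \<in> conj_dom L (pone L)" "pconj L x (pone L) = x"
  using dom_unit[of "[pone L, x]" "[]"] prod_unit[of "[pone L, x]"
    "[]"] dom_one_left[OF assms] one_left[OF assms]
  by (auto simp: pconj_def intro: conj_domI)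

text \<open>The centralizer of \<open>f\<close> in \<open>S\<close>, seen from \<open>f\<close>: for
  \<open>f\<close> in \<open>L\<close> and \<open>Q \<subseteq> S\<close>, containment of
  \<open>Q\<close> in this set amounts to \<open>f \<in> pcentralizer L Q\<close>.\<close>

definition Sfix :: "'a \<Rightarrow> 'a set" where
  "Sfix f = {s \<in> Sdom f. pconj L s f = s}"

lemma Sfix_psubgroup:
  assumes f: "f \<in> carrier L" shows "psubgroup L (Sfix f)"
proof (rule psubgroupI_sub[OF Sdom_psubgroup[OF f]])
  note D = psubgroupD[OF Sdom_psubgroup[OF f]]
  show "Sfix f \<subseteq> Sdom f" by (auto simp: Sfix_def)
  show "pone L \<in> Sfix f" using D(6) pconj_one[OF f] by (auto simp: Sfix_def)
  show "pinv L x \<in> Sfix f" if "x \<in> Sfix f" for x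
    using that D(3) pconj_inverse_elem(2)[of x f] by (auto simp: Sfix_def Sdom_def)
  show "x \<cdot> y \<in> Sfix f" if "x \<in> Sfix f" "y \<in> Sfix f" for x y
    using that Sdom_mult[of x f y] by (auto simp: Sfix_def)
qed

lemma Sfix_pcentralizer: "f \<in> carrier L \<Longrightarrow> Q \<subseteq> Sfix f \<Longrightarrow> f \<in> pcentralizer L Q"
  by (auto simp: pcentralizer_def Sfix_def Sdom_def)

lemma pcentralizer_Sfix: "Q \<subseteq> S \<Longrightarrow> f \<in> pcentralizer L Q \<Longrightarrow> Q \<subseteq> Sfix f"
  by (auto simp: pcentralizer_def Sfix_def Sdom_def)

lemma moves_mono: "moves P f Q \<Longrightarrow> P' \<in> \<Delta> \<Longrightarrow> P' \<subseteq> P \<Longrightarrow> moves P' f (pconj_set L P' f)"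
  using moves_Sdom moves_subset_Sdom movesD(3) by blast

lemma pconj_pow:
  assumes "x \<in> Sdom f"
  shows "x [^]\<^bsub>grp L S\<^esub> (n::nat) \<in> Sdom f \<and> pconj L (x [^]\<^bsub>grp L S\<^esub> n) f = (pconj L x f) [^]\<^bsub>grp L S\<^esub> n"
proof (induction n)
  case 0
  have "f \<in> carrier L" using assms conj_domD by (auto simp: Sdom_def)
  then show ?case using pconj_one psubgroupD(6)[OF Sdom_psubgroup] by (simp add: nat_pow_def grp_def)
next
  case (Suc n)
  then show ?case using Sdom_mult[of "x [^]\<^bsub>grp L S\<^esub> n" f x] assms
    by (simp add: nat_pow_def grp_def)
qed

lemma normalizer_grows:
  assumes p: "prime p" and Q: "Q \<in> \<Delta>" and U: "psubgroup L U" "U \<subseteq> S" "Q \<subseteq> U" "Q \<noteq> U"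
  obtains s where "s \<in> U" "s \<notin> Q" "moves Q s Q"
proof -
  interpret G: group "grp L U" by (rule psubgroup_group[OF U(1)])
  obtain n where n: "card U = p ^ n" using card_object[OF p U(1,2)] by blast
  have sub: "subgroup Q (grp L U)" using subgroup_grp_iff[OF U(1)] object_psubgroup[OF Q] U(3) by blast
  obtain s where s: "s \<in> carrier (grp L U)" "s \<notin> Q"
     "\<And>h. h \<in> Q \<Longrightarrow> s \<otimes>\<^bsub>grp L U\<^esub> h \<otimes>\<^bsub>grp L U\<^esub> inv\<^bsub>grp L U\<^esub> s \<in> Q"
    using G.p_group_normalizer_grows[OF p _ sub] n U(4) by (auto simp: grp_def)
  have sU: "s \<in> U" using s(1) by (simp add: grp_def)
  have sc: "s \<in> carrier L" using psubgroupD(1)[OF U(1)] sU by blast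
  have i: "pinv L s \<in> U" using psubgroupD(3)[OF U(1)] sU by blast
  \<comment> \<open>The group lemma conjugates with the inverse on the right; in the convention of
    \<open>pconj\<close> this is conjugation by the inverse of \<open>s\<close>.\<close>
  have t: "moves Q (pinv L s) (pconj_set L Q (pinv L s))" by (rule moves_S[OF Q]) (use i U in auto)
  have "pconj L h (pinv L s) \<in> Q" if h: "h \<in> Q" for h
  proof -
    have "h \<in> U" using h U(3) by blast
    then have "pconj L h (pinv L s) = s \<otimes>\<^bsub>grp L U\<^esub> h \<otimes>\<^bsub>grp L U\<^esub> inv\<^bsub>grp L U\<^esub> s"
      using psubgroup_assoc(1)[OF U(1) sU _ i, of h] grp_inv[OF U(1) sU] sc inv_inv
        by (simp add: pconj_def grp_def)
    then show ?thesis using s(3)[OF h] by simp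
  qed
  then have sub: "pconj_set L Q (pinv L s) \<subseteq> Q" by (auto simp: pconj_set_def)
  have "pconj_set L Q (pinv L s) = Q"
    using t by (intro card_subset_eq[OF finite_object[OF Q] sub] card_pconj_set) (simp add: moves_def)
  then have "moves Q s Q" using moves_inv[of Q "pinv L s" Q] t inv_inv sc by simp
  then show ?thesis using that sU s(2) by blast
qed

end

locale signalizer = locality p L \<Delta> S for p and L :: "'a pgroup" and \<Delta> S +
  fixes \<theta> :: "'a \<Rightarrow> 'a set"
  assumes p_prime: "prime p"
    and objects_def: "\<Delta> = {P. psubgroup L P \<and> P \<subseteq> S \<and> P \<noteq> {pone L}}"
    and sig: "signalizer_functor p L S \<theta>"
begin

abbreviation "Th \<equiv> Theta p L \<theta>"
abbreviation "I \<equiv> order_p_elems p L"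

lemma object_iff: "P \<in> \<Delta> \<longleftrightarrow> psubgroup L P \<and> P \<subseteq> S \<and> P \<noteq> {pone L}"
  by (simp add: objects_def)

text \<open>Measures the order by powers in \<open>S\<close>, so that \<open>P\<close> enters only
  through membership and orders can be compared between subgroups.\<close>

lemma order_p_iff:
  assumes "psubgroup L P"
  shows "x \<in> I P \<longleftrightarrow> x \<in> P \<and> x \<noteq> pone L \<and> x [^]\<^bsub>grp L S\<^esub> p = pone L"
proof -
  interpret G: group "grp L P" by (rule psubgroup_group[OF assms])
  have one: "\<one>\<^bsub>grp L P\<^esub> = pone L" by (simp add: grp_def)
  show ?thesis
  proof (cases "x \<in> P")
    case True
    then have x: "x \<in> carrier (grp L P)" by (simp add: grp_def)
    have "G.ord x = p \<longleftrightarrow> x \<noteq> pone L \<and> x [^]\<^bsub>grp L P\<^esub> p = pone L"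
      using G.pow_eq_id[OF x, of p] G.ord_eq_1[OF x] p_prime unfolding one
      by (metis dvd_refl not_prime_1 prime_nat_iff)
    then show ?thesis using True grp_pow[where H = P and K = S] by (auto simp: order_p_elems_def)
  qed (simp add: order_p_elems_def)
qed

lemma order_p_mono: "psubgroup L P \<Longrightarrow> psubgroup L Q \<Longrightarrow> P \<subseteq> Q \<Longrightarrow> x \<in> I P \<Longrightarrow> x \<in> I Q"
  by (auto simp: order_p_iff)

lemma order_p_S: "P \<in> \<Delta> \<Longrightarrow> x \<in> I P \<Longrightarrow> x \<in> I S"
  using order_p_mono[OF object_psubgroup S_psubgroup object_subset] by blast

lemma order_p_subset: "x \<in> I P \<Longrightarrow> x \<in> P"
  by (simp add: order_p_elems_def)

lemma order_p_object: "psubgroup L P \<Longrightarrow> P \<subseteq> S \<Longrightarrow> x \<in> I S \<Longrightarrow> x \<in> P \<Longrightarrow> P \<in> \<Delta> \<and> x \<in> I P"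
  by (auto simp: object_iff order_p_iff S_psubgroup)

lemma order_p_central:
  assumes Q: "Q \<in> \<Delta>"
  obtains z where "z \<in> I Q" "\<And>g. g \<in> Q \<Longrightarrow> g \<cdot> z = z \<cdot> g"
proof -
  interpret G: group "grp L Q" by (rule psubgroup_group[OF object_psubgroup[OF Q]])
  obtain n where n: "card Q = p ^ n" using card_object[OF p_prime object_psubgroup object_subset] Q
    by blast
  have "card (carrier (grp L Q)) = p ^ n" "carrier (grp L Q) \<noteq> {\<one>\<^bsub>grp L Q\<^esub>}"
    using n Q by (simp_all add: grp_def object_iff)
  then obtain z where "z \<in> carrier (grp L Q)" "G.ord z = p"
      "\<And>g. g \<in> carrier (grp L Q) \<Longrightarrow> g \<otimes>\<^bsub>grp L Q\<^esub> z = z \<otimes>\<^bsub>grp L Q\<^esub> g"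
    using G.p_group_central_element[OF p_prime] by metis
  with that show ?thesis by (auto simp: grp_def order_p_elems_def)
qed

lemma commutator_one:
  assumes "x \<in> S" "y \<in> S" "x \<cdot> y = y \<cdot> x"
  shows "pprod L [pinv L x, pinv L y, x, y] = pone L"
proof -
  note S' = psubgroupD[OF S_psubgroup]
  have i: "pinv L x \<in> S" "pinv L y \<in> S" using S' assms by auto
  have w: "[pinv L x, pinv L y, x, y] \<in> pdom L" using i assms S' by simp
  have "pprod L [pinv L x, pinv L y, x, y] = pprod L [pinv L x \<cdot> pinv L y, x, y]"
    "[pinv L x \<cdot> pinv L y, x, y] \<in> pdom L"
    using prod_assoc[of "[]" "[pinv L x, pinv L y]" "[x, y]"] w by simp_all
  moreover from this have "pprod L [pinv L x \<cdot> pinv L y, x, y] = pinv L x \<cdot> pinv L y \<cdot> (x \<cdot> y)"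
    using prod_assoc[of "[pinv L x \<cdot> pinv L y]" "[x, y]" "[]"] by simp
  moreover have "pinv L x \<cdot> pinv L y = pinv L (y \<cdot> x)"
    using inv_prod[of "[y, x]"] S'(4)[of "[y, x]"] assms by (simp add: word_inv_def)
  ultimately show ?thesis using assms inv_left[of "y \<cdot> x"] S'(1) S'(5)[of "[y, x]"] by auto
qed

lemma balance:
  assumes "a \<in> I S" "b \<in> I S" "a \<cdot> b = b \<cdot> a" "f \<in> \<theta> a" "f \<in> pcentralizer L {b}"
  shows "f \<in> \<theta> b"
  using sig commutator_one[of a b] assms order_p_subset unfolding signalizer_functor_def by blast

lemma theta_normal: "a \<in> I S \<Longrightarrow> \<theta> a \<lhd> grp L (pcentralizer L {a})"
  and theta_card: "a \<in> I S \<Longrightarrow> \<not> p dvd card (\<theta> a)"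
  using sig unfolding signalizer_functor_def by blast+

lemma theta_conj: "a \<in> I S \<Longrightarrow> g \<in> carrier L \<Longrightarrow> a \<in> conj_dom L g \<Longrightarrow> pconj L a g \<in> S \<Longrightarrow>
     \<theta> a \<subseteq> conj_dom L g \<and> \<theta> (pconj L a g) = pconj_set L (\<theta> a) g"
  using sig unfolding signalizer_functor_def by blast

lemma
  assumes a: "a \<in> I S"
  shows theta_subset: "\<theta> a \<subseteq> pcentralizer L {a}"
    and theta_one: "pone L \<in> \<theta> a"
    and theta_mult: "\<And>x y. x \<in> \<theta> a \<Longrightarrow> y \<in> \<theta> a \<Longrightarrow> x \<cdot> y \<in> \<theta> a"
    and theta_inv: "\<And>x. x \<in> \<theta> a \<Longrightarrow> pinv L x \<in> \<theta> a"
    and theta_group: "group (grp L (\<theta> a))"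
proof -
  interpret N: normal "\<theta> a" "grp L (pcentralizer L {a})" by (rule theta_normal[OF a])
  show 1: "\<theta> a \<subseteq> pcentralizer L {a}" using N.subset by (simp add: grp_def)
  show "pone L \<in> \<theta> a" using subgroup.one_closed[OF N.subgroup_axioms] by (simp add: grp_def)
  show "x \<cdot> y \<in> \<theta> a" if "x \<in> \<theta> a" "y \<in> \<theta> a" for x y using subgroup.m_closed[OF N.subgroup_axioms that]
    by (simp add: grp_def)
  show "group (grp L (\<theta> a))" using N.subgroup_is_group[OF N.is_group] by (simp add: grp_def)
  fix x assume x: "x \<in> \<theta> a"
  have "inv\<^bsub>grp L (pcentralizer L {a})\<^esub> x = pinv L x"
    by (rule N.inv_equality) (use x 1 pcentralizer_inv inv_left pcentralizerD(3) in \<open>auto simp: grp_def\<close>)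
  then show "pinv L x \<in> \<theta> a" using subgroup.m_inv_closed[OF N.subgroup_axioms x] by simp
qed

text \<open>Two elements \<open>x\<close> and \<open>y\<close> of order \<open>p\<close> in
  \<open>Q\<close> need not commute, so balance does not apply to them directly. It applies twice
  through a central element \<open>z\<close>: from \<open>x\<close> to \<open>z\<close>, then from
  \<open>z\<close> to \<open>y\<close>.\<close>

lemma theta_in_Theta:
  assumes Q: "Q \<in> \<Delta>" "x \<in> I Q" and f: "f \<in> \<theta> x" "f \<in> pcentralizer L Q"
  shows "f \<in> Th Q"
proof -
  obtain z where z: "z \<in> I Q" "\<And>g. g \<in> Q \<Longrightarrow> g \<cdot> z = z \<cdot> g"
    using order_p_central[OF Q(1)] by metis
  have c: "f \<in> pcentralizer L {y}" if "y \<in> I Q" for y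
    using pcentralizer_mono[OF f(2)] order_p_subset[OF that] by blast
  have fz: "f \<in> \<theta> z"
    by (rule balance[OF _ _ _ f(1) c[OF z(1)]]) (use z Q order_p_S order_p_subset in blast)+
  have "f \<in> \<theta> y" if y: "y \<in> I Q" for y
    by (rule balance[OF _ _ _ fz c[OF y]]) (use z(1) z(2)[OF order_p_subset[OF y]] y Q order_p_S in auto)
  then show ?thesis using f(2) by (simp add: Theta_def)
qed

lemma Theta_theta: "n \<in> Th P \<Longrightarrow> x \<in> I P \<Longrightarrow> n \<in> \<theta> x"
  and Theta_cent: "n \<in> Th P \<Longrightarrow> n \<in> pcentralizer L P"
  by (auto simp: Theta_def)

lemma Theta_carrier: "n \<in> Th P \<Longrightarrow> n \<in> carrier L"
  using Theta_cent pcentralizerD(3) by blast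

lemma Theta_antimono:
  assumes "P \<in> \<Delta>" "Q \<in> \<Delta>" "P \<subseteq> Q" "n \<in> Th Q" shows "n \<in> Th P"
  using assms order_p_mono[OF object_psubgroup object_psubgroup] pcentralizer_mono
  by (auto simp: Theta_def)

lemma Theta_moves: "P \<in> \<Delta> \<Longrightarrow> n \<in> Th P \<Longrightarrow> moves P n P"
  using Theta_cent pcentralizer_moves by blast

lemma Theta_pconj: "n \<in> Th P \<Longrightarrow> x \<in> P \<Longrightarrow> pconj L x n = x"
  using Theta_cent pcentralizerD by blast

lemma Theta_one: "P \<in> \<Delta> \<Longrightarrow> pone L \<in> Th P"
  and Theta_inv: "P \<in> \<Delta> \<Longrightarrow> n \<in> Th P \<Longrightarrow> pinv L n \<in> Th P"
  and Theta_mult: "P \<in> \<Delta> \<Longrightarrow> n \<in> Th P \<Longrightarrow> m \<in> Th P \<Longrightarrow> n \<cdot> m \<in> Th P"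
proof -
  assume P: "P \<in> \<Delta>"
  have I: "x \<in> I S" if "x \<in> I P" for x using order_p_S[OF P that] .
  have "pone L \<in> pcentralizer L P"
    using pconj_by_one psubgroupD(1)[OF object_psubgroup[OF P]] by (auto simp: pcentralizer_def)
  then show "pone L \<in> Th P" using theta_one[OF I] by (auto simp: Theta_def)
  show "pinv L n \<in> Th P" if "n \<in> Th P" using that theta_inv[OF I] pcentralizer_inv
    by (auto simp: Theta_def)
  show "n \<cdot> m \<in> Th P" if "n \<in> Th P" "m \<in> Th P"
  proof -
    have "n \<cdot> m \<in> pcentralizer L P"
      using moves_mult[OF Theta_moves[OF P that(1)] Theta_moves[OF P that(2)]]
        pconj_mult[OF Theta_moves[OF P that(1)] Theta_moves[OF P that(2)]] Theta_pconj that
      by (auto simp: pcentralizer_def moves_def)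
    then show ?thesis using that theta_mult[OF I] by (auto simp: Theta_def)
  qed
qed

text \<open>Each element of order \<open>p\<close> in \<open>Q\<close> is the conjugate of one in
  \<open>P\<close>, so the conjugacy condition on \<theta> carries every term of the intersection
  defining \<open>Th P\<close> to the matching term for \<open>Q\<close>.\<close>

lemma Theta_conj:
  assumes g: "moves P g Q" and n: "n \<in> Th P"
  shows "pconj L n g \<in> Th Q"
proof -
  have P: "P \<in> \<Delta>" "Q \<in> \<Delta>" using movesD g by blast+
  have gc: "g \<in> carrier L" using movesD g by blast
  have tn: "moves P n P" by (rule Theta_moves[OF P(1) n])
  note c = moves_conj[OF tn g g]
  have "pconj L n g \<in> \<theta> y" if y: "y \<in> I Q" for y
  proof -
    obtain x where x: "x \<in> P" "y = pconj L x g" using order_p_subset[OF y] moves_image[OF g] by blast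
    have xd: "x \<in> Sdom g" using moves_subset_Sdom[OF g] x by blast
    have y': "y \<in> Q" "y \<noteq> pone L" "y [^]\<^bsub>grp L S\<^esub> p = pone L"
      using y order_p_iff[OF object_psubgroup[OF P(2)]] by auto
    have inj: "inj_on (\<lambda>x. pconj L x g) (Sdom g)"
      by (rule inj_on_subset[OF pconj_inj]) (auto simp: Sdom_def)
    have one: "pone L \<in> Sdom g" "pconj L (pone L) g = pone L"
      using psubgroupD(6)[OF Sdom_psubgroup[OF gc]] pconj_one[OF gc] by auto
    have "pconj L (x [^]\<^bsub>grp L S\<^esub> p) g = pconj L (pone L) g"
      using pconj_pow[OF xd, of p] y' x one by simp
    then have "x [^]\<^bsub>grp L S\<^esub> p = pone L" using inj_onD[OF inj] pconj_pow[OF xd, of p] one by blast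
    moreover have "x \<noteq> pone L" using y' x one by auto
    ultimately have xI: "x \<in> I P" using x order_p_iff[OF object_psubgroup[OF P(1)]] by blast
    have "\<theta> y = pconj_set L (\<theta> x) g"
      using theta_conj[OF order_p_S[OF P(1) xI] gc] xd x by (auto simp: Sdom_def)
    then show ?thesis using Theta_theta[OF n xI] by (auto simp: pconj_set_def)
  qed
  moreover have "pconj L n g \<in> pcentralizer L Q"
  proof -
    have "pconj L y (pconj L n g) = y" if y: "y \<in> Q" for y
    proof -
      have gi: "moves Q (pinv L g) P" by (rule moves_inv[OF g])
      have y1: "pconj L y (pinv L g) \<in> P" using movesD(5)[OF gi y] .
      have "pconj L y (pconj L n g) = pconj L (pconj L (pconj L y (pinv L g)) n) g"
        unfolding c(3) using pconj_mult[OF moves_mult[OF gi tn] g y] pconj_mult[OF gi tn y] by simp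
      also have "\<dots> = pconj L (pconj L y (pinv L g)) g" using Theta_pconj[OF n y1] by simp
      also have "\<dots> = y" using pconj_inv(2)[OF movesD(4)[OF gi y]] inv_inv gc by simp
      finally show ?thesis .
    qed
    then show ?thesis using c(2) by (auto simp: pcentralizer_def moves_def)
  qed
  ultimately show ?thesis by (simp add: Theta_def)
qed

lemma Theta_nonempty_order: "P \<in> \<Delta> \<Longrightarrow> \<exists>x. x \<in> I P"
  using order_p_central by metis

text \<open>One element \<open>x\<close> of order \<open>p\<close> in \<open>P\<close> is enough:
  \<open>Th P\<close> is a subgroup of the \<open>p'\<close>-group
  \<open>\<theta> x\<close>.\<close>

lemma Theta_card:
  assumes P: "P \<in> \<Delta>" shows "\<not> p dvd card (Th P)"
proof -
  obtain x where x: "x \<in> I P" using Theta_nonempty_order[OF P] by blast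
  have xS: "x \<in> I S" using order_p_S[OF P x] .
  interpret G: group "grp L (\<theta> x)" by (rule theta_group[OF xS])
  have sub: "Th P \<subseteq> \<theta> x" using Theta_theta x by blast
  have "subgroup (Th P) (grp L (\<theta> x))"
  proof (rule G.subgroupI)
    show "Th P \<subseteq> carrier (grp L (\<theta> x))" using sub by (simp add: grp_def)
    show "Th P \<noteq> {}" using Theta_one[OF P] by blast
    show "inv\<^bsub>grp L (\<theta> x)\<^esub> a \<in> Th P" if a: "a \<in> Th P" for a
    proof -
      have "inv\<^bsub>grp L (\<theta> x)\<^esub> a = pinv L a"
        by (rule G.inv_equality) (use a sub Theta_inv[OF P a]
          inv_left Theta_carrier in \<open>auto simp: grp_def\<close>)
      then show ?thesis using Theta_inv[OF P a] by simp
    qed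
    show "a \<otimes>\<^bsub>grp L (\<theta> x)\<^esub> b \<in> Th P" if "a \<in> Th P" "b \<in> Th P" for a b
      using Theta_mult[OF P that] by (simp add: grp_def)
  qed
  from G.lagrange[OF this] have "card (Th P) dvd card (\<theta> x)"
    by (metis dvd_triv_right order_def partial_object.select_convs(1) grp_def)
  then show ?thesis using theta_card[OF xS] dvd_trans by blast
qed

lemma Theta_normal:
  assumes P: "P \<in> \<Delta>" shows "Th P \<lhd> grp L (pnormalizer L P)"
proof -
  note N = normalizer_psubgroup[OF P]
  interpret G: group "grp L (pnormalizer L P)" by (rule psubgroup_group[OF N])
  have sub: "Th P \<subseteq> pnormalizer L P" using Theta_moves[OF P] normalizer_iff[OF P] by blast
  have "subgroup (Th P) (grp L (pnormalizer L P))"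
    by (rule subgroup.intro)
      (use sub Theta_one[OF P] Theta_inv[OF P] Theta_mult[OF P] grp_inv[OF N] in \<open>auto simp: grp_def\<close>)
  moreover have "x \<otimes>\<^bsub>grp L (pnormalizer L P)\<^esub> h \<otimes>\<^bsub>grp L (pnormalizer L P)\<^esub> inv\<^bsub>grp L (pnormalizer L P)\<^esub> x \<in> Th P"
    if x: "x \<in> carrier (grp L (pnormalizer L P))" and h: "h \<in> Th P" for x h
  proof -
    have xN: "x \<in> pnormalizer L P" using x by (simp add: grp_def)
    have t: "moves P x P" using xN normalizer_iff[OF P] by blast
    note ti = moves_inv[OF t]
    have "pconj L h (pinv L x) = x \<cdot> h \<cdot> pinv L x"
      using moves_conj(3)[OF Theta_moves[OF P h] ti ti] inv_inv movesD(3)[OF t] by simp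
    then show ?thesis using Theta_conj[OF ti h] grp_inv[OF N xN] by (simp add: grp_def)
  qed
  ultimately show ?thesis by (simp add: G.normal_inv_iff)
qed

text \<open>A \<open>p\<close>-group meets a \<open>p'\<close>-group trivially. Through
  \<open>eqv_S\<close> this makes congruent elements of \<open>S\<close> equal.\<close>

lemma Theta_S:
  assumes P: "P \<in> \<Delta>" and n: "n \<in> Th P" "n \<in> S" shows "n = pone L"
proof -
  obtain x where x: "x \<in> I P" using Theta_nonempty_order[OF P] by blast
  have xS: "x \<in> I S" using order_p_S[OF P x] .
  obtain k where "card S = p ^ k" using card_object[OF p_prime S_psubgroup] by blast
  then have "coprime (card S) (card (\<theta> x))"
    using theta_card[OF xS] p_prime by (simp add: prime_imp_coprime)
  then show ?thesis
    using coprime_Int_trivial[OF psubgroup_group[OF S_psubgroup] theta_group[OF xS]]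
      n Theta_theta[OF n(1) x] by blast
qed

end

section \<open>Elements congruent modulo a signalizer\<close>

context locality
begin

lemma moves_right_inj:
  assumes "g \<cdot> f = g' \<cdot> f" "moves P g Q" "moves P' g' Q" "moves Q f R" shows "g = g'"
  using moves_cancel_right[OF assms(2,4)] moves_cancel_right[OF assms(3,4)] assms(1) by metis

lemma moves_left_inj:
  assumes "f \<cdot> g = f \<cdot> g'" "moves P f Q" "moves Q g R" "moves Q g' R'" shows "g = g'"
  using moves_cancel_left[OF assms(2,3)] moves_cancel_left[OF assms(2,4)] assms(1) by metis

end

context signalizer
begin

definition eqv :: "'a set \<Rightarrow> 'a \<Rightarrow> 'a \<Rightarrow> bool" where
  "eqv P f g \<longleftrightarrow> (\<exists>Q. moves P g Q) \<and> (\<exists>n \<in> Th P. f = n \<cdot> g)"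

definition sim :: "'a \<Rightarrow> 'a \<Rightarrow> bool" where
  "sim f g \<longleftrightarrow> (\<exists>P. eqv P f g)"

lemma eqvI: "moves P g Q \<Longrightarrow> n \<in> Th P \<Longrightarrow> f = n \<cdot> g \<Longrightarrow> eqv P f g"
  by (auto simp: eqv_def)

lemma eqvE:
  assumes "eqv P f g"
  obtains Q n where "moves P g Q" "n \<in> Th P" "f = n \<cdot> g" "moves P n P" "P \<in> \<Delta>" "moves P f Q"
proof -
  obtain Q n where 1: "moves P g Q" "n \<in> Th P" "f = n \<cdot> g" using assms by (auto simp: eqv_def)
  have 2: "moves P n P" using Theta_moves movesD(1)[OF 1(1)] 1(2) by blast
  show ?thesis by (rule that[OF 1 2 movesD(1)[OF 1(1)]]) (use moves_mult[OF 2 1(1)] 1(3) in simp)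
qed

lemma eqv_object: "eqv P f g \<Longrightarrow> P \<in> \<Delta>"
  by (auto elim: eqvE)

lemma eqv_moves: assumes "eqv P f g" shows "moves P f Q \<longleftrightarrow> moves P g Q"
  using assms by (metis eqvE moves_unique)

lemma eqv_moves_ex: "eqv P f g \<Longrightarrow> \<exists>Q. moves P f Q \<and> moves P g Q"
  by (auto elim: eqvE)

lemma eqv_carrier: "eqv P f g \<Longrightarrow> f \<in> carrier L \<and> g \<in> carrier L"
  by (auto elim!: eqvE dest: movesD(3))

lemma eqv_refl: "moves P g Q \<Longrightarrow> eqv P g g"
  using Theta_one[of P] by (auto simp: eqv_def one_left movesD intro!: bexI[of _ "pone L"])

lemma eqv_sym: assumes "eqv P f g" shows "eqv P g f"
proof -
  obtain Q n where e: "moves P g Q" "n \<in> Th P" "f = n \<cdot> g" "moves P n P" "P \<in> \<Delta>" "moves P f Q"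
    using assms by (rule eqvE)
  show ?thesis by (rule eqvI[OF e(6) Theta_inv[OF e(5,2)]]) (simp add: e(3) moves_cancel_left[OF e(4,1)])
qed

lemma eqv_trans: assumes "eqv P f g" "eqv P g h" shows "eqv P f h"
proof -
  obtain Q n where e: "moves P g Q" "n \<in> Th P" "f = n \<cdot> g" "moves P n P" "P \<in> \<Delta>" "moves P f Q"
    using assms(1) by (rule eqvE)
  obtain R m where d: "moves P h R" "m \<in> Th P" "g = m \<cdot> h" "moves P m P" "P \<in> \<Delta>" "moves P g R"
    using assms(2) by (rule eqvE)
  show ?thesis
    by (rule eqvI[OF d(1) Theta_mult[OF e(5,2) d(2)]]) (simp add: e(3) d(3) moves_assoc[OF e(4) d(4,1)])
qed

lemma eqv_mono: assumes "eqv P f g" "P' \<in> \<Delta>" "P' \<subseteq> P" shows "eqv P' f g"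
proof -
  obtain Q n where e: "moves P g Q" "n \<in> Th P" "f = n \<cdot> g" "moves P n P" "P \<in> \<Delta>" "moves P f Q"
    using assms(1) by (rule eqvE)
  show ?thesis
    by (rule eqvI[OF moves_mono[OF e(1) assms(2,3)] Theta_antimono[OF assms(2) e(5) assms(3) e(2)] e(3)])
qed

lemma eqv_mult_right:
  assumes "eqv P f g" "moves P f Q" "moves Q h R" shows "eqv P (f \<cdot> h) (g \<cdot> h)"
proof -
  obtain Q' n where e: "moves P g Q'" "n \<in> Th P" "f = n \<cdot> g" "moves P n P" "P \<in> \<Delta>" "moves P f Q'"
    using assms(1) by (rule eqvE)
  have "moves P g Q" using e(1) moves_unique[OF e(6) assms(2)] by simp
  then show ?thesis
    by (intro eqvI[OF moves_mult[OF _ assms(3)] e(2)]) (auto simp: e(3) moves_assoc[OF e(4) _ assms(3)])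
qed

text \<open>Moving \<open>n\<close> to the left across \<open>h\<close> replaces it by its conjugate
  under the inverse of \<open>h\<close>, which lies in \<open>Th Q\<close> by
  \<open>Theta_conj\<close>. This is the normality that makes \<open>eqv\<close> a
  congruence.\<close>

lemma eqv_mult_left:
  assumes "eqv P f g" "moves Q h P" shows "eqv Q (h \<cdot> f) (h \<cdot> g)"
proof -
  obtain R n where e: "moves P g R" "n \<in> Th P" "f = n \<cdot> g" "moves P n P" "P \<in> \<Delta>" "moves P f R"
    using assms(1) by (rule eqvE)
  note hi = moves_inv[OF assms(2)]
  define m where "m = pconj L n (pinv L h)"
  have m: "m \<in> Th Q" "moves Q m Q" using Theta_conj[OF hi e(2)] Theta_moves movesD(1)[OF assms(2)]
    by (auto simp: m_def)
  have n: "n = pconj L m h"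
    using pconj_inv(2)[OF moves_conj(1)[OF e(4) hi hi]] inv_inv movesD(3)[OF assms(2)]
      by (simp add: m_def)
  have "m \<cdot> h = h \<cdot> n"
    using mult_eq_conj[OF moves_conj(1)[OF m(2) assms(2) assms(2)]] n by simp
  then have "h \<cdot> f = m \<cdot> (h \<cdot> g)"
    using moves_assoc[OF assms(2) e(4,1)] moves_assoc[OF m(2) assms(2) e(1)] e(3) by simp
  then show ?thesis by (rule eqvI[OF moves_mult[OF assms(2) e(1)] m(1)])
qed

lemma eqv_mult:
  assumes "eqv P f g" "moves P f Q" "eqv Q f' g'" shows "eqv P (f \<cdot> f') (g \<cdot> g')"
proof -
  obtain R where R: "moves Q f' R" using eqv_moves_ex[OF assms(3)] by blast
  have "moves P g Q" using assms eqv_moves by blast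
  from eqv_trans[OF eqv_mult_right[OF assms(1,2) R] eqv_mult_left[OF assms(3) this]] show ?thesis .
qed

lemma eqv_inv:
  assumes "eqv P f g" "moves P f Q" shows "eqv Q (pinv L f) (pinv L g)"
proof -
  have g: "moves P g Q" using assms eqv_moves by blast
  note fi = moves_inv[OF assms(2)] and gi = moves_inv[OF g]
  have c: "f \<in> carrier L" "g \<in> carrier L" using movesD(3) assms(2) g by auto
  have "eqv P (f \<cdot> pinv L g) (g \<cdot> pinv L g)"
    by (rule eqv_mult_right[OF assms gi])
  from eqv_mult_left[OF this fi]
  have "eqv Q (pinv L f \<cdot> (f \<cdot> pinv L g)) (pinv L f \<cdot> pone L)"
    using inv_right[OF c(2)] by simp
  then show ?thesis using moves_cancel_left[OF assms(2) gi] one_right[OF inv_closed[OF c(1)]]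
    by (simp add: eqv_sym)
qed

lemma eqv_cancel_left:
  assumes "eqv Q (h \<cdot> f) (h \<cdot> g)" "moves Q h P" "moves P f R" "moves P g R'"
  shows "eqv P f g"
  using eqv_mult_left[OF assms(1) moves_inv[OF assms(2)]] moves_cancel_left[OF assms(2,3)]
    moves_cancel_left[OF assms(2,4)]
  by simp

lemma eqv_S:
  assumes "eqv P a b" "a \<in> S" "b \<in> S" shows "a = b"
proof -
  obtain R n where e: "moves P b R" "n \<in> Th P" "a = n \<cdot> b" "moves P n P" "P \<in> \<Delta>" "moves P a R"
    using assms(1) by (rule eqvE)
  have "n = a \<cdot> pinv L b" using moves_cancel_right[OF e(4,1)] e(3) by simp
  also have "\<dots> \<in> S"
    using psubgroupD(5)[OF S_psubgroup, of "[a, pinv L b]"] psubgroupD(3)[OF S_psubgroup] assms by simp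
  finally have "n = pone L" using Theta_S[OF e(5,2)] by blast
  then show ?thesis using e(3) one_left movesD(3)[OF e(1)] by simp
qed

lemma Sdom_Int_object:
  assumes "P \<in> \<Delta>" "P \<subseteq> Sdom f" "P \<subseteq> Sdom g" "f \<in> carrier L" "g \<in> carrier L"
  shows "Sdom f \<inter> Sdom g \<in> \<Delta>"
  by (rule objects_overgroups[OF assms(1) psubgroup_Int[OF Sdom_psubgroup Sdom_psubgroup]])
    (use assms Sdom_subset in auto)

lemma sim_eqv:
  assumes "sim f g" shows "eqv (Sdom f \<inter> Sdom g) f g"
proof -
  obtain P where P: "eqv P f g" using assms by (auto simp: sim_def)
  obtain R0 n where e: "moves P g R0" "n \<in> Th P" "f = n \<cdot> g" "moves P n P" "P \<in> \<Delta>" "moves P f R0"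
    using P by (rule eqvE)
  have c: "f \<in> carrier L" "g \<in> carrier L" "n \<in> carrier L" using movesD(3) e(1,4,6) by auto
  define U where "U = Sdom f \<inter> Sdom g"
  define Q where "Q = U \<inter> Sfix n"
  have U: "U \<in> \<Delta>" unfolding U_def
    by (rule Sdom_Int_object[OF e(5) moves_subset_Sdom[OF e(6)] moves_subset_Sdom[OF e(1)] c(1,2)])
  have PU: "P \<subseteq> U" using moves_subset_Sdom[OF e(6)] moves_subset_Sdom[OF e(1)] by (simp add: U_def)
  have PQ: "P \<subseteq> Q" using PU pcentralizer_Sfix[OF object_subset[OF e(5)] Theta_cent[OF e(2)]]
    by (simp add: Q_def)
  have Q: "Q \<in> \<Delta>" by (rule objects_overgroups[OF e(5) _ PQ])
     (use psubgroup_Int[OF object_psubgroup[OF U] Sfix_psubgroup[OF c(3)]] object_subset[OF U]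
       in \<open>auto simp: Q_def\<close>)
  \<comment> \<open>So far \<open>n\<close> is known to lie in \<open>Th P\<close> only. One element
    of order \<open>p\<close> carries this over to \<open>Q\<close>, which \<open>n\<close>
    centralizes by construction.\<close>
  obtain x where x: "x \<in> I P" using Theta_nonempty_order[OF e(5)] by blast
  have nQ: "n \<in> Th Q"
    by (rule theta_in_Theta[OF Q order_p_mono[OF object_psubgroup[OF e(5)] object_psubgroup[OF Q] PQ x]
      Theta_theta[OF e(2) x]])
      (rule Sfix_pcentralizer[OF c(3)], simp add: Q_def)
  obtain R where g: "moves Q g R" using moves_Sdom[OF c(2) Q] by (auto simp: Q_def U_def)
  have eQ: "eqv Q f g" by (rule eqvI[OF g nQ e(3)])
  have f: "moves Q f R" using g eQ eqv_moves by blast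
  have n: "moves Q n Q" by (rule Theta_moves[OF Q nQ])
  have "Q = U"
  proof (rule ccontr)
    assume "Q \<noteq> U"
    then obtain s where s: "s \<in> U" "s \<notin> Q" "moves Q s Q"
      using normalizer_grows[OF p_prime Q object_psubgroup[OF U] object_subset[OF U]]
        by (auto simp: Q_def)
    define a b where "a = pconj L s f" and "b = pconj L s g"
    have sf: "s \<in> conj_dom L f" "a \<in> S" "s \<in> conj_dom L g" "b \<in> S"
      using s(1) by (auto simp: U_def Sdom_def a_def b_def)
    have ta: "moves R a R" "moves R b R" using moves_conj(2)[OF s(3) f f] moves_conj(2)[OF s(3) g g]
      by (auto simp: a_def b_def)
    have sfa: "s \<cdot> f = f \<cdot> a" and sgb: "s \<cdot> g = g \<cdot> b"
      using mult_eq_conj sf by (auto simp: a_def b_def)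
    \<comment> \<open>Both sides are \<open>s\<close> times congruent elements. Since
      \<open>f\<close> and \<open>g\<close> are congruent over \<open>Q\<close>, cancelling them
      leaves \<open>a\<close> and \<open>b\<close> congruent; both lie in \<open>S\<close>, hence
      they are equal.\<close>
    have "eqv Q (f \<cdot> a) (g \<cdot> b)" using eqv_mult_left[OF eQ s(3)] sfa sgb by simp
    moreover have "eqv Q (f \<cdot> b) (g \<cdot> b)" by (rule eqv_mult_right[OF eQ f ta(2)])
    ultimately have "eqv Q (f \<cdot> a) (f \<cdot> b)" using eqv_sym eqv_trans by blast
    then have "eqv R a b" using eqv_cancel_left f ta by blast
    then have ab: "a = b" using eqv_S sf by blast
    \<comment> \<open>Equal conjugates of \<open>s\<close> under \<open>f = n \<cdot> g\<close> and
      under \<open>g\<close> force \<open>s\<close> and \<open>n\<close> to commute, which puts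
      \<open>s\<close> into \<open>Sfix n\<close> and so into \<open>Q\<close>.\<close>
    have "s \<cdot> n \<cdot> g = s \<cdot> f" using moves_assoc[OF s(3) n g] e(3) by simp
    also have "\<dots> = n \<cdot> g \<cdot> b" using sfa ab e(3) by simp
    also have "\<dots> = n \<cdot> s \<cdot> g" using moves_assoc[OF n g ta(2)] moves_assoc[OF n s(3) g] sgb by simp
    finally have "s \<cdot> n = n \<cdot> s"
      by (rule moves_right_inj[OF _ moves_mult[OF s(3) n] moves_mult[OF n s(3)] g])
    then have *: "n \<cdot> pconj L s n = n \<cdot> s"
      using mult_eq_conj[OF moves_conj(1)[OF s(3) n n]] by simp
    have "pconj L s n = s"
      by (rule moves_left_inj[OF * n moves_conj(2)[OF s(3) n n] s(3)])
    moreover have "s \<in> S" using s(1) Sdom_subset by (auto simp: U_def)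
    ultimately have "s \<in> Sfix n" using moves_conj(1)[OF s(3) n n] by (auto simp: Sfix_def Sdom_def)
    then show False using s by (simp add: Q_def)
  qed
  with eQ show ?thesis by (simp add: U_def)
qed

lemma eqv_sim: "eqv P f g \<Longrightarrow> sim f g"
  by (auto simp: sim_def)

lemma eqv_subset: "eqv P f g \<Longrightarrow> P \<subseteq> Sdom f \<inter> Sdom g"
  by (auto elim!: eqvE dest: moves_subset_Sdom)

lemma sim_eqv_sub: "sim f g \<Longrightarrow> P \<in> \<Delta> \<Longrightarrow> P \<subseteq> Sdom f \<Longrightarrow> P \<subseteq> Sdom g \<Longrightarrow> eqv P f g"
  using eqv_mono[OF sim_eqv] by blast

lemma sim_sym: "sim f g \<Longrightarrow> sim g f"
  using eqv_sym by (auto simp: sim_def)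

lemma sim_refl: "f \<in> carrier L \<Longrightarrow> sim f f"
  unfolding sim_def using moves_exists eqv_refl by blast

lemma sim_carrier: "sim f g \<Longrightarrow> f \<in> carrier L \<and> g \<in> carrier L"
  using eqv_carrier by (auto simp: sim_def)

lemma sim_trans: "sim f g \<Longrightarrow> sim g h \<Longrightarrow> P \<in> \<Delta> \<Longrightarrow> P \<subseteq> Sdom f \<Longrightarrow> P \<subseteq> Sdom g \<Longrightarrow> P \<subseteq> Sdom h \<Longrightarrow> sim f h"
  using eqv_trans[OF sim_eqv_sub sim_eqv_sub] eqv_sim by blast

text \<open>The object common to the three domains is \<open>Sdom f \<inter> Sdom g\<close>.\<close>

lemma sim_trans_mid: "sim f g \<Longrightarrow> sim g h \<Longrightarrow> Sdom g \<subseteq> Sdom h \<Longrightarrow> sim f h"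
  using sim_trans[of f g h "Sdom f \<inter> Sdom g"] eqv_object[OF sim_eqv] by blast

lemma sim_S: "sim a b \<Longrightarrow> a \<in> S \<Longrightarrow> b \<in> S \<Longrightarrow> a = b"
  using eqv_S by (auto simp: sim_def)

lemma Theta_eqv_one: "n \<in> Th P \<and> P \<in> \<Delta> \<longleftrightarrow> eqv P n (pone L)"
proof
  assume "n \<in> Th P \<and> P \<in> \<Delta>"
  then show "eqv P n (pone L)" using eqvI[OF moves_one, of P n n] one_right Theta_carrier by auto
next
  assume "eqv P n (pone L)"
  then obtain m where "m \<in> Th P" "n = m \<cdot> pone L" "P \<in> \<Delta>" by (rule eqvE)
  then show "n \<in> Th P \<and> P \<in> \<Delta>" using one_right Theta_carrier by auto
qed

section \<open>The union of the signalizers and its cosets\<close>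

abbreviation "N \<equiv> Theta_hat p L S \<theta>"

text \<open>An element of \<open>\<theta> x\<close> centralizes \<open>x\<close>, so
  \<open>Sfix n\<close> is a nontrivial subgroup of \<open>S\<close>. Being nontrivial is all it
  takes to be an object, and \<open>theta_in_Theta\<close> applies to it.\<close>

lemma N_iff: "n \<in> N \<longleftrightarrow> (\<exists>P\<in>\<Delta>. n \<in> Th P)"
proof
  assume "n \<in> N"
  then obtain x where x: "x \<in> I S" "n \<in> \<theta> x" by (auto simp: Theta_hat_def)
  have c: "n \<in> pcentralizer L {x}" using theta_subset x by blast
  have nc: "n \<in> carrier L" using pcentralizerD(3)[OF c] .
  have "x \<in> Sfix n" using pcentralizer_Sfix[OF _ c] order_p_subset[OF x(1)] by auto
  then have Q: "Sfix n \<in> \<Delta> \<and> x \<in> I (Sfix n)"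
    by (intro order_p_object[OF Sfix_psubgroup[OF nc] _ x(1)]) (auto simp: Sfix_def Sdom_def)
  then have "n \<in> Th (Sfix n)" using theta_in_Theta[OF _ _ x(2) Sfix_pcentralizer[OF nc]] by blast
  then show "\<exists>P\<in>\<Delta>. n \<in> Th P" using Q by blast
next
  assume "\<exists>P\<in>\<Delta>. n \<in> Th P"
  then obtain P where P: "P \<in> \<Delta>" "n \<in> Th P" by blast
  obtain x where x: "x \<in> I P" using Theta_nonempty_order[OF P(1)] by blast
  then show "n \<in> N" using Theta_theta[OF P(2) x] order_p_S[OF P(1) x] by (auto simp: Theta_hat_def)
qed

lemma N_sim_one: "n \<in> N \<longleftrightarrow> sim n (pone L)"
  unfolding sim_def N_iff using Theta_eqv_one by blast

lemma one_S: "pone L \<in> S"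
  using psubgroupD(6)[OF S_psubgroup] .

text \<open>Since \<open>Sdom (pone L)\<close> is all of \<open>S\<close>, the congruence of
  \<open>n\<close> with the identity extends to every object inside \<open>Sdom n\<close>.\<close>

lemma N_Theta:
  assumes "n \<in> N" "P \<in> \<Delta>" "P \<subseteq> Sdom n" shows "n \<in> Th P"
proof -
  have "P \<subseteq> Sdom (pone L)" using Sdom_S[OF one_S] assms(3) Sdom_subset by blast
  then have "eqv P n (pone L)" using sim_eqv_sub N_sim_one assms by blast
  then show ?thesis using Theta_eqv_one by blast
qed

text \<open>As soon as an element of \<open>N\<close> moves an object, it centralizes it. A word in
  \<open>N\<close> that lies in the domain is thus a chain that never leaves its first object, and
  its product is taken in a single \<open>Th P\<close>.\<close>

lemma N_moves: "n \<in> N \<Longrightarrow> moves P n Q \<Longrightarrow> n \<in> Th P \<and> Q = P"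
  using N_Theta[of n P] moves_subset_Sdom[of P n Q] movesD(1)[of P n Q] Theta_moves moves_unique by blast

lemma N_partial_normal: "partial_normal L N"
proof -
  have "pone L \<in> N" using Theta_one[OF S_object] S_object N_iff by blast
  moreover have "N \<subseteq> carrier L" using N_iff Theta_carrier by blast
  moreover have "pinv L n \<in> N" if "n \<in> N" for n using that N_iff Theta_inv by blast
  moreover have "pprod L w \<in> N" if w: "w \<in> pdom L" "set w \<subseteq> N" for w
  proof -
    have "pprod L w \<in> Th P" if "path P w Q" "set w \<subseteq> N" for P Q w
      using that
    proof (induction w)
      case Nil
      then show ?case using Theta_one[of P] by (auto simp: pone_def)
    next
      case (Cons f w)
      then obtain R where R: "moves P f R" "path R w Q" by auto
      have f: "f \<in> Th P" "R = P" using N_moves R Cons.prems by auto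
      have "pprod L w \<in> Th P" using Cons R f by simp
      moreover have "pprod L (f # w) = f \<cdot> pprod L w"
        using prod_assoc[of "[f]" w "[]"] path_dom[OF Cons.prems(1)] by simp
      ultimately show ?case using Theta_mult[OF movesD(1)[OF R(1)] f(1)] by simp
    qed
    moreover obtain P Q where "path P w Q" using w dom_iff_path by blast
    moreover have "P \<in> \<Delta>" if "path P w Q" for P Q using that by (cases w) (auto dest: movesD(1))
    ultimately show ?thesis using w N_iff by blast
  qed
  moreover have "pconj L n g \<in> N" if n: "n \<in> N" and g: "n \<in> conj_dom L g" for n g
  proof -
    have c: "g \<in> carrier L" using conj_domD[OF g] by blast
    obtain A B C D where A: "moves A (pinv L g) B" "moves B n C" "moves C g D"
      using conj_domD[OF g] dom_iff_path[of "[pinv L g, n, g]"] by auto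
    \<comment> \<open>The arrow of \<open>n\<close> is a loop at the source of the arrow of
      \<open>g\<close>, so \<open>g\<close> conjugates it from one \<Theta> into another.\<close>
    have "n \<in> Th B" "C = B" using N_moves[OF n A(2)] by auto
    then show ?thesis using Theta_conj[of B g D n] A(3) N_iff movesD(2)[OF A(3)] by blast
  qed
  ultimately show ?thesis
    unfolding partial_normal_def partial_subgroup_def by (auto simp: in_lists_conv_set subset_iff)
qed

lemma N_Int_S: "N \<inter> S = {pone L}"
proof -
  have "pone L \<in> N" using Theta_one[OF S_object] S_object N_iff by blast
  then show ?thesis using Theta_S N_iff one_S by blast
qed

text \<open>A word \<open>[n, g]\<close> in the domain makes \<open>n\<close> a loop at some object,
  which is exactly a congruence over that object.\<close>

lemma pcoset_eq: "g \<in> carrier L \<Longrightarrow> pcoset L N g = {f. sim f g}"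
proof (intro equalityI subsetI)
  fix f assume "f \<in> pcoset L N g"
  then obtain n where n: "f = n \<cdot> g" "n \<in> N" "[n, g] \<in> pdom L" by (auto simp: pcoset_def)
  then obtain P Q R where P: "moves P n Q" "moves Q g R" using dom_iff_path[of "[n, g]"] by auto
  have "n \<in> Th P" "Q = P" using N_moves n P by auto
  then show "f \<in> {f. sim f g}" using P n by (auto simp: sim_def intro!: eqvI)
next
  fix f assume "f \<in> {f. sim f g}"
  then obtain P where "eqv P f g" by (auto simp: sim_def)
  then obtain Q n where e: "moves P g Q" "n \<in> Th P" "f = n \<cdot> g" "moves P n P" "P \<in> \<Delta>" by (rule eqvE)
  then show "f \<in> pcoset L N g" using moves_mult_dom[OF e(4,1)] N_iff by (auto simp: pcoset_def)
qed

section \<open>Elements with maximal domain\<close>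

definition maximal :: "'a \<Rightarrow> bool" where
  "maximal f \<longleftrightarrow> f \<in> carrier L \<and> (\<forall>h. sim h f \<and> Sdom f \<subseteq> Sdom h \<longrightarrow> Sdom h = Sdom f)"

lemma maximal_carrier: "maximal f \<Longrightarrow> f \<in> carrier L"
  by (simp add: maximal_def)

text \<open>The candidates are restricted to those with domain containing \<open>Sdom g\<close>, and
  one with a domain of largest size is taken. The restriction keeps \<open>Sdom g\<close> as a
  common object, so that an element congruent to the candidate and with larger domain is still
  congruent to \<open>g\<close>.\<close>

lemma maximal_exists:
  assumes "g \<in> carrier L" obtains f where "maximal f" "sim g f" "Sdom g \<subseteq> Sdom f"
proof -
  define A where "A = {f. sim g f \<and> Sdom g \<subseteq> Sdom f}"
  have A: "finite A" "A \<noteq> {}"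
    using finite_subset[OF _ finite_carrier, of A] sim_carrier sim_refl[OF assms] by (auto simp: A_def)
  then obtain f where f: "f \<in> A" "\<And>h. h \<in> A \<Longrightarrow> card (Sdom h) \<le> card (Sdom f)"
    using Max_in[of "(\<lambda>f. card (Sdom f)) ` A"] Max_ge[of "(\<lambda>f. card (Sdom f)) ` A"] by fastforce
  have "Sdom h = Sdom f" if h: "sim h f" "Sdom f \<subseteq> Sdom h" for h
  proof -
    have "sim g h"
      by (rule sim_trans[OF _ sim_sym[OF h(1)] Sdom_object[OF assms]]) (use f h in \<open>auto simp: A_def\<close>)
    then have "h \<in> A" using f h by (auto simp: A_def)
    then show ?thesis
      using f(2) h(2) card_seteq[of "Sdom h" "Sdom f"] finite_subset[OF Sdom_subset finite_S] by auto
  qed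
  then have "maximal f" using f(1) sim_carrier by (auto simp: maximal_def A_def)
  then show ?thesis using that f(1) by (auto simp: A_def)
qed

text \<open>The elements of \<open>N\<^sub>S(P)\<close> that \<open>f\<close> conjugates into \<open>\<Theta>(R) N\<^sub>S(R)\<close>, where \<open>R\<close> is the conjugate of
  \<open>P\<close> by \<open>f\<close>.\<close>

definition Sext :: "'a set \<Rightarrow> 'a \<Rightarrow> 'a set" where
  "Sext P f = {s \<in> S. moves P s P \<and> (\<exists>R b. moves P f R \<and> b \<in> S \<and> moves R b R \<and> eqv P (s \<cdot> f) (f \<cdot> b))}"

text \<open>The relation between \<open>s\<close> and \<open>b\<close> expressed by
  \<open>eqv P (s \<cdot> f) (f \<cdot> b)\<close> is compatible with products and inverses because
  \<open>eqv\<close> is a congruence.\<close>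

lemma Sext_psubgroup:
  assumes f: "moves P f R" shows "psubgroup L (Sext P f)"
proof (rule psubgroupI_sub[OF S_psubgroup])
  note S' = psubgroupD[OF S_psubgroup]
  have P: "P \<in> \<Delta>" "R \<in> \<Delta>" and fc: "f \<in> carrier L" using movesD f by auto
  have extI: "s \<in> Sext P f" if "s \<in> S" "moves P s P" "b \<in> S" "moves R b R" "eqv P (s \<cdot> f) (f \<cdot> b)"
    for s b
    using that f by (auto simp: Sext_def)
  have extE: "\<exists>b. s \<in> S \<and> moves P s P \<and> b \<in> S \<and> moves R b R \<and> eqv P (s \<cdot> f) (f \<cdot> b)" if "s \<in> Sext P f"
    for s
    using that moves_unique[OF f] by (auto simp: Sext_def)
  show "Sext P f \<subseteq> S" by (auto simp: Sext_def)
  show "pone L \<in> Sext P f"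
    by (rule extI[OF one_S moves_one[OF P(1)] one_S moves_one[OF P(2)]])
      (use eqv_refl[OF f] one_left one_right fc in simp)
  show "pinv L x \<in> Sext P f" if x: "x \<in> Sext P f" for x
  proof -
    obtain b where b: "x \<in> S" "moves P x P" "b \<in> S" "moves R b R" and e: "eqv P (x \<cdot> f) (f \<cdot> b)"
      using extE[OF x] by blast
    note bi = moves_inv[OF b(4)] and xi = moves_inv[OF b(2)]
    have "eqv P (x \<cdot> f \<cdot> pinv L b) (f \<cdot> b \<cdot> pinv L b)"
      by (rule eqv_mult_right[OF e moves_mult[OF b(2) f] bi])
    then have "eqv P (x \<cdot> (f \<cdot> pinv L b)) f"
      using moves_cancel_right[OF f b(4)] moves_assoc[OF b(2) f bi] by simp
    from eqv_mult_left[OF this xi] have "eqv P (f \<cdot> pinv L b) (pinv L x \<cdot> f)"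
      using moves_cancel_left[OF b(2) moves_mult[OF f bi]] by simp
    then show ?thesis using extI[OF S'(3)[OF b(1)] xi S'(3)[OF b(3)] bi] eqv_sym by blast
  qed
  show "x \<cdot> y \<in> Sext P f" if x: "x \<in> Sext P f" and y: "y \<in> Sext P f" for x y
  proof -
    obtain b where b: "x \<in> S" "moves P x P" "b \<in> S" "moves R b R" and eb: "eqv P (x \<cdot> f) (f \<cdot> b)"
      using extE[OF x] by blast
    obtain c where c: "y \<in> S" "moves P y P" "c \<in> S" "moves R c R" and ec: "eqv P (y \<cdot> f) (f \<cdot> c)"
      using extE[OF y] by blast
    have "eqv P (x \<cdot> (y \<cdot> f)) (x \<cdot> (f \<cdot> c))" by (rule eqv_mult_left[OF ec b(2)])
    moreover have "eqv P (x \<cdot> f \<cdot> c) (f \<cdot> b \<cdot> c)"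
      by (rule eqv_mult_right[OF eb moves_mult[OF b(2) f] c(4)])
    ultimately have "eqv P (x \<cdot> y \<cdot> f) (f \<cdot> (b \<cdot> c))"
      using eqv_trans moves_assoc[OF b(2) c(2) f] moves_assoc[OF b(2) f c(4)] moves_assoc[OF f b(4) c(4)]
        by simp
    then show ?thesis
      using extI[OF _ moves_mult[OF b(2) c(2)] _ moves_mult[OF b(4) c(4)]] S'(5)[of "[x, y]"]
        S'(5)[of "[b, c]"] b c by simp
  qed
qed

text \<open>Seen in the normalizer of \<open>P\<close>, the \<open>p\<close>-group
  \<open>Sext P f\<close> lies in the product of \<open>Th P\<close> and the subgroup
  \<open>B\<close> that \<open>f\<close> conjugates into \<open>S\<close>. Some \<open>n\<close> in
  \<open>Th P\<close> conjugates it into \<open>B\<close>, and then \<open>n \<cdot> f\<close>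
  conjugates it into \<open>S\<close>.\<close>

lemma Sext_into_Sdom:
  assumes f: "moves P f R"
  obtains f' where "eqv P f' f" "Sext P f \<subseteq> Sdom f'"
proof -
  have P: "P \<in> \<Delta>" "R \<in> \<Delta>" and fc: "f \<in> carrier L" using movesD f by auto
  note NP = normalizer_psubgroup[OF P(1)]
  let ?G = "grp L (pnormalizer L P)"
  interpret G: group ?G by (rule psubgroup_group[OF NP])
  have NG: "x \<in> carrier ?G \<longleftrightarrow> moves P x P" for x using normalizer_iff[OF P(1)] by (simp add: grp_def)
  have mG: "x \<otimes>\<^bsub>?G\<^esub> y = x \<cdot> y" and oG: "\<one>\<^bsub>?G\<^esub> = pone L" for x y by (auto simp: grp_def)
  have iG: "inv\<^bsub>?G\<^esub> x = pinv L x" if "moves P x P" for x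
    using grp_inv[OF NP] that normalizer_iff[OF P(1)] by blast
  \<comment> \<open>The normalizer of \<open>R\<close> in \<open>S\<close>, pulled back along
    \<open>f\<close>, so that the whole argument runs in the group
    \<open>pnormalizer L P\<close>.\<close>
  define B where "B = {m. moves P m P \<and> pconj L m f \<in> S}"
  have cB: "moves R (pconj L m f) R" "m \<in> conj_dom L f" "m \<cdot> f = f \<cdot> pconj L m f" if "moves P m P" for m
    using moves_conj[OF that f f] mult_eq_conj by auto
  have hom: "pconj L (m \<cdot> k) f = pconj L m f \<cdot> pconj L k f" if m: "moves P m P" and k: "moves P k P"
    for m k
  proof -
    note mk = moves_mult[OF m k]
    have "f \<cdot> pconj L (m \<cdot> k) f = m \<cdot> k \<cdot> f" using cB(3)[OF mk] by simp
    also have "\<dots> = m \<cdot> (f \<cdot> pconj L k f)" using moves_assoc[OF m k f] cB(3)[OF k] by simp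
    also have "\<dots> = f \<cdot> (pconj L m f \<cdot> pconj L k f)"
      using moves_assoc[OF m f cB(1)[OF k]] cB(3)[OF m] moves_assoc[OF f cB(1)[OF m] cB(1)[OF k]] by simp
    finally show ?thesis
      by (rule moves_left_inj[OF _ f cB(1)[OF mk] moves_mult[OF cB(1)[OF m] cB(1)[OF k]]])
  qed
  note S' = psubgroupD[OF S_psubgroup]
  have subB: "subgroup B ?G"
  proof (rule G.subgroupI)
    show "B \<subseteq> carrier ?G" using NG by (auto simp: B_def)
    show "B \<noteq> {}" using moves_one[OF P(1)] pconj_one[OF fc] one_S by (auto simp: B_def)
    show "inv\<^bsub>?G\<^esub> m \<in> B" if "m \<in> B" for m
      using that iG moves_inv pconj_inverse_elem(2)[OF cB(2)] S'(3) by (auto simp: B_def)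
    show "m \<otimes>\<^bsub>?G\<^esub> k \<in> B" if "m \<in> B" "k \<in> B" for m k
      using that moves_mult hom S'(5)[of "[_, _]"] by (auto simp: B_def mG)
  qed
  \<comment> \<open>Conjugation by \<open>f\<close> sends such an element into \<open>Th R\<close>
    and into \<open>S\<close>, hence to the identity.\<close>
  have NB: "Th P \<inter> B = {\<one>\<^bsub>?G\<^esub>}"
  proof -
    have "m = pone L" if m: "m \<in> Th P" "m \<in> B" for m
    proof -
      have t: "moves P m P" "pconj L m f \<in> S" using m by (auto simp: B_def)
      have "pconj L m f = pone L" using Theta_S[OF P(2) Theta_conj[OF f m(1)] t(2)] .
      then show ?thesis using inj_onD[OF pconj_inj, of m f "pone L"] cB(2)[OF t(1)] pconj_one[OF fc]
        by simp
    qed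
    moreover have "pone L \<in> B" using G.subgroupE(2)[OF subB] subgroup.one_closed[OF subB] oG by simp
    ultimately show ?thesis using Theta_one[OF P(1)] unfolding oG by blast
  qed
  have extS: "Sext P f \<subseteq> S" by (auto simp: Sext_def)
  obtain k where k: "card (Sext P f) = p ^ k" using card_object[OF p_prime Sext_psubgroup[OF f] extS]
    by blast
  have subA: "subgroup (Sext P f) ?G"
    using subgroup_grp_iff[OF NP] Sext_psubgroup[OF f] normalizer_iff[OF P(1)] by (auto simp: Sext_def)
  have fin: "finite (carrier ?G)" using finite_subset[OF psubgroupD(1)[OF NP] finite_carrier]
    by (simp add: grp_def)
  have AB: "\<exists>n\<in>Th P. \<exists>b\<in>B. s = n \<otimes>\<^bsub>?G\<^esub> b" if s: "s \<in> Sext P f" for s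
  proof -
    obtain b where b: "s \<in> S" "moves P s P" "b \<in> S" "moves R b R" and e: "eqv P (s \<cdot> f) (f \<cdot> b)"
      using s moves_unique[OF f] by (auto simp: Sext_def)
    note fi = moves_inv[OF f]
    \<comment> \<open>The element of \<open>B\<close> that \<open>f\<close> conjugates to
      \<open>b\<close>; modulo \<open>Th P\<close> it agrees with \<open>s\<close>.\<close>
    define m where "m = pconj L b (pinv L f)"
    have m: "moves P m P" "pconj L m f = b"
      using moves_conj(1,2)[OF b(4) fi fi] pconj_inv(2)[of b "pinv L f"] fc inv_inv by (auto simp: m_def)
    have mB: "m \<in> B" using m b by (simp add: B_def)
    have "f \<cdot> b = m \<cdot> f" using cB(3)[OF m(1)] m(2) by simp
    then have "eqv P (s \<cdot> f \<cdot> pinv L f) (m \<cdot> f \<cdot> pinv L f)"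
      using eqv_mult_right[OF e moves_mult[OF b(2) f] fi] by simp
    then have "eqv P s m" using moves_cancel_right[OF b(2) f] moves_cancel_right[OF m(1) f] by simp
    then obtain n where "n \<in> Th P" "s = n \<cdot> m" by (rule eqvE)
    then have "s = n \<otimes>\<^bsub>?G\<^esub> m" using mG by simp
    then show ?thesis using mB \<open>n \<in> Th P\<close> by blast
  qed
  obtain n where n: "n \<in> Th P" "\<And>a. a \<in> Sext P f \<Longrightarrow> inv\<^bsub>?G\<^esub> n \<otimes>\<^bsub>?G\<^esub> a \<otimes>\<^bsub>?G\<^esub> n \<in> B"
    using G.p_subgroup_conj_into_complement[OF p_prime fin Theta_normal[OF P(1)] Theta_card[OF P(1)]
      subA k subB NB AB]
    by metis
  have nt: "moves P n P" by (rule Theta_moves[OF P(1) n(1)])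
  define f' where "f' = n \<cdot> f"
  have e: "eqv P f' f" by (rule eqvI[OF f n(1) f'_def])
  have tf': "moves P f' R" using e f eqv_moves by blast
  have "s \<in> Sdom f'" if s: "s \<in> Sext P f" for s
  proof -
    have st: "moves P s P" "s \<in> S" using s by (auto simp: Sext_def)
    have "pconj L s n = inv\<^bsub>?G\<^esub> n \<otimes>\<^bsub>?G\<^esub> s \<otimes>\<^bsub>?G\<^esub> n"
      using moves_conj(3)[OF st(1) nt nt] iG[OF nt] mG by simp
    then have B: "pconj L s n \<in> B" using n(2)[OF s] by simp
    note sn = moves_conj(2)[OF st(1) nt nt]
    have "f' \<cdot> pconj L s f' = s \<cdot> f'" using mult_eq_conj[OF moves_conj(1)[OF st(1) tf' tf']] by simp
    also have "\<dots> = n \<cdot> pconj L s n \<cdot> f"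
      using moves_assoc[OF st(1) nt f] mult_eq_conj[OF moves_conj(1)[OF st(1) nt nt]]
        by (simp add: f'_def)
    also have "\<dots> = f' \<cdot> pconj L (pconj L s n) f"
      using moves_assoc[OF nt sn f] cB(3)[OF sn] moves_assoc[OF nt f cB(1)[OF sn]] by (simp add: f'_def)
    finally have "pconj L s f' = pconj L (pconj L s n) f"
      by (rule moves_left_inj[OF _ tf' moves_conj(2)[OF st(1) tf' tf'] cB(1)[OF sn]])
    also have "\<dots> \<in> S" using B by (simp add: B_def)
    finally show ?thesis using st moves_conj(1)[OF st(1) tf' tf'] by (simp add: Sdom_def)
  qed
  then show ?thesis using that e by blast
qed

text \<open>Taken for \<open>f\<close> itself and for another congruent \<open>h\<close>, this
  collects elements of both domains in the one group \<open>Sext P f\<close>, which a single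
  congruent element then conjugates into \<open>S\<close>.\<close>

lemma Sdom_in_Sext:
  assumes "eqv P h f" "moves P s P" "s \<in> Sdom h" shows "s \<in> Sext P f"
proof -
  obtain R where R: "moves P h R" "moves P f R" using eqv_moves_ex[OF assms(1)] by blast
  define b where "b = pconj L s h"
  have b: "b \<in> S" "moves R b R" "s \<in> S" using moves_conj(2)[OF assms(2) R(1) R(1)] assms(3)
    by (auto simp: b_def Sdom_def)
  have "eqv P (s \<cdot> f) (s \<cdot> h)" by (rule eqv_mult_left[OF eqv_sym[OF assms(1)] assms(2)])
  also have "s \<cdot> h = h \<cdot> b" using mult_eq_conj[OF moves_conj(1)[OF assms(2) R(1) R(1)]]
    by (simp add: b_def)
  finally have "eqv P (s \<cdot> f) (h \<cdot> b)" .
  then have "eqv P (s \<cdot> f) (f \<cdot> b)"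
    using eqv_trans eqv_mult_right[OF assms(1) R(1) b(2)] by blast
  then show ?thesis using b R assms(2) by (auto simp: Sext_def)
qed

text \<open>Induction downwards on the size of the overlap \<open>P\<close> of the two domains. If
  \<open>Sdom h\<close> is not contained in \<open>Sdom f\<close>, then \<open>P\<close> is proper
  in both, and its normalizer grows in each, by \<open>s\<close> and by \<open>s'\<close>. An
  element \<open>f'\<close> with \<open>Sext P f \<subseteq> Sdom f'\<close> bridges the two: its
  domain contains \<open>s\<close> and \<open>s'\<close>.\<close>

lemma maximal_Sdom:
  assumes f: "maximal f" and h: "sim h f" shows "Sdom h \<subseteq> Sdom f"
  using h
proof (induction "card S - card (Sdom f \<inter> Sdom h)" arbitrary: h rule: less_induct)
  case less
  show ?case
  proof (rule ccontr)
    assume n: "\<not> Sdom h \<subseteq> Sdom f"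
    define P where "P = Sdom f \<inter> Sdom h"
    have e: "eqv P h f" using sim_eqv[OF less.prems] by (simp add: P_def Int_commute)
    have P: "P \<in> \<Delta>" using eqv_object[OF e] .
    have c: "f \<in> carrier L" "h \<in> carrier L" using sim_carrier[OF less.prems] by auto
    \<comment> \<open>Equality would give \<open>Sdom f \<subseteq> Sdom h\<close>, and then
      maximality of \<open>f\<close> would make the domains equal.\<close>
    have "P \<noteq> Sdom f" using f less.prems n by (auto simp: maximal_def P_def)
    moreover have "P \<noteq> Sdom h" using n by (auto simp: P_def)
    ultimately obtain s s' where s: "s \<in> Sdom h" "s \<notin> P" "moves P s P"
      and s': "s' \<in> Sdom f" "s' \<notin> P" "moves P s' P"
      using normalizer_grows[OF p_prime P Sdom_psubgroup[OF c(1)] Sdom_subset]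
        normalizer_grows[OF p_prime P Sdom_psubgroup[OF c(2)] Sdom_subset]
          by (metis P_def Int_lower1 Int_lower2)
    obtain R where R: "moves P h R" "moves P f R" using eqv_moves_ex[OF e] by blast
    obtain f' where f': "eqv P f' f" "Sext P f \<subseteq> Sdom f'" using Sext_into_Sdom[OF R(2)] .
    have sX: "s \<in> Sext P f" "s' \<in> Sext P f"
      using Sdom_in_Sext[OF e s(3,1)] Sdom_in_Sext[OF eqv_refl[OF R(2)] s'(3,1)] by auto
    \<comment> \<open>Because of \<open>s'\<close>, the overlap of \<open>f'\<close> with
      \<open>f\<close> is larger than \<open>P\<close>. The induction hypothesis puts
      \<open>Sdom f'\<close> inside \<open>Sdom f\<close>, so \<open>s\<close> would lie in both
      domains, that is, in \<open>P\<close>.\<close>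
    have "P \<union> {s'} \<subseteq> Sdom f \<inter> Sdom f'" using s' sX f' eqv_subset[OF f'(1)] by auto
    then have "P \<subset> Sdom f \<inter> Sdom f'" using s' by blast
    moreover have fin: "finite (Sdom f \<inter> Sdom f')" using finite_subset[OF Sdom_subset finite_S] by blast
    ultimately have "card P < card (Sdom f \<inter> Sdom f')" by (rule psubset_card_mono[rotated])
    moreover have "card (Sdom f \<inter> Sdom f') \<le> card S"
      by (rule card_mono[OF finite_S]) (use Sdom_subset in blast)
    ultimately have "Sdom f' \<subseteq> Sdom f" using less.hyps[of f'] eqv_sim[OF f'(1)] by (simp add: P_def)
    then show False using s sX f' by (auto simp: P_def)
  qed
qed

text \<open>The element that \<open>Sext_into_Sdom\<close> constructs is congruent to
  \<open>h\<close>, so by \<open>maximal_Sdom\<close> its domain cannot leave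
  \<open>Sdom h\<close>.\<close>

lemma Sext_maximal: assumes "maximal h" shows "Sext (Sdom h) h \<subseteq> Sdom h"
proof -
  have "moves (Sdom h) h (pconj_set L (Sdom h) h)" using moves_Sdom Sdom_object maximal_carrier[OF assms]
    by blast
  then obtain f' where f': "eqv (Sdom h) f' h" "Sext (Sdom h) h \<subseteq> Sdom f'" by (rule Sext_into_Sdom)
  then show ?thesis using maximal_Sdom[OF assms eqv_sim] by blast
qed

end

section \<open>The quotient\<close>

context signalizer
begin

definition sim_class :: "'a \<Rightarrow> 'a set" where
  "sim_class f = {g. sim g f}"

abbreviation "\<rho> \<equiv> proj L N"
abbreviation "Lq \<equiv> quot L N"

lemma sim_class_mono: "sim g f \<Longrightarrow> Sdom g \<subseteq> Sdom f \<Longrightarrow> sim_class g \<subseteq> sim_class f"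
  using sim_trans_mid by (auto simp: sim_class_def)

text \<open>The domains of \<open>f\<close> and \<open>g\<close> both contain \<open>Sdom h\<close>,
  which therefore serves as the common object. This is why maximal cosets do not overlap.\<close>

lemma maximal_common:
  assumes "maximal f" "maximal g" "sim h f" "sim h g"
  shows "sim f g" "Sdom f = Sdom g" "sim_class f = sim_class g"
proof -
  show 1: "sim f g"
    using sim_trans[OF sim_sym[OF assms(3)] assms(4), of "Sdom h"]
      Sdom_object maximal_Sdom assms sim_carrier by blast
  show 2: "Sdom f = Sdom g" using maximal_Sdom[OF assms(1) sim_sym[OF 1]] maximal_Sdom[OF assms(2) 1]
    by blast
  show "sim_class f = sim_class g" using sim_class_mono[OF 1] sim_class_mono[OF sim_sym[OF 1]] 2 by blast
qed

lemma max_cosets_eq: "max_cosets L N = sim_class ` {f. maximal f}"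
proof -
  have pc: "pcoset L N ` carrier L = sim_class ` carrier L" using pcoset_eq by (simp add: sim_class_def)
  have 1: "sim_class f \<in> max_cosets L N" if f: "maximal f" for f
  proof -
    have "sim_class g' = sim_class f" if g': "g' \<in> carrier L" "sim_class f \<subseteq> sim_class g'" for g'
    proof -
      \<comment> \<open>The class of \<open>g'\<close> is squeezed between those of the maximal
        elements \<open>f\<close> and \<open>g\<close>, which coincide because \<open>f\<close> lies
        in both.\<close>
      obtain g where g: "maximal g" "sim g' g" "Sdom g' \<subseteq> Sdom g" using maximal_exists[OF g'(1)] .
      have 2: "sim_class g' \<subseteq> sim_class g" using sim_class_mono g by blast
      have "f \<in> sim_class f" using sim_refl[OF maximal_carrier[OF f]] by (simp add: sim_class_def)
      then have "sim f g" using g'(2) 2 by (auto simp: sim_class_def)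
      then have "sim_class f = sim_class g"
        using maximal_common(3)[OF f g(1) sim_refl[OF maximal_carrier[OF f]]] by blast
      then show ?thesis using 2 g'(2) by blast
    qed
    then show ?thesis using maximal_carrier[OF f] by (auto simp: max_cosets_def pc)
  qed
  have 2: "C \<in> sim_class ` {f. maximal f}" if C: "C \<in> max_cosets L N" for C
  proof -
    obtain g where g: "g \<in> carrier L" "C = sim_class g" using C by (auto simp: max_cosets_def pc)
    obtain f where f: "maximal f" "sim g f" "Sdom g \<subseteq> Sdom f" using maximal_exists[OF g(1)] .
    have "C \<subseteq> sim_class f" using sim_class_mono f g by blast
    then have "C = sim_class f" using C maximal_carrier[OF f(1)] by (auto simp: max_cosets_def pc)
    then show ?thesis using f by blast
  qed
  show ?thesis using 1 2 by blast
qed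

lemma proj_sim_class:
  assumes "maximal f" "sim g f" shows "\<rho> g = sim_class f"
  unfolding proj_def
proof (rule the_equality)
  show "sim_class f \<in> max_cosets L N \<and> g \<in> sim_class f" using assms
    by (auto simp: max_cosets_eq sim_class_def)
  show "C = sim_class f" if "C \<in> max_cosets L N \<and> g \<in> C" for C
    using that maximal_common(3)[OF _ assms(1) _ assms(2)] by (auto simp: max_cosets_eq sim_class_def)
qed

lemma proj_maximal: "maximal f \<Longrightarrow> \<rho> f = sim_class f"
  using proj_sim_class sim_refl maximal_carrier by blast

lemma proj_rep:
  assumes "g \<in> carrier L" obtains f where "maximal f" "\<rho> g = \<rho> f"
  using maximal_exists[OF assms] proj_sim_class proj_maximal by metis

lemma proj_sim: assumes "sim f g" shows "\<rho> f = \<rho> g"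
proof -
  obtain g' where g': "maximal g'" "sim g g'" "Sdom g \<subseteq> Sdom g'"
    using maximal_exists sim_carrier[OF assms] by blast
  then show ?thesis using proj_sim_class[OF g'(1)] sim_trans_mid[OF assms g'(2,3)] by metis
qed

text \<open>Two elements with the same image may lack a common object and so fail to be congruent.
  Against a maximal representative congruence does hold, and its domain is the larger one; this is
  how equations in the quotient are read back in \<open>L\<close>.\<close>

lemma proj_eq_maximal:
  assumes "maximal h" "g \<in> carrier L" "\<rho> g = \<rho> h" shows "sim g h" "Sdom g \<subseteq> Sdom h"
proof -
  obtain f where f: "maximal f" "sim g f" using maximal_exists[OF assms(2)] by blast
  then have "sim_class f = sim_class h" using proj_sim_class[OF f] proj_maximal[OF assms(1)] assms(3)
    by simp
  then show "sim g h" using f by (auto simp: sim_class_def)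
  then show "Sdom g \<subseteq> Sdom h" using maximal_Sdom assms(1) by blast
qed

lemma maximal_S: "s \<in> S \<Longrightarrow> maximal s"
  using psubgroupD(1)[OF S_psubgroup] Sdom_S Sdom_subset by (auto simp: maximal_def)

lemma card_Sdom_inv:
  assumes f: "f \<in> carrier L" shows "card (Sdom (pinv L f)) = card (Sdom f)"
proof -
  have *: "card (Sdom g) \<le> card (Sdom (pinv L g))" if g: "g \<in> carrier L" for g
  proof -
    have t: "moves (Sdom g) g (pconj_set L (Sdom g) g)" by (rule moves_Sdom[OF g Sdom_object[OF g]]) simp
    have "card (pconj_set L (Sdom g) g) = card (Sdom g)"
      by (rule card_pconj_set) (auto simp: Sdom_def)
    moreover have "pconj_set L (Sdom g) g \<subseteq> Sdom (pinv L g)"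
      by (rule moves_subset_Sdom[OF moves_inv[OF t]])
    ultimately show ?thesis using card_mono[OF finite_subset[OF Sdom_subset finite_S]] by metis
  qed
  show ?thesis using *[OF f] *[OF inv_closed[OF f]] inv_inv[OF f] by simp
qed

lemma sim_inv: assumes "sim f g" shows "sim (pinv L f) (pinv L g)"
proof -
  obtain P where "eqv P f g" using assms by (auto simp: sim_def)
  then show ?thesis using eqv_moves_ex eqv_inv eqv_sim by blast
qed

text \<open>Inversion respects congruence and preserves the sizes of domains, so a strictly larger
  domain for a class member of the inverse would give one for \<open>h\<close>. Needed because the
  word of a conjugation contains an inverse.\<close>

lemma maximal_inv: assumes h: "maximal h" shows "maximal (pinv L h)"
proof -
  have c: "h \<in> carrier L" using maximal_carrier[OF h] .
  have "Sdom g = Sdom (pinv L h)" if g: "sim g (pinv L h)" "Sdom (pinv L h) \<subseteq> Sdom g" for g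
  proof -
    have gc: "g \<in> carrier L" using sim_carrier[OF g(1)] by blast
    have "sim (pinv L g) h" using sim_inv[OF g(1)] inv_inv[OF c] by simp
    then have "Sdom (pinv L g) \<subseteq> Sdom h" using maximal_Sdom[OF h] by blast
    then have "card (Sdom g) \<le> card (Sdom (pinv L h))"
      using card_mono[OF finite_subset[OF Sdom_subset finite_S]] card_Sdom_inv[OF gc] card_Sdom_inv[OF c]
        by metis
    then show ?thesis using card_seteq[OF finite_subset[OF Sdom_subset finite_S] g(2)] by simp
  qed
  then show ?thesis using inv_closed[OF c] by (simp add: maximal_def)
qed

lemma proj_inv_eq:
  assumes "f \<in> carrier L" "g \<in> carrier L" "\<rho> f = \<rho> g" shows "\<rho> (pinv L f) = \<rho> (pinv L g)"
proof -
  obtain h where h: "maximal h" "\<rho> f = \<rho> h" using proj_rep[OF assms(1)] .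
  then have "sim f h" "sim g h" using proj_eq_maximal assms by metis+
  then show ?thesis using proj_sim[OF sim_inv] by metis
qed

section \<open>Words of maximal representatives and the quotient operations\<close>

abbreviation "reps \<equiv> list_all2 (\<lambda>f h. maximal h \<and> \<rho> f = \<rho> h)"

text \<open>Each letter is congruent to its maximal representative over the object where it acts, so
  the replacement keeps every object of the chain and changes the product only within its class over
  \<open>P\<close>.\<close>

lemma path_maximal:
  assumes "path P w Q" "reps w v"
  shows "path P v Q \<and> eqv P (pprod L w) (pprod L v)"
  using assms
proof (induction w arbitrary: P v)
  case Nil
  then show ?case using eqv_refl[OF moves_one[of P]] by (auto simp: pone_def)
next
  case (Cons f w)
  then obtain R where R: "moves P f R" "path R w Q" by auto
  obtain h v' where v: "v = h # v'" "maximal h" "\<rho> f = \<rho> h" "reps w v'"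
    using Cons.prems(2) by (auto simp: list_all2_Cons1)
  have IH: "path R v' Q" "eqv R (pprod L w) (pprod L v')" using Cons.IH[OF R(2) v(4)] by auto
  have s: "sim f h" "Sdom f \<subseteq> Sdom h" using proj_eq_maximal[OF v(2) movesD(3)[OF R(1)] v(3)] by auto
  have e: "eqv P f h"
    using sim_eqv_sub[OF s(1) movesD(1)[OF R(1)]] moves_subset_Sdom[OF R(1)] s(2) by blast
  have h: "moves P h R" using R(1) e eqv_moves by blast
  have p: "path P v Q" using h IH v(1) by auto
  have "pprod L (f # w) = f \<cdot> pprod L w" "pprod L v = h \<cdot> pprod L v'"
    using prod_assoc[of "[f]" w "[]"] path_dom[OF Cons.prems(1)] prod_assoc[of "[h]" v' "[]"]
      path_dom[OF p] v(1)
    by simp_all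
  then show ?case using p eqv_mult[OF e R(1) IH(2)] by simp
qed

lemma maximal_word:
  assumes "set w \<subseteq> carrier L" obtains v where "reps w v"
  using assms
proof (induction w arbitrary: thesis)
  case (Cons f w)
  obtain v where "reps w v" using Cons by auto
  moreover obtain h where "maximal h" "\<rho> f = \<rho> h" using proj_rep[of f] Cons.prems by auto
  ultimately show ?case using Cons.prems(1)[of "h # v"] by simp
qed simp

text \<open>The chains of \<open>w\<close> and \<open>w'\<close> may have no object in common, so
  the two words are compared through one word of maximal representatives, which inherits both
  chains.\<close>

lemma proj_prod_eq:
  assumes "w \<in> pdom L" "w' \<in> pdom L" "map \<rho> w = map \<rho> w'"
  shows "\<rho> (pprod L w) = \<rho> (pprod L w')"
proof -
  obtain v where v: "reps w v" using maximal_word[OF dom_set[OF assms(1)]] .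
  have "reps w' v"
    using v assms(3) by (auto simp: list_all2_conv_all_nth list_eq_iff_nth_eq)
  note v' = this
  obtain P Q P' Q' where "path P w Q" "path P' w' Q'" using assms(1,2) dom_iff_path by metis
  then have "sim (pprod L w) (pprod L v)" "sim (pprod L w') (pprod L v)"
    using path_maximal[OF _ v] path_maximal[OF _ v'] eqv_sim by blast+
  then show ?thesis using proj_sim by metis
qed

lemma quot_carrier: "carrier Lq = \<rho> ` carrier L"
proof -
  have "carrier Lq = sim_class ` {f. maximal f}" by (simp add: quot_def max_cosets_eq)
  also have "\<dots> = \<rho> ` {f. maximal f}" using proj_maximal by auto
  also have "\<dots> = \<rho> ` carrier L"
  proof
    show "\<rho> ` {f. maximal f} \<subseteq> \<rho> ` carrier L" using maximal_carrier by blast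
    show "\<rho> ` carrier L \<subseteq> \<rho> ` {f. maximal f}"
    proof
      fix x assume "x \<in> \<rho> ` carrier L"
      then obtain g where g: "g \<in> carrier L" "x = \<rho> g" by blast
      obtain f where "maximal f" "\<rho> g = \<rho> f" using proj_rep[OF g(1)] .
      then show "x \<in> \<rho> ` {f. maximal f}" using g by simp
    qed
  qed
  finally show ?thesis .
qed

lemma quot_dom: "pdom Lq = map \<rho> ` pdom L"
  by (simp add: quot_def)

lemma quot_prod: "w \<in> pdom L \<Longrightarrow> pprod Lq (map \<rho> w) = \<rho> (pprod L w)"
  unfolding quot_def by (simp, rule the_equality) (use proj_prod_eq in blast)+

lemma quot_inv: "f \<in> carrier L \<Longrightarrow> pinv Lq (\<rho> f) = \<rho> (pinv L f)"
  unfolding quot_def by (simp, rule the_equality) (use proj_inv_eq in blast)+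

lemma quot_one: "pone Lq = \<rho> (pone L)"
  using quot_prod[OF dom_Nil] by (simp add: pone_def)

text \<open>A word of maximal elements inherits the chain of objects of any word in the domain with
  the same image.\<close>

lemma quot_maximal_dom:
  assumes "map \<rho> w \<in> pdom Lq" "\<And>f. f \<in> set w \<Longrightarrow> maximal f" shows "w \<in> pdom L"
proof -
  obtain w0 where w0: "w0 \<in> pdom L" "map \<rho> w = map \<rho> w0" using assms(1) by (auto simp: quot_dom)
  have "reps w0 w"
    using w0(2) assms(2) by (auto simp: list_all2_conv_all_nth list_eq_iff_nth_eq)
  note w = this
  obtain P Q where "path P w0 Q" using w0(1) dom_iff_path by metis
  from path_maximal[OF this w] show ?thesis using path_dom by blast
qed

lemma quot_word_inv: "set w \<subseteq> carrier L \<Longrightarrow> word_inv Lq (map \<rho> w) = map \<rho> (word_inv L w)"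
  by (induction w) (auto simp: word_inv_def quot_inv)

lemma quot_partial_group: "partial_group Lq"
proof
  show "carrier Lq \<noteq> {}" using nonempty by (simp add: quot_carrier)
  show "pdom Lq \<subseteq> lists (carrier Lq)" using dom_set by (fastforce simp: quot_dom quot_carrier)
  show "pprod Lq w \<in> carrier Lq" if "w \<in> pdom Lq" for w
    using that prod_closed by (auto simp: quot_dom quot_carrier quot_prod)
  show "pinv Lq x \<in> carrier Lq" "pinv Lq (pinv Lq x) = x" "[x] \<in> pdom Lq" "pprod Lq [x] = x"
    if x: "x \<in> carrier Lq" for x
  proof -
    obtain f where f: "f \<in> carrier L" "x = \<rho> f" using x by (auto simp: quot_carrier)
    then show "pinv Lq x \<in> carrier Lq" "pinv Lq (pinv Lq x) = x"
      using inv_closed inv_inv by (auto simp: quot_inv quot_carrier)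
    show "[x] \<in> pdom Lq" using imageI[OF dom_single[OF f(1)], of "map \<rho>"] f by (simp add: quot_dom)
    show "pprod Lq [x] = x" using quot_prod[OF dom_single[OF f(1)]] f prod_single by simp
  qed
  show "u \<in> pdom Lq \<and> v \<in> pdom Lq" if uv: "u @ v \<in> pdom Lq" for u v
  proof -
    obtain a b where "a @ b \<in> pdom L" "u = map \<rho> a" "v = map \<rho> b" using uv
      by (auto simp: quot_dom append_eq_map_conv)
    then show ?thesis using dom_append[of a b] by (simp add: quot_dom)
  qed
  show "u @ [pprod Lq v] @ w \<in> pdom Lq \<and> pprod Lq (u @ v @ w) = pprod Lq (u @ [pprod Lq v] @ w)"
    if uvw: "u @ v @ w \<in> pdom Lq" for u v w
  proof -
    obtain a b c where abc: "a @ b @ c \<in> pdom L" "u = map \<rho> a" "v = map \<rho> b" "w = map \<rho> c"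
      using uvw by (auto simp: quot_dom append_eq_map_conv)
    have b: "b \<in> pdom L" using abc(1) dom_append by blast
    have d: "a @ [pprod L b] @ c \<in> pdom L" "pprod L (a @ b @ c) = pprod L (a @ [pprod L b] @ c)"
      using prod_assoc[OF abc(1)] by auto
    have "u @ [pprod Lq v] @ w = map \<rho> (a @ [pprod L b] @ c)" using abc quot_prod[OF b] by simp
    moreover have "u @ v @ w = map \<rho> (a @ b @ c)" using abc by simp
    ultimately show ?thesis
      using quot_prod[OF abc(1)] quot_prod[OF d(1)] d(2) imageI[OF d(1), of "map \<rho>"]
        by (simp only: quot_dom)
  qed
  show "word_inv Lq w @ w \<in> pdom Lq \<and> pprod Lq (word_inv Lq w @ w) = pone Lq"
    if w: "w \<in> pdom Lq" for w
  proof -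
    obtain a where a: "a \<in> pdom L" "w = map \<rho> a" using w by (auto simp: quot_dom)
    have "word_inv Lq w @ w = map \<rho> (word_inv L a @ a)" using quot_word_inv[OF dom_set[OF a(1)]] a
      by simp
    moreover have d: "word_inv L a @ a \<in> pdom L" "pprod L (word_inv L a @ a) = pone L"
      using prod_word_inv[OF a(1)] by auto
    ultimately show ?thesis
      using quot_prod[OF d(1)] d(2) imageI[OF d(1), of "map \<rho>"] by (simp only: quot_dom quot_one)
  qed
qed

lemma quot_conj:
  assumes "x \<in> conj_dom L g"
  shows "\<rho> x \<in> conj_dom Lq (\<rho> g)" "pconj Lq (\<rho> x) (\<rho> g) = \<rho> (pconj L x g)"
proof -
  have c: "x \<in> carrier L" "g \<in> carrier L" "[pinv L g, x, g] \<in> pdom L" using conj_domD[OF assms] by auto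
  have e: "[pinv Lq (\<rho> g), \<rho> x, \<rho> g] = map \<rho> [pinv L g, x, g]" using quot_inv[OF c(2)] by simp
  show "\<rho> x \<in> conj_dom Lq (\<rho> g)"
    unfolding conj_dom_def mem_Collect_eq e quot_dom quot_carrier by (intro conjI imageI c)
  show "pconj Lq (\<rho> x) (\<rho> g) = \<rho> (pconj L x g)" unfolding pconj_def e using quot_prod[OF c(3)] .
qed

lemma quot_conj_set:
  assumes "P \<subseteq> conj_dom L g"
  shows "\<rho> ` P \<subseteq> conj_dom Lq (\<rho> g)" "pconj_set Lq (\<rho> ` P) (\<rho> g) = \<rho> ` pconj_set L P g"
proof -
  show "\<rho> ` P \<subseteq> conj_dom Lq (\<rho> g)" using quot_conj(1) assms by blast
  show "pconj_set Lq (\<rho> ` P) (\<rho> g) = \<rho> ` pconj_set L P g"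
    unfolding pconj_set_def image_image by (rule image_cong) (use quot_conj(2) assms in auto)
qed

text \<open>The element \<open>x\<^sup>-\<^sup>1 h y\<close> is congruent to \<open>h\<close>, so by maximality \<open>x\<close> normalizes \<open>S\<^sub>h\<close>; then \<open>h\<close>
  conjugates it into \<open>\<Theta>(R) N\<^sub>S(R)\<close> with \<open>R\<close> the conjugate of \<open>S\<^sub>h\<close>, and maximality applies again.\<close>

lemma quot_conj_lift:
  assumes h: "maximal h" and x: "x \<in> S" and y: "y \<in> S"
    and xh: "\<rho> x \<in> conj_dom Lq (\<rho> h)" "pconj Lq (\<rho> x) (\<rho> h) = \<rho> y"
  shows "x \<in> Sdom h" "pconj L x h = y"
proof -
  have c: "h \<in> carrier L" "x \<in> carrier L" "y \<in> carrier L" using maximal_carrier maximal_S h x y by auto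
  have "map \<rho> [pinv L h, x, h] \<in> pdom Lq" using xh(1) quot_inv[OF c(1)] by (simp add: conj_dom_def)
  then have w: "[pinv L h, x, h] \<in> pdom L"
    by (rule quot_maximal_dom) (use h x maximal_inv maximal_S in auto)
  have xd: "x \<in> conj_dom L h" using w by (rule conj_domI)
  define c' where "c' = pconj L x h"
  have c'c: "c' \<in> carrier L" using pconj_carrier[OF xd] by (simp add: c'_def)
  have "\<rho> c' = \<rho> y" using quot_conj(2)[OF xd] xh(2) by (simp add: c'_def)
  then have s: "sim c' y" using proj_eq_maximal(1)[OF maximal_S[OF y] c'c] by blast
  obtain A B C D where A: "moves A (pinv L h) B" "moves B x C" "moves C h D"
    using w dom_iff_path[of "[pinv L h, x, h]"] by auto
  have tc: "moves A c' D" using path_prod[OF path_ConsI[OF A(1) path_ConsI[OF A(2) path_oneI[OF A(3)]]]]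
    by (simp add: c'_def pconj_def)
  have "eqv A c' y"
    by (rule sim_eqv_sub[OF s movesD(1)[OF tc] moves_subset_Sdom[OF tc]]) (use Sdom_S[OF y]
      object_subset[OF movesD(1)[OF tc]] in simp)
  moreover have hB: "moves B h A" using moves_inv[OF A(1)] inv_inv[OF c(1)] by simp
  ultimately have e1: "eqv B (x \<cdot> h) (h \<cdot> y)"
    using eqv_mult_left mult_eq_conj[OF xd] by (metis c'_def)
  define g where "g = pinv L x \<cdot> (h \<cdot> y)"
  have "eqv C (pinv L x \<cdot> (x \<cdot> h)) g"
    using eqv_mult_left[OF e1 moves_inv[OF A(2)]] by (simp add: g_def)
  then have sg: "sim g h" using moves_cancel_left[OF A(2,3)] eqv_sim sim_sym by metis
  define U where "U = Sdom h"
  define V where "V = pconj_set L U h"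
  define W where "W = pconj_set L U x"
  have U: "U \<in> \<Delta>" using Sdom_object[OF c(1)] by (simp add: U_def)
  have Uh: "moves U h V" using moves_Sdom[OF c(1) U] by (simp add: U_def V_def)
  have Ux: "moves U x W" using moves_S[OF U x] by (simp add: W_def)
  obtain V' where Vy: "moves V y V'" using moves_S[OF movesD(2)[OF Uh] y] by blast
  have Wg: "moves W g V'" using moves_mult[OF moves_inv[OF Ux] moves_mult[OF Uh Vy]] by (simp add: g_def)
  \<comment> \<open>\<open>g\<close> carries \<open>W\<close> to an object, so \<open>W\<close> lies
    in \<open>Sdom g\<close>, which maximality of \<open>h\<close> places inside \<open>U\<close>.
    Equal sizes then make \<open>x\<close> normalize \<open>U\<close>.\<close>
  have "W \<subseteq> U" using moves_subset_Sdom[OF Wg] maximal_Sdom[OF h sg] by (simp add: U_def)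
  moreover have "card W = card U" unfolding W_def
    by (rule card_pconj_set) (use Ux in \<open>auto simp: moves_def\<close>)
  ultimately have WU: "W = U" using card_subset_eq[OF finite_object[OF U]] by blast
  have xU: "moves U x U" and gU: "moves U g V'" using Ux Wg WU by auto
  have eg: "eqv U g h" by (rule sim_eqv_sub[OF sg U moves_subset_Sdom[OF gU]]) (simp add: U_def)
  then have "V' = V" using gU Uh eqv_moves moves_unique by blast
  then have yV: "moves V y V" using Vy by simp
  have "x \<cdot> g = h \<cdot> y" using moves_cancel_left'[OF xU moves_mult[OF Uh yV]] by (simp add: g_def)
  then have "eqv U (x \<cdot> h) (h \<cdot> y)" using eqv_sym[OF eqv_mult_left[OF eg xU]] by simp
  then have "x \<in> Sext U h" using xU Uh yV x y by (auto simp: Sext_def)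
  then show "x \<in> Sdom h" using Sext_maximal[OF h] by (auto simp: U_def)
  \<comment> \<open>Only now is the conjugate known to lie in \<open>S\<close>, where congruence
    with \<open>y\<close> means equality.\<close>
  then show "pconj L x h = y" using sim_S[OF s] y by (simp add: c'_def Sdom_def)
qed

lemma proj_inj_S: "inj_on \<rho> S"
proof (rule inj_onI)
  fix s t assume st: "s \<in> S" "t \<in> S" "\<rho> s = \<rho> t"
  show "s = t"
    by (rule sim_S[OF proj_eq_maximal(1)[OF maximal_S[OF st(2)] maximal_carrier[OF maximal_S[OF st(1)]]
      st(3)] st(1,2)])
qed

lemma quot_conj_set_lift:
  assumes h: "maximal h" and P: "P \<in> \<Delta>" and Q: "Q \<subseteq> S"
    and Ph: "\<rho> ` P \<subseteq> conj_dom Lq (\<rho> h)" "pconj_set Lq (\<rho> ` P) (\<rho> h) = \<rho> ` Q"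
  shows "P \<subseteq> Sdom h" "pconj_set L P h = Q" "moves P h Q"
proof -
  have *: "x \<in> Sdom h \<and> pconj L x h \<in> Q" if x: "x \<in> P" for x
  proof -
    have "pconj Lq (\<rho> x) (\<rho> h) \<in> \<rho> ` Q" using Ph(2) x by (auto simp: pconj_set_def)
    then obtain y where y: "y \<in> Q" "pconj Lq (\<rho> x) (\<rho> h) = \<rho> y" by blast
    then show ?thesis using quot_conj_lift[OF h _ _ _ y(2)] x object_subset[OF P] Q Ph(1) by blast
  qed
  then show 1: "P \<subseteq> Sdom h" by blast
  then have d: "P \<subseteq> conj_dom L h" by (auto simp: Sdom_def)
  have "\<rho> ` pconj_set L P h = \<rho> ` Q" using quot_conj_set(2)[OF d] Ph(2) by simp
  moreover have "pconj_set L P h \<subseteq> S" using * Q by (auto simp: pconj_set_def)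
  ultimately show 2: "pconj_set L P h = Q" using inj_on_image_eq_iff[OF proj_inj_S _ Q] by simp
  show "moves P h Q" using moves_Sdom[OF maximal_carrier[OF h] P 1] 2 by simp
qed

section \<open>Subgroups and objects of the quotient\<close>

abbreviation "Sq \<equiv> \<rho> ` S"
abbreviation "\<Delta>q \<equiv> (`) \<rho> ` \<Delta>"

lemma quot_psubgroup:
  assumes "psubgroup L H" shows "psubgroup Lq (\<rho> ` H)"
proof -
  note H = psubgroupD[OF assms]
  have "u \<in> pdom Lq \<and> pprod Lq u \<in> \<rho> ` H" if u: "u \<in> map \<rho> ` lists H" for u
  proof -
    obtain w where w: "set w \<subseteq> H" "u = map \<rho> w" using u by auto
    then show ?thesis using H(4,5)[of w] quot_prod[of w] by (auto simp: quot_dom)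
  qed
  moreover have "pinv Lq x \<in> \<rho> ` H" if x: "x \<in> \<rho> ` H" for x
  proof -
    obtain h where h: "h \<in> H" "x = \<rho> h" using x by blast
    then have "pinv Lq x = \<rho> (pinv L h)" using quot_inv H(1) by blast
    then show ?thesis using H(3)[OF h(1)] by simp
  qed
  ultimately show ?thesis using H(1,2)
    by (auto simp: psubgroup_def partial_subgroup_def quot_carrier lists_image)
qed

lemma quot_mult: "[x, y] \<in> pdom L \<Longrightarrow> pprod Lq [\<rho> x, \<rho> y] = \<rho> (x \<cdot> y)"
  using quot_prod[of "[x, y]"] by simp

lemma quot_psubgroup_S:
  assumes H: "H \<subseteq> S" and Hq: "psubgroup Lq (\<rho> ` H)" shows "psubgroup L H"
proof (rule psubgroupI_sub[OF S_psubgroup H])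
  interpret q: partial_group Lq by (rule quot_partial_group)
  note Hq' = q.psubgroupD[OF Hq] and S' = psubgroupD[OF S_psubgroup]
  have mem: "x \<in> H" if "x \<in> S" "\<rho> x \<in> \<rho> ` H" for x
    using that H proj_inj_S by (metis inj_on_image_mem_iff)
  show "pone L \<in> H" using mem[OF one_S] Hq'(6) by (simp add: quot_one)
  show "pinv L x \<in> H" if x: "x \<in> H" for x
  proof (rule mem)
    show "pinv L x \<in> S" using S'(3) x H by blast
    have "pinv Lq (\<rho> x) = \<rho> (pinv L x)" using quot_inv x H S'(1) by blast
    then show "\<rho> (pinv L x) \<in> \<rho> ` H" using Hq'(3)[OF imageI[OF x]] by simp
  qed
  show "x \<cdot> y \<in> H" if x: "x \<in> H" "y \<in> H" for x y
  proof -
    have "set [x, y] \<subseteq> S" using x H by auto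
    note xy = this
    have "pprod Lq [\<rho> x, \<rho> y] = \<rho> (x \<cdot> y)" by (rule quot_mult[OF S'(4)[OF xy]])
    moreover have "pprod Lq [\<rho> x, \<rho> y] \<in> \<rho> ` H" by (rule Hq'(5)) (use x in simp)
    ultimately show ?thesis using mem[OF S'(5)[OF xy]] by simp
  qed
qed

lemma quot_subset_S: "R \<subseteq> Sq \<Longrightarrow> \<exists>H\<subseteq>S. R = \<rho> ` H"
  by (metis subset_image_iff)

lemma proj_iso_S: "\<rho> \<in> iso (grp L S) (grp Lq Sq)"
proof -
  have "\<rho> (x \<cdot> y) = pprod Lq [\<rho> x, \<rho> y]" if "x \<in> S" "y \<in> S" for x y
    using quot_mult psubgroupD(4)[OF S_psubgroup, of "[x, y]"] that by simp
  then show ?thesis using proj_inj_S by (auto simp: iso_def hom_def grp_def bij_betw_def)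
qed

lemma proj_hom: "psubgroup L H \<Longrightarrow> \<rho> \<in> hom (grp L H) (grp Lq (\<rho> ` H))"
  using quot_mult psubgroupD(4)[of H "[_, _]"] by (auto simp: hom_def grp_def)

text \<open>Being trivial in the quotient means lying in \<open>N\<close>, and an element of
  \<open>N\<close> that normalizes \<open>P\<close> already lies in \<open>Th P\<close> by
  \<open>N_moves\<close>.\<close>

lemma proj_one_iff: "P \<in> \<Delta> \<Longrightarrow> moves P f P \<Longrightarrow> \<rho> f = \<rho> (pone L) \<longleftrightarrow> f \<in> Th P"
proof
  assume "P \<in> \<Delta>" "moves P f P" "\<rho> f = \<rho> (pone L)"
  then have "f \<in> N" using proj_eq_maximal(1)[OF maximal_S[OF one_S]] movesD(3) N_sim_one by blast
  then show "f \<in> Th P" using N_moves \<open>moves P f P\<close> by blast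
next
  assume "P \<in> \<Delta>" "f \<in> Th P"
  then show "\<rho> f = \<rho> (pone L)" using Theta_eqv_one eqv_sim proj_sim by blast
qed

text \<open>For the converse direction each letter is represented by a maximal element, since for
  these a conjugation between images of objects lifts to an arrow between the objects
  themselves.\<close>

lemma quot_dom_iff:
  assumes u: "u \<in> lists (carrier Lq)"
  shows "u \<in> pdom Lq \<longleftrightarrow>
            (\<exists>Ps. length Ps = Suc (length u) \<and> set Ps \<subseteq> \<Delta>q \<and>
               (\<forall>i < length u. Ps ! i \<subseteq> conj_dom Lq (u ! i) \<and>
                  pconj_set Lq (Ps ! i) (u ! i) = Ps ! Suc i))" (is "_ \<longleftrightarrow> ?chain")
proof
  assume "u \<in> pdom Lq"
  then obtain w where w: "w \<in> pdom L" "u = map \<rho> w" by (auto simp: quot_dom)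
  then obtain Ps where Ps: "length Ps = Suc (length w)" "set Ps \<subseteq> \<Delta>"
    "\<forall>i < length w. Ps ! i \<subseteq> conj_dom L (w ! i) \<and> pconj_set L (Ps ! i) (w ! i) = Ps ! Suc i"
    using dom_iff[of w] dom_words by blast
  then show "?chain"
    using w(2) quot_conj_set by (intro exI[of _ "map ((`) \<rho>) Ps"]) auto
next
  assume "?chain"
  then obtain Ps where Ps: "length Ps = Suc (length u)" "set Ps \<subseteq> \<Delta>q"
    "\<forall>i < length u. Ps ! i \<subseteq> conj_dom Lq (u ! i) \<and> pconj_set Lq (Ps ! i) (u ! i) = Ps ! Suc i" by blast
  have "\<exists>Qs. set Qs \<subseteq> \<Delta> \<and> Ps = map ((`) \<rho>) Qs"
  proof -
    have "Ps \<in> lists \<Delta>q" using Ps(2) by auto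
    then show ?thesis by (auto simp: lists_image)
  qed
  then obtain Qs where Qs: "set Qs \<subseteq> \<Delta>" "Ps = map ((`) \<rho>) Qs" by blast
  obtain w0 where w0: "set w0 \<subseteq> carrier L" "u = map \<rho> w0"
    using u by (auto simp: quot_carrier lists_image)
  obtain w where "reps w0 w" using maximal_word[OF w0(1)] .
  then have w: "u = map \<rho> w" "\<And>i. i < length w \<Longrightarrow> maximal (w ! i)"
    using w0(2) by (auto simp: list_all2_conv_all_nth list_eq_iff_nth_eq)
  have "Qs ! i \<subseteq> conj_dom L (w ! i) \<and> pconj_set L (Qs ! i) (w ! i) = Qs ! Suc i" if i: "i < length w"
    for i
  proof -
    have len: "i < length Qs" "Suc i < length Qs" using i Ps(1) Qs(2) w(1) by auto
    have q: "Qs ! i \<in> \<Delta>" "Qs ! Suc i \<subseteq> S"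
      using len Qs(1) object_subset[OF subsetD[OF Qs(1) nth_mem[OF len(2)]]] by auto
    have "moves (Qs ! i) (w ! i) (Qs ! Suc i)"
      by (rule quot_conj_set_lift(3)[OF w(2)[OF i] q]) (use Ps(3)[rule_format, of i] i w(1) Qs(2)
        len in auto)
    then show ?thesis by (auto simp: moves_def)
  qed
  moreover have "w \<in> lists (carrier L)" using w(2) maximal_carrier
    by (auto simp: in_lists_conv_set in_set_conv_nth)
  moreover have "length Qs = Suc (length w)" using Ps(1) Qs(2) w(1) by simp
  ultimately have "w \<in> pdom L" using dom_iff[of w] Qs(1) by blast
  then show "u \<in> pdom Lq" using w(1) by (auto simp: quot_dom)
qed

end

section \<open>The quotient is a locality\<close>

context signalizer
begin

lemma quot_objects_conj:
  assumes h: "maximal h" and P: "P \<in> \<Delta>" and sub: "\<rho> ` P \<subseteq> conj_dom Lq (\<rho> h)"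
    "pconj_set Lq (\<rho> ` P) (\<rho> h) \<subseteq> Sq"
  shows "\<exists>Q\<in>\<Delta>. moves P h Q \<and> pconj_set Lq (\<rho> ` P) (\<rho> h) = \<rho> ` Q"
proof -
  obtain Q where Q: "Q \<subseteq> S" "pconj_set Lq (\<rho> ` P) (\<rho> h) = \<rho> ` Q" using quot_subset_S[OF sub(2)] by blast
  have "moves P h Q" by (rule quot_conj_set_lift(3)[OF h P Q(1) sub(1) Q(2)])
  then show ?thesis using Q(2) movesD(2) by blast
qed

lemma quot_S_p_subgroup: "p_subgroup p Lq Sq"
  using S_p_subgroup quot_psubgroup[OF S_psubgroup] card_image[OF proj_inj_S]
    by (simp add: p_subgroup_def)

lemma preimage_psubgroup:
  assumes H: "psubgroup L H" and T: "psubgroup Lq T"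
  shows "psubgroup L {h \<in> H. \<rho> h \<in> T}"
proof (rule psubgroupI_sub[OF H])
  interpret q: partial_group Lq by (rule quot_partial_group)
  note H' = psubgroupD[OF H] and T' = q.psubgroupD[OF T]
  show "pone L \<in> {h \<in> H. \<rho> h \<in> T}" using H'(6) T'(6) by (simp add: quot_one)
  show "pinv L x \<in> {h \<in> H. \<rho> h \<in> T}" if x: "x \<in> {h \<in> H. \<rho> h \<in> T}" for x
  proof -
    have "pinv Lq (\<rho> x) = \<rho> (pinv L x)" using quot_inv x H'(1) by blast
    then show ?thesis using x H'(3) T'(3)[of "\<rho> x"] by simp
  qed
  show "x \<cdot> y \<in> {h \<in> H. \<rho> h \<in> T}"
    if xy: "x \<in> {h \<in> H. \<rho> h \<in> T}" "y \<in> {h \<in> H. \<rho> h \<in> T}" for x y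
  proof -
    have "pprod Lq [\<rho> x, \<rho> y] = \<rho> (x \<cdot> y)" by (rule quot_mult[OF H'(4)]) (use xy in simp)
    then show ?thesis using xy H'(5)[of "[x, y]"] T'(5)[of "[\<rho> x, \<rho> y]"] by simp
  qed
qed auto

lemma card_eq_kernel_image:
  assumes P: "P \<in> \<Delta>" and X: "psubgroup L X" "X \<subseteq> pnormalizer L P" "Th P \<subseteq> X"
  shows "card X = card (\<rho> ` X) * card (Th P)"
proof -
  interpret q: partial_group Lq by (rule quot_partial_group)
  interpret h: group_hom "grp L X" "grp Lq (\<rho> ` X)" \<rho>
    using psubgroup_group[OF X(1)] q.psubgroup_group[OF quot_psubgroup[OF X(1)]] proj_hom[OF X(1)]
    by (simp add: group_hom_def group_hom_axioms_def)
  have "kernel (grp L X) (grp Lq (\<rho> ` X)) \<rho> = Th P"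
    using proj_one_iff[OF P] X normalizer_iff[OF P] by (auto simp: kernel_def grp_def quot_one)
  moreover have "\<rho> ` carrier (grp L X) = carrier (grp Lq (\<rho> ` X))" by (simp add: grp_def)
  ultimately have "(grp L X Mod Th P) \<cong> grp Lq (\<rho> ` X)" using h.FactGroup_iso by simp
  then have "card (carrier (grp L X Mod Th P)) = card (\<rho> ` X)"
    by (auto simp: is_iso_def iso_def grp_def dest: bij_betw_same_card)
  moreover have "subgroup (Th P) (grp L X)"
    using h.subgroup_kernel \<open>kernel (grp L X) (grp Lq (\<rho> ` X)) \<rho> = Th P\<close> by simp
  ultimately show ?thesis using group.lagrange[OF psubgroup_group[OF X(1)], of "Th P"]
    by (simp add: FactGroup_def order_def grp_def)
qed

text \<open>Maximality of \<open>S\<close> in \<open>L\<close> only controls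
  \<open>p\<close>-subgroups of \<open>L\<close>, so a \<open>p\<close>-subgroup has to be lifted
  from the quotient. The part of \<open>T\<close> normalizing \<open>Sq\<close> can be lifted
  through the normalizer of \<open>S\<close>, and that part is enough because normalizers grow in
  \<open>T\<close>.\<close>

lemma quot_S_maximal:
  assumes T: "p_subgroup p Lq T" and ST: "Sq \<subseteq> T" shows "T = Sq"
proof (rule ccontr)
  assume ne: "T \<noteq> Sq"
  interpret q: partial_group Lq by (rule quot_partial_group)
  have Tq: "psubgroup Lq T" and "\<exists>n. card T = p ^ n" using T by (auto simp: p_subgroup_def)
  then obtain n where n: "card T = p ^ n" by blast
  interpret GT: group "grp Lq T" by (rule q.psubgroup_group[OF Tq])
  have Sq: "psubgroup Lq Sq" by (rule quot_psubgroup[OF S_psubgroup])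
  note T' = q.psubgroupD[OF Tq]
  \<comment> \<open>The preimage of \<open>T\<close> in the normalizer of \<open>S\<close>; the aim
    is that its image is no more than \<open>Sq\<close>.\<close>
  define X where "X = {h \<in> pnormalizer L S. \<rho> h \<in> T}"
  note NS = normalizer_psubgroup[OF S_object]
  let ?G = "grp L (pnormalizer L S)"
  have X: "psubgroup L X" unfolding X_def by (rule preimage_psubgroup[OF NS Tq])
  have SX: "S \<subseteq> X" using moves_self[OF S_object] normalizer_iff[OF S_object] ST by (auto simp: X_def)
  have ThX: "Th S \<subseteq> X"
  proof
    fix m assume m: "m \<in> Th S"
    then have "moves S m S" by (rule Theta_moves[OF S_object])
    moreover have "\<rho> m = pone Lq" using proj_one_iff[OF S_object calculation] m by (simp add: quot_one)
    ultimately show "m \<in> X" using normalizer_iff[OF S_object] T'(6) by (simp add: X_def)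
  qed
  have XN: "X \<subseteq> pnormalizer L S" by (auto simp: X_def)
  have XT: "\<rho> ` X \<subseteq> T" by (auto simp: X_def)
  have "subgroup (\<rho> ` X) (grp Lq T)" using q.subgroup_grp_iff[OF Tq] quot_psubgroup[OF X] XT by blast
  then have "card (\<rho> ` X) dvd p ^ n" using GT.lagrange n
    by (metis dvd_triv_right order_def partial_object.select_convs(1) grp_def)
  then obtain a where a: "card (\<rho> ` X) = p ^ a" using divides_primepow_nat[OF p_prime] by blast
  have cX: "card X = p ^ a * card (Th S)" using card_eq_kernel_image[OF S_object X XN ThX] a by simp
  interpret GX: group "grp L X" by (rule psubgroup_group[OF X])
  have finX: "finite X" using finite_subset[OF psubgroupD(1)[OF X] finite_carrier] .
  \<comment> \<open>As \<open>p\<close> does not divide \<open>card (Th S)\<close>, a Sylow subgroup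
    of \<open>X\<close> is a complement to the kernel and maps bijectively onto the image of
    \<open>X\<close>.\<close>
  obtain Y where Y: "subgroup Y (grp L X)" "card Y = p ^ a"
    using sylow_thm[OF p_prime GX.is_group, of a "card (Th S)"] cX finX by (auto simp: order_def grp_def)
  have Yp: "psubgroup L Y" "Y \<subseteq> X" using subgroup_grp_iff[OF X] Y(1) by auto
  note Y' = psubgroupD[OF Yp(1)]
  have finY: "finite Y" using finite_subset[OF Yp(2) finX] .
  have Ytr: "moves S y S" if "y \<in> Y" for y using that Yp(2) XN normalizer_iff[OF S_object] by blast
  have kerY: "y = pone L" if y: "y \<in> Y" "y \<in> Th S" for y
  proof -
    have "psubgroup L (Th S)"
      using normal_imp_subgroup[OF Theta_normal[OF S_object]] subgroup_grp_iff[OF NS] by blast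
    moreover have "coprime (card Y) (card (Th S))"
      using Theta_card[OF S_object] p_prime Y(2) by (simp add: prime_imp_coprime)
    ultimately show ?thesis
      using coprime_Int_trivial[OF psubgroup_group[OF Yp(1)] psubgroup_group] y by blast
  qed
  have YN: "subgroup Y (?G)" using subgroup_grp_iff[OF NS] Yp XN by blast
  have injY: "inj_on \<rho> Y"
  proof (rule inj_onI)
    fix x y assume xy: "x \<in> Y" "y \<in> Y" "\<rho> x = \<rho> y"
    note xt = Ytr[OF xy(1)] and yt = Ytr[OF xy(2)]
    have d: "[x, pinv L y] \<in> pdom L" using moves_mult_dom[OF xt moves_inv[OF yt]] .
    have z: "x \<cdot> pinv L y \<in> Y" using Y'(5)[of "[x, pinv L y]"] xy Y'(3) by simp
    have "\<rho> (x \<cdot> pinv L y) = pprod Lq [\<rho> x, \<rho> (pinv L y)]" using quot_mult[OF d] by simp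
    also have "\<dots> = pprod Lq [\<rho> y, \<rho> (pinv L y)]" using xy by simp
    also have "\<dots> = \<rho> (pone L)" using quot_mult[OF dom_inv_right] inv_right movesD(3)[OF yt] by simp
    finally have "x \<cdot> pinv L y \<in> Th S" using proj_one_iff[OF S_object Ytr[OF z]] by simp
    then have "x \<cdot> pinv L y = y \<cdot> pinv L y" using kerY[OF z] inv_right movesD(3)[OF yt] by simp
    then show "x = y" by (rule moves_right_inj[OF _ xt yt moves_inv[OF yt]])
  qed
  have "\<rho> ` Y = \<rho> ` X"
    by (rule card_subset_eq) (use finX Yp(2) card_image[OF injY] Y(2) a in auto)
  note YX = this
  have YTh: "Th S \<inter> Y = {\<one>\<^bsub>?G\<^esub>}"
  proof -
    have "\<one>\<^bsub>?G\<^esub> = pone L" by (simp add: grp_def)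
    moreover have "y \<in> {pone L}" if "y \<in> Th S \<inter> Y" for y using kerY[of y] that by simp
    moreover have "pone L \<in> Th S \<inter> Y" using Theta_one[OF S_object] Y'(6) by simp
    ultimately show ?thesis by (metis empty_subsetI insert_subset subset_antisym subsetI)
  qed
  have dec: "\<exists>n\<in>Th S. \<exists>y\<in>Y. s = n \<otimes>\<^bsub>?G\<^esub> y" if s: "s \<in> S" for s
  proof -
    have "\<rho> s \<in> \<rho> ` Y" unfolding YX using s SX by blast
    then obtain y where y: "y \<in> Y" "\<rho> y = \<rho> s" by auto
    have "sim y s" by (rule proj_eq_maximal(1)[OF maximal_S[OF s] _ y(2)]) (use y Y'(1) in blast)
    \<comment> \<open>Both elements act on all of \<open>S\<close>, so they are congruent over
      \<open>S\<close> itself and differ by an element of \<open>Th S\<close>.\<close>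
    then have "eqv S s y"
      using sim_eqv_sub[OF sim_sym S_object] moves_subset_Sdom[OF Ytr[OF y(1)]] Sdom_S[OF s] by blast
    then obtain n where "n \<in> Th S" "s = n \<cdot> y" by (rule eqvE)
    then have "s = n \<otimes>\<^bsub>?G\<^esub> y" by (simp add: grp_def)
    with \<open>n \<in> Th S\<close> y(1) show ?thesis by blast
  qed
  interpret GN: group "?G" by (rule psubgroup_group[OF NS])
  have finN: "finite (carrier (?G))"
    using finite_subset[OF psubgroupD(1)[OF NS] finite_carrier] by (simp add: grp_def)
  obtain k where k: "card S = p ^ k" using card_object[OF p_prime S_psubgroup] by blast
  have SN: "subgroup S (?G)"
    using subgroup_grp_iff[OF NS] S_psubgroup SX XN by blast
  obtain m where m: "m \<in> Th S"
    "\<And>s. s \<in> S \<Longrightarrow> inv\<^bsub>?G\<^esub> m \<otimes>\<^bsub>?G\<^esub> s \<otimes>\<^bsub>?G\<^esub> m \<in> Y"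
    using GN.p_subgroup_conj_into_complement[OF p_prime finN Theta_normal[OF S_object]
      Theta_card[OF S_object]
        SN k YN YTh dec] by metis
  have "S \<subseteq> Y"
  proof
    fix s assume s: "s \<in> S"
    have mt: "moves S m S" by (rule Theta_moves[OF S_object m(1)])
    have "inv\<^bsub>?G\<^esub> m = pinv L m" using grp_inv[OF NS] mt normalizer_iff[OF S_object] by blast
    then have "pconj L s m \<in> Y" using m(2)[OF s] moves_conj(3)[OF moves_self[OF S_object s] mt mt]
      by (simp add: grp_def)
    \<comment> \<open>The conjugating element \<open>m\<close> centralizes \<open>S\<close>, so
      conjugation into \<open>Y\<close> is plain inclusion.\<close>
    then show "s \<in> Y" using Theta_pconj[OF m(1) s] by simp
  qed
  then have "Y = S" using S_maximal[of Y] Yp(1) Y(2) by (auto simp: p_subgroup_def)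
  then have XS: "\<rho> ` X = Sq" using YX by simp
  \<comment> \<open>If \<open>T\<close> were larger, some \<open>t\<close> outside \<open>Sq\<close>
    would normalize \<open>Sq\<close>; its lift lies in \<open>X\<close>, whose image has just been
    identified with \<open>Sq\<close>.\<close>
  have "subgroup Sq (grp Lq T)" using q.subgroup_grp_iff[OF Tq] Sq ST by blast
  then obtain t where t: "t \<in> carrier (grp Lq T)" "t \<notin> Sq"
    "\<And>h. h \<in> Sq \<Longrightarrow> t \<otimes>\<^bsub>grp Lq T\<^esub> h \<otimes>\<^bsub>grp Lq T\<^esub> inv\<^bsub>grp Lq T\<^esub> t \<in> Sq"
    using GT.p_group_normalizer_grows[OF p_prime, of n Sq] n ne by (auto simp: grp_def)
  have tT: "t \<in> T" using t(1) by (simp add: grp_def)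
  have tc: "t \<in> carrier Lq" using T'(1) tT by blast
  have uT: "pinv Lq t \<in> T" using T'(3)[OF tT] .
  \<comment> \<open>The inverse of \<open>t\<close> is lifted, because \<open>t\<close> normalizes
    \<open>Sq\<close> with the inverse on the right while \<open>pconj\<close> has it on the
    left.\<close>
  obtain g where g: "g \<in> carrier L" "pinv Lq t = \<rho> g" using q.inv_closed[OF tc]
    by (auto simp: quot_carrier)
  obtain h where h: "maximal h" "pinv Lq t = \<rho> h" using proj_rep[OF g(1)] g(2) by metis
  have conj: "y \<in> conj_dom Lq (\<rho> h)" "pconj Lq y (\<rho> h) \<in> Sq" if y: "y \<in> Sq" for y
  proof -
    have yT: "y \<in> T" using y ST by blast
    have i: "pinv Lq (\<rho> h) = t" using h(2) q.inv_inv[OF tc] by simp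
    show "y \<in> conj_dom Lq (\<rho> h)" by (rule q.conj_domI, rule T'(4)) (use yT tT uT h(2) i in simp)
    have "pconj Lq y (\<rho> h) = t \<otimes>\<^bsub>grp Lq T\<^esub> y \<otimes>\<^bsub>grp Lq T\<^esub> inv\<^bsub>grp Lq T\<^esub> t"
      using q.psubgroup_assoc(1)[OF Tq tT yT uT] q.grp_inv[OF Tq tT] i h(2)
        by (simp add: pconj_def grp_def)
    then show "pconj Lq y (\<rho> h) \<in> Sq" using t(3)[OF y] by simp
  qed
  have "\<rho> ` S \<subseteq> conj_dom Lq (\<rho> h)" "pconj_set Lq (\<rho> ` S) (\<rho> h) \<subseteq> Sq"
    using conj by (auto simp: pconj_set_def)
  then obtain Q where Q: "Q \<in> \<Delta>" "moves S h Q" using quot_objects_conj[OF h(1) S_object] by blast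
  have "card Q = card S" using Q(2) card_pconj_set[of S h] by (auto simp: moves_def)
  then have "Q = S" using card_subset_eq[OF finite_S object_subset[OF Q(1)]] by simp
  then have "h \<in> X" using Q(2) normalizer_iff[OF S_object] uT h(2) by (simp add: X_def)
  then have "pinv L h \<in> X" using psubgroupD(3)[OF X] by blast
  moreover have "\<rho> (pinv L h) = t"
    using quot_inv[OF maximal_carrier[OF h(1)]] h(2) q.inv_inv[OF tc] by simp
  ultimately have "t \<in> \<rho> ` X" by blast
  then show False using XS t(2) by simp
qed

lemma quot_locality: "locality p Lq \<Delta>q Sq"
proof -
  interpret q: partial_group Lq by (rule quot_partial_group)
  have obj: "\<exists>P\<in>\<Delta>. R = \<rho> ` P" if "R \<in> \<Delta>q" for R using that by blast
  show ?thesis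
  proof (unfold_locales)
    show "finite (carrier Lq)" using finite_carrier by (simp add: quot_carrier)
    show "p_subgroup p Lq Sq" by (rule quot_S_p_subgroup)
    show "\<Delta>q \<noteq> {}" using objects_nonempty by simp
    show "psubgroup Lq P \<and> P \<subseteq> Sq" if "P \<in> \<Delta>q" for P
      using obj[OF that] quot_psubgroup[OF object_psubgroup] image_mono[OF object_subset] by metis
    show "T = Sq" if "p_subgroup p Lq T" "Sq \<subseteq> T" for T using quot_S_maximal that .
    show "u \<in> pdom Lq \<longleftrightarrow> (\<exists>Ps. length Ps = Suc (length u) \<and> set Ps \<subseteq> \<Delta>q \<and>
               (\<forall>i < length u. Ps ! i \<subseteq> conj_dom Lq (u ! i) \<and>
                 pconj_set Lq (Ps ! i) (u ! i) = Ps ! Suc i))"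
      if "u \<in> lists (carrier Lq)" for u using quot_dom_iff[OF that] .
    show "R \<in> \<Delta>q" if PR: "P \<in> \<Delta>q" "psubgroup Lq R" "P \<subseteq> R" "R \<subseteq> Sq" for P R
    proof -
      obtain P0 where P0: "P0 \<in> \<Delta>" "P = \<rho> ` P0" using obj[OF PR(1)] by blast
      obtain R0 where R0: "R0 \<subseteq> S" "R = \<rho> ` R0" using quot_subset_S[OF PR(4)] by blast
      have "P0 \<subseteq> R0"
        using PR(3) P0(2) R0(2) inj_on_image_mem_iff[OF proj_inj_S _ R0(1)] object_subset[OF P0(1)]
          by blast
      then have "R0 \<in> \<Delta>" using objects_overgroups[OF P0(1) quot_psubgroup_S] R0 PR(2) by blast
      then show ?thesis using R0(2) by blast
    qed
    show "pconj_set Lq P g \<in> \<Delta>q"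
      if P: "P \<in> \<Delta>q" "g \<in> carrier Lq" "P \<subseteq> conj_dom Lq g" "psubgroup Lq (pconj_set Lq P g)"
        "pconj_set Lq P g \<subseteq> Sq" for P g
    proof -
      obtain P0 where P0: "P0 \<in> \<Delta>" "P = \<rho> ` P0" using obj[OF P(1)] by blast
      obtain g0 where "g0 \<in> carrier L" "g = \<rho> g0" using P(2) by (auto simp: quot_carrier)
      then obtain h where h: "maximal h" "g = \<rho> h" using proj_rep by metis
      show ?thesis using quot_objects_conj[OF h(1) P0(1)] P h(2) P0(2) by auto
    qed
  qed
qed

text \<open>The substantial inclusion is surjectivity: a maximal representative of an element
  normalizing the image of \<open>P\<close> normalizes \<open>P\<close> itself.\<close>

lemma quot_normalizer:
  assumes P: "P \<in> \<Delta>" shows "pnormalizer Lq (\<rho> ` P) = \<rho> ` pnormalizer L P"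
proof
  interpret q: locality p Lq \<Delta>q Sq by (rule quot_locality)
  show "\<rho> ` pnormalizer L P \<subseteq> pnormalizer Lq (\<rho> ` P)"
  proof
    fix x assume "x \<in> \<rho> ` pnormalizer L P"
    then obtain f where f: "moves P f P" "x = \<rho> f" using normalizer_iff[OF P] by auto
    then have "P \<subseteq> conj_dom L f" "pconj_set L P f = P" "f \<in> carrier L" by (auto simp: moves_def)
    then show "x \<in> pnormalizer Lq (\<rho> ` P)" using quot_conj_set[of P f] f(2)
      by (auto simp: pnormalizer_def quot_carrier)
  qed
  show "pnormalizer Lq (\<rho> ` P) \<subseteq> \<rho> ` pnormalizer L P"
  proof
    fix x assume x: "x \<in> pnormalizer Lq (\<rho> ` P)"
    then have "x \<in> \<rho> ` carrier L" by (simp add: pnormalizer_def quot_carrier)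
    then obtain h where h: "maximal h" "x = \<rho> h" using proj_rep by blast
    have "moves P h P"
      by (rule quot_conj_set_lift(3)[OF h(1) P object_subset[OF P]]) (use x h(2)
        in \<open>auto simp: pnormalizer_def\<close>)
    then show "x \<in> \<rho> ` pnormalizer L P" using h(2) normalizer_iff[OF P] by blast
  qed
qed

lemma normalizer_epi:
  assumes P: "P \<in> \<Delta>"
  defines "G \<equiv> grp L (pnormalizer L P)" and "Gq \<equiv> grp Lq (pnormalizer Lq (\<rho> ` P))"
  shows "\<rho> \<in> epi G Gq" "kernel G Gq \<rho> = Th P" "(\<lambda>X. the_elem (\<rho> ` X)) \<in> iso (G Mod Th P) Gq"
proof -
  interpret q: partial_group Lq by (rule quot_partial_group)
  note N = normalizer_psubgroup[OF P]
  have Gq: "Gq = grp Lq (\<rho> ` pnormalizer L P)" by (simp add: Gq_def quot_normalizer[OF P])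
  interpret h: group_hom G Gq \<rho>
    using psubgroup_group[OF N] q.psubgroup_group[OF quot_psubgroup[OF N]] proj_hom[OF N]
    by (simp add: group_hom_def group_hom_axioms_def G_def Gq)
  have im: "\<rho> ` carrier G = carrier Gq" by (simp add: G_def Gq grp_def)
  show "\<rho> \<in> epi G Gq" using h.homh im by (simp add: epi_def)
  show K: "kernel G Gq \<rho> = Th P"
    using proj_one_iff[OF P] Theta_moves[OF P] normalizer_iff[OF P]
      by (auto simp: kernel_def G_def Gq grp_def quot_one)
  show "(\<lambda>X. the_elem (\<rho> ` X)) \<in> iso (G Mod Th P) Gq" using h.FactGroup_iso_set[OF im] K by simp
qed

end

section \<open>Fusion systems\<close>

text \<open>Separates the generators from the partial group, as triples of source, target and map,
  so that transport along an isomorphism can be treated for plain groups.\<close>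

definition fusion_gen ::
    "'a monoid \<Rightarrow> ('a set \<times> 'a set \<times> ('a \<Rightarrow> 'a)) set \<Rightarrow> 'a set \<Rightarrow> 'a set \<Rightarrow> ('a \<Rightarrow> 'a) set" where
  "fusion_gen A G P Q = \<Inter> {F P Q | F. fusion_system A F \<and> (\<forall>(R, T, c) \<in> G. c \<in> F R T)}"

text \<open>\<open>transport\<close> with the inverse map as an explicit argument, so that the same
  operation also leads back.\<close>

definition carry :: "('a \<Rightarrow> 'b) \<Rightarrow> ('b \<Rightarrow> 'a) \<Rightarrow> 'a set \<Rightarrow> ('a \<Rightarrow> 'a) \<Rightarrow> 'b \<Rightarrow> 'b" where
  "carry r r' P \<phi> = restrict (\<lambda>y. r (\<phi> (r' y))) (r ` P)"

lemma fusion_gen_mem: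
  "\<phi> \<in> fusion_gen A G P Q \<longleftrightarrow> (\<forall>F. fusion_system A F \<and> (\<forall>(R, T, c) \<in> G. c \<in> F R T) \<longrightarrow> \<phi> \<in> F P Q)"
  by (auto simp: fusion_gen_def)

lemma fusion_systemD:
  assumes "fusion_system A F"
  shows "F P Q \<noteq> {} \<Longrightarrow> subgroup P A \<and> subgroup Q A"
    "\<phi> \<in> F P Q \<Longrightarrow> \<phi> \<in> extensional P \<inter> mon (A\<lparr>carrier := P\<rparr>) (A\<lparr>carrier := Q\<rparr>)"
    "x \<in> carrier A \<Longrightarrow> subgroup P A \<Longrightarrow> subgroup Q A \<Longrightarrow> (\<lambda>y. inv\<^bsub>A\<^esub> x \<otimes>\<^bsub>A\<^esub> y \<otimes>\<^bsub>A\<^esub> x) ` P \<subseteq> Q \<Longrightarrow>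
        restrict (\<lambda>y. inv\<^bsub>A\<^esub> x \<otimes>\<^bsub>A\<^esub> y \<otimes>\<^bsub>A\<^esub> x) P \<in> F P Q"
    "\<phi> \<in> F P Q \<Longrightarrow> \<psi> \<in> F Q R \<Longrightarrow> compose P \<psi> \<phi> \<in> F P R"
    "\<phi> \<in> F P Q \<Longrightarrow> \<phi> \<in> F P (\<phi> ` P)"
    "\<phi> \<in> F P Q \<Longrightarrow> restrict (inv_into P \<phi>) (\<phi> ` P) \<in> F (\<phi> ` P) P"
proof -
  note f = assms[unfolded fusion_system_def]
  note f1 = f[THEN conjunct1] and f2 = f[THEN conjunct2, THEN conjunct1]
    and f3 = f[THEN conjunct2, THEN conjunct2, THEN conjunct1]
    and f4 = f[THEN conjunct2, THEN conjunct2, THEN conjunct2, THEN conjunct1]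
    and f5 = f[THEN conjunct2, THEN conjunct2, THEN conjunct2, THEN conjunct2]
  show "F P Q \<noteq> {} \<Longrightarrow> subgroup P A \<and> subgroup Q A" using f1 by blast
  show "\<phi> \<in> F P Q \<Longrightarrow> \<phi> \<in> extensional P \<inter> mon (A\<lparr>carrier := P\<rparr>) (A\<lparr>carrier := Q\<rparr>)" using f2 by blast
  show "x \<in> carrier A \<Longrightarrow> subgroup P A \<Longrightarrow> subgroup Q A \<Longrightarrow> (\<lambda>y. inv\<^bsub>A\<^esub> x \<otimes>\<^bsub>A\<^esub> y \<otimes>\<^bsub>A\<^esub> x) ` P \<subseteq> Q \<Longrightarrow>
        restrict (\<lambda>y. inv\<^bsub>A\<^esub> x \<otimes>\<^bsub>A\<^esub> y \<otimes>\<^bsub>A\<^esub> x) P \<in> F P Q" by (rule f3[rule_format]) simp_all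
  show "\<phi> \<in> F P Q \<Longrightarrow> \<psi> \<in> F Q R \<Longrightarrow> compose P \<psi> \<phi> \<in> F P R" by (rule f4[rule_format])
  show "\<phi> \<in> F P Q \<Longrightarrow> \<phi> \<in> F P (\<phi> ` P)" "\<phi> \<in> F P Q \<Longrightarrow> restrict (inv_into P \<phi>) (\<phi> ` P) \<in> F (\<phi> ` P) P"
    using f5 by blast+
qed

lemma mon_subgroup_image:
  assumes A: "group A" and P: "subgroup P A" "subgroup Q A"
    and \<phi>: "\<phi> \<in> mon (A\<lparr>carrier := P\<rparr>) (A\<lparr>carrier := Q\<rparr>)"
  shows "subgroup (\<phi> ` P) A" "\<phi> ` P \<subseteq> Q" "inj_on \<phi> P"
    "\<And>x y. x \<in> P \<Longrightarrow> y \<in> P \<Longrightarrow> \<phi> (x \<otimes>\<^bsub>A\<^esub> y) = \<phi> x \<otimes>\<^bsub>A\<^esub> \<phi> y"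
proof -
  interpret A: group A by (fact A)
  interpret PA: group "A\<lparr>carrier := P\<rparr>" by (rule A.subgroup_imp_group[OF P(1)])
  interpret QA: group "A\<lparr>carrier := Q\<rparr>" by (rule A.subgroup_imp_group[OF P(2)])
  interpret h: group_hom "A\<lparr>carrier := P\<rparr>" "A\<lparr>carrier := Q\<rparr>" \<phi>
    using \<phi> by (simp add: group_hom_def group_hom_axioms_def mon_def PA.is_group QA.is_group)
  have "subgroup (\<phi> ` P) (A\<lparr>carrier := Q\<rparr>)" using h.img_is_subgroup by simp
  then show "subgroup (\<phi> ` P) A" using A.incl_subgroup[OF P(2)] by simp
  show "\<phi> ` P \<subseteq> Q" "inj_on \<phi> P" using \<phi> by (auto simp: mon_def hom_def)
  show "\<phi> (x \<otimes>\<^bsub>A\<^esub> y) = \<phi> x \<otimes>\<^bsub>A\<^esub> \<phi> y" if "x \<in> P" "y \<in> P" for x y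
    using h.hom_mult that by simp
qed

lemma fusion_system_memD:
  assumes F: "fusion_system A F" and A: "group A" and \<phi>: "\<phi> \<in> F P Q"
  shows "\<phi> \<in> extensional P" "\<phi> ` P \<subseteq> Q" "inj_on \<phi> P" "subgroup (\<phi> ` P) A" "P \<subseteq> carrier A" "Q \<subseteq> carrier A"
    "\<And>x y. x \<in> P \<Longrightarrow> y \<in> P \<Longrightarrow> \<phi> (x \<otimes>\<^bsub>A\<^esub> y) = \<phi> x \<otimes>\<^bsub>A\<^esub> \<phi> y"
proof -
  have PQ: "subgroup P A" "subgroup Q A" using fusion_systemD(1)[OF F, of P Q] \<phi> by auto
  have m: "\<phi> \<in> extensional P" "\<phi> \<in> mon (A\<lparr>carrier := P\<rparr>) (A\<lparr>carrier := Q\<rparr>)"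
    using fusion_systemD(2)[OF F \<phi>] by auto
  show "\<phi> \<in> extensional P" "P \<subseteq> carrier A" "Q \<subseteq> carrier A" using m PQ subgroup.subset by auto
  show "\<phi> ` P \<subseteq> Q" "inj_on \<phi> P" "subgroup (\<phi> ` P) A"
    "\<And>x y. x \<in> P \<Longrightarrow> y \<in> P \<Longrightarrow> \<phi> (x \<otimes>\<^bsub>A\<^esub> y) = \<phi> x \<otimes>\<^bsub>A\<^esub> \<phi> y"
    using mon_subgroup_image[OF A PQ m(2)] by auto
qed

lemma monI:
  assumes "\<phi> ` P \<subseteq> Q" "inj_on \<phi> P" "\<And>x y. x \<in> P \<Longrightarrow> y \<in> P \<Longrightarrow> \<phi> (x \<otimes>\<^bsub>A\<^esub> y) = \<phi> x \<otimes>\<^bsub>A\<^esub> \<phi> y"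
  shows "\<phi> \<in> mon (A\<lparr>carrier := P\<rparr>) (A\<lparr>carrier := Q\<rparr>)"
  using assms by (auto simp: mon_def hom_def)

text \<open>All injective homomorphisms between subgroups form the largest fusion system. Since
  \<open>fusion_gen\<close> is an intersection, properties of its members are read off from a system
  known to take part in it; this one yields that they are extensional and injective
  homomorphisms.\<close>

lemma fusion_system_universal:
  assumes A: "group A"
  defines "F \<equiv> (\<lambda>P Q. if subgroup P A \<and> subgroup Q A
      then extensional P \<inter> mon (A\<lparr>carrier := P\<rparr>) (A\<lparr>carrier := Q\<rparr>) else {})"
  shows "fusion_system A F"
proof -
  interpret A: group A by (fact A)
  let ?c = "\<lambda>x y. inv\<^bsub>A\<^esub> x \<otimes>\<^bsub>A\<^esub> y \<otimes>\<^bsub>A\<^esub> x"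
  have FI: "\<phi> \<in> F P Q" if "subgroup P A" "subgroup Q A" "\<phi> \<in> extensional P" "\<phi> ` P \<subseteq> Q" "inj_on \<phi> P"
      "\<And>x y. x \<in> P \<Longrightarrow> y \<in> P \<Longrightarrow> \<phi> (x \<otimes>\<^bsub>A\<^esub> y) = \<phi> x \<otimes>\<^bsub>A\<^esub> \<phi> y" for \<phi> P Q
    using that monI[of \<phi> P Q A] by (simp add: F_def)
  have FE: "subgroup P A" "subgroup Q A" "\<phi> \<in> extensional P" "\<phi> ` P \<subseteq> Q" "inj_on \<phi> P"
    "subgroup (\<phi> ` P) A"
      "\<And>x y. x \<in> P \<Longrightarrow> y \<in> P \<Longrightarrow> \<phi> (x \<otimes>\<^bsub>A\<^esub> y) = \<phi> x \<otimes>\<^bsub>A\<^esub> \<phi> y" if "\<phi> \<in> F P Q" for \<phi> P Q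
  proof -
    have 1: "subgroup P A" "subgroup Q A" "\<phi> \<in> extensional P"
      "\<phi> \<in> mon (A\<lparr>carrier := P\<rparr>) (A\<lparr>carrier := Q\<rparr>)"
      using that by (auto simp: F_def split: if_splits)
    then show "subgroup P A" "subgroup Q A" "\<phi> \<in> extensional P" by auto
    show "\<phi> ` P \<subseteq> Q" "inj_on \<phi> P" "subgroup (\<phi> ` P) A"
      "\<And>x y. x \<in> P \<Longrightarrow> y \<in> P \<Longrightarrow> \<phi> (x \<otimes>\<^bsub>A\<^esub> y) = \<phi> x \<otimes>\<^bsub>A\<^esub> \<phi> y"
      using mon_subgroup_image[OF A 1(1,2,4)] by auto
  qed
  show ?thesis
    unfolding fusion_system_def
  proof (intro conjI allI ballI impI)
    show "F P Q = {}" if "\<not> (subgroup P A \<and> subgroup Q A)" for P Q using that by (auto simp: F_def)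
    show "F P Q \<subseteq> extensional P \<inter> mon (A\<lparr>carrier := P\<rparr>) (A\<lparr>carrier := Q\<rparr>)" for P Q by (simp add: F_def)
    show "restrict (?c x) P \<in> F P Q"
      if x: "x \<in> carrier A" and PQ: "subgroup P A \<and> subgroup Q A \<and> ?c x ` P \<subseteq> Q" for P Q x
    proof (rule FI)
      have PA: "\<And>y. y \<in> P \<Longrightarrow> y \<in> carrier A" using PQ subgroup.subset by blast
      show "inj_on (restrict (?c x) P) P"
        by (rule inj_onI) (use PA x in simp)
      fix y z assume yz: "y \<in> P" "z \<in> P"
      have e: "x \<otimes>\<^bsub>A\<^esub> (inv\<^bsub>A\<^esub> x \<otimes>\<^bsub>A\<^esub> w) = w" if "w \<in> carrier A" for w using that x
        by (simp add: A.m_assoc[symmetric])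
      have "y \<otimes>\<^bsub>A\<^esub> z \<in> P" using yz PQ subgroup.m_closed by metis
      then show "restrict (?c x) P (y \<otimes>\<^bsub>A\<^esub> z) =
        restrict (?c x) P y \<otimes>\<^bsub>A\<^esub> restrict (?c x) P z"
        using yz PA[OF yz(1)] PA[OF yz(2)] x by (simp add: A.m_assoc e)
    qed (use PQ in auto)
    show "compose P \<psi> \<phi> \<in> F P R" if \<phi>: "\<phi> \<in> F P Q" and \<psi>: "\<psi> \<in> F Q R" for P Q R \<phi> \<psi>
    proof (rule FI)
      note f = FE[OF \<phi>] and g = FE[OF \<psi>]
      have fQ: "\<And>x. x \<in> P \<Longrightarrow> \<phi> x \<in> Q" using f(4) by blast
      show "compose P \<psi> \<phi> ` P \<subseteq> R" using fQ g(4) by (auto simp: compose_def)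
      show "inj_on (compose P \<psi> \<phi>) P"
        using comp_inj_on[OF f(5) inj_on_subset[OF g(5) f(4)]] by (simp add: compose_def inj_on_def)
      show "compose P \<psi> \<phi> (x \<otimes>\<^bsub>A\<^esub> y) = compose P \<psi> \<phi> x \<otimes>\<^bsub>A\<^esub> compose P \<psi> \<phi> y" if "x \<in> P" "y \<in> P" for x y
        using that f(7)[OF that] g(7)[OF fQ[OF that(1)] fQ[OF that(2)]] subgroup.m_closed[OF f(1) that]
        by (simp add: compose_def)
    qed (use FE[OF \<phi>] FE[OF \<psi>] in auto)
    fix P Q \<phi> assume \<phi>: "\<phi> \<in> F P Q"
    note f = FE[OF \<phi>]
    show "\<phi> \<in> F P (\<phi> ` P)" by (rule FI) (use f in auto)
    show "restrict (inv_into P \<phi>) (\<phi> ` P) \<in> F (\<phi> ` P) P"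
    proof (rule FI)
      fix u v assume "u \<in> \<phi> ` P" "v \<in> \<phi> ` P"
      then obtain x y where xy: "x \<in> P" "u = \<phi> x" "y \<in> P" "v = \<phi> y" by blast
      have m: "x \<otimes>\<^bsub>A\<^esub> y \<in> P" by (rule subgroup.m_closed[OF f(1) xy(1,3)])
      have "u \<otimes>\<^bsub>A\<^esub> v = \<phi> (x \<otimes>\<^bsub>A\<^esub> y)" using f(7) xy by simp
      then show "restrict (inv_into P \<phi>) (\<phi> ` P) (u \<otimes>\<^bsub>A\<^esub> v) =
        restrict (inv_into P \<phi>) (\<phi> ` P) u \<otimes>\<^bsub>A\<^esub> restrict (inv_into P \<phi>) (\<phi> ` P) v"
        using xy m inv_into_f_f[OF f(5)] by simp
    qed (use f in \<open>auto simp: inj_on_def intro: inv_into_into\<close>)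
  qed
qed

section \<open>Transport of fusion systems along an isomorphism\<close>

locale inverse_isos =
  fixes A :: "'a monoid" and B :: "'b monoid" and r r'
  assumes A: "group A" and B: "group B" and r_hom: "r \<in> hom A B" and r'_hom: "r' \<in> hom B A"
    and r'_r: "x \<in> carrier A \<Longrightarrow> r' (r x) = x" and r_r': "y \<in> carrier B \<Longrightarrow> r (r' y) = y"
begin

lemma swap: "inverse_isos B A r' r"
  by (rule inverse_isos.intro[OF B A r'_hom r_hom r_r' r'_r])

lemma image_image_r: "P \<subseteq> carrier A \<Longrightarrow> r' ` r ` P = P"
  using r'_r by (force simp: image_image)

lemma carry_carry:
  assumes "P \<subseteq> carrier A" "\<phi> \<in> extensional P" "\<phi> ` P \<subseteq> carrier A"
  shows "carry r' r (r ` P) (carry r r' P \<phi>) = \<phi>"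
proof
  fix x
  show "carry r' r (r ` P) (carry r r' P \<phi>) x = \<phi> x"
  proof (cases "x \<in> P")
    case True
    then have "x \<in> carrier A" "\<phi> x \<in> carrier A" using assms by auto
    then show ?thesis using True by (simp add: carry_def image_image_r[OF assms(1)] r'_r)
  next
    case False
    then show ?thesis using assms(2) by (simp add: carry_def image_image_r[OF assms(1)] extensional_def)
  qed
qed

lemma subgroup_image: "subgroup P A \<Longrightarrow> subgroup (r ` P) B"
proof -
  assume P: "subgroup P A"
  interpret h: group_hom A B r using A B r_hom by (simp add: group_hom_def group_hom_axioms_def)
  show ?thesis by (rule h.subgroup_img_is_subgroup[OF P])
qed

end

text \<open>The guard is needed because \<open>r'\<close> is arbitrary outside
  \<open>carrier B\<close>: a set that is no subgroup of \<open>B\<close> could still have a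
  subgroup of \<open>A\<close> as its image.\<close>

definition push_fusion :: "'a monoid \<Rightarrow> 'b monoid \<Rightarrow> ('a \<Rightarrow> 'b) \<Rightarrow> ('b \<Rightarrow> 'a) \<Rightarrow> ('a set \<Rightarrow> 'a set \<Rightarrow> ('a \<Rightarrow> 'a) set) \<Rightarrow>
    'b set \<Rightarrow> 'b set \<Rightarrow> ('b \<Rightarrow> 'b) set" where
  "push_fusion A B r r' F P Q = (if subgroup P B \<and>
    subgroup Q B then carry r r' (r' ` P) ` F (r' ` P) (r' ` Q) else {})"

context inverse_isos
begin

lemma fusion_system_push_fusion:
  assumes F: "fusion_system A F" shows "fusion_system B (push_fusion A B r r' F)"
proof -
  interpret A: group A by (fact A)
  interpret B: group B by (fact B)
  interpret sw: inverse_isos B A r' r by (rule swap)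
  note FD = fusion_systemD[OF F]
  have r: "\<And>x. x \<in> carrier A \<Longrightarrow> r x \<in> carrier B"
    "\<And>x y. x \<in> carrier A \<Longrightarrow> y \<in> carrier A \<Longrightarrow> r (x \<otimes>\<^bsub>A\<^esub> y) = r x \<otimes>\<^bsub>B\<^esub> r y"
    using r_hom by (auto simp: hom_def)
  have r': "\<And>x. x \<in> carrier B \<Longrightarrow> r' x \<in> carrier A"
    "\<And>x y. x \<in> carrier B \<Longrightarrow> y \<in> carrier B \<Longrightarrow> r' (x \<otimes>\<^bsub>B\<^esub> y) = r' x \<otimes>\<^bsub>A\<^esub> r' y"
    using r'_hom by (auto simp: hom_def)
  have inj_r: "\<And>x y. x \<in> carrier A \<Longrightarrow> y \<in> carrier A \<Longrightarrow> r x = r y \<Longrightarrow> x = y" using r'_r by metis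
  have inj_r': "\<And>x y. x \<in> carrier B \<Longrightarrow> y \<in> carrier B \<Longrightarrow> r' x = r' y \<Longrightarrow> x = y" using r_r' by metis
  note FE = fusion_system_memD[OF F A]
  let ?cA = "\<lambda>x y. inv\<^bsub>A\<^esub> x \<otimes>\<^bsub>A\<^esub> y \<otimes>\<^bsub>A\<^esub> x" and ?cB = "\<lambda>x y. inv\<^bsub>B\<^esub> x \<otimes>\<^bsub>B\<^esub> y \<otimes>\<^bsub>B\<^esub> x"
  let ?F = "push_fusion A B r r' F"
  have pE: "\<exists>\<phi>. f = carry r r' (r' ` P) \<phi> \<and> \<phi> \<in> F (r' ` P) (r' ` Q) \<and> subgroup P B \<and> subgroup Q B"
    if "f \<in> ?F P Q" for f P Q
    using that by (auto simp: push_fusion_def split: if_splits)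
  have pI: "carry r r' (r' ` P) \<phi> \<in> ?F P Q" if "\<phi> \<in> F (r' ` P) (r' ` Q)" "subgroup P B" "subgroup Q B"
    for \<phi> P Q
    using that by (simp add: push_fusion_def)
  \<comment> \<open>For \<open>P\<close> inside \<open>carrier B\<close> the formal source of the
    carried map, the image under \<open>r\<close> of the image of \<open>P\<close> under
    \<open>r'\<close>, is \<open>P\<close> again.\<close>
  have val: "carry r r' (r' ` P) \<phi> y = r (\<phi> (r' y))" if "subgroup P B" "y \<in> P" for P y \<phi>
    using that sw.image_image_r[OF subgroup.subset] by (simp add: carry_def)
  have ext: "carry r r' (r' ` P) \<phi> \<in> extensional P" if "subgroup P B" for P \<phi>
    using that sw.image_image_r[OF subgroup.subset] by (simp add: carry_def)
  have eqI: "f = carry r r' (r' ` P) \<phi>" if "subgroup P B" "f \<in> extensional P"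
    "\<And>y. y \<in> P \<Longrightarrow> f y = r (\<phi> (r' y))" for f P \<phi>
    by (rule extensionalityI[OF that(2) ext[OF that(1)]]) (simp add: val that)
  show ?thesis
    unfolding fusion_system_def
  proof (intro conjI allI ballI impI)
    show "?F P Q = {}" if "\<not> (subgroup P B \<and> subgroup Q B)" for P Q using that
      by (auto simp: push_fusion_def)
    show "?F P Q \<subseteq> extensional P \<inter> mon (B\<lparr>carrier := P\<rparr>) (B\<lparr>carrier := Q\<rparr>)" for P Q
    proof
      fix f assume "f \<in> ?F P Q"
      then obtain \<phi>
        where f: "f = carry r r' (r' ` P) \<phi>" "\<phi> \<in> F (r' ` P) (r' ` Q)" "subgroup P B" "subgroup Q B"
        using pE by blast
      note \<phi> = FE[OF f(2)]
      have PB: "\<And>y. y \<in> P \<Longrightarrow> y \<in> carrier B" using f(3) subgroup.subset by blast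
      have QB: "\<And>y. y \<in> Q \<Longrightarrow> y \<in> carrier B" using f(4) subgroup.subset by blast
      have im: "\<phi> (r' y) \<in> r' ` Q" "\<phi> (r' y) \<in> carrier A" if "y \<in> P" for y using \<phi>(2,6) that by auto
      have "f \<in> mon (B\<lparr>carrier := P\<rparr>) (B\<lparr>carrier := Q\<rparr>)"
      proof (rule monI)
        show "f ` P \<subseteq> Q"
        proof (clarify)
          fix y assume y: "y \<in> P"
          then obtain z where "z \<in> Q" "\<phi> (r' y) = r' z" using im(1) by blast
          then show "f y \<in> Q" using val[OF f(3) y] f(1) r_r' QB by simp
        qed
        show "inj_on f P"
        proof (rule inj_onI)
          fix x y assume xy: "x \<in> P" "y \<in> P" "f x = f y"
          then have "r (\<phi> (r' x)) = r (\<phi> (r' y))" using val[OF f(3) xy(1)] val[OF f(3) xy(2)] f(1)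
            by simp
          then have "\<phi> (r' x) = \<phi> (r' y)" by (rule inj_r[OF im(2)[OF xy(1)] im(2)[OF xy(2)]])
          then have "r' x = r' y" by (rule inj_onD[OF \<phi>(3)]) (use xy in auto)
          then show "x = y" by (rule inj_r'[OF PB[OF xy(1)] PB[OF xy(2)]])
        qed
        show "f (x \<otimes>\<^bsub>B\<^esub> y) = f x \<otimes>\<^bsub>B\<^esub> f y" if xy: "x \<in> P" "y \<in> P" for x y
        proof -
          have "x \<otimes>\<^bsub>B\<^esub> y \<in> P" by (rule subgroup.m_closed[OF f(3) xy])
          then show ?thesis using xy val[OF f(3)] f(1) r'(2) PB \<phi>(7) im(2) r(2) by simp
        qed
      qed
      then show "f \<in> extensional P \<inter> mon (B\<lparr>carrier := P\<rparr>) (B\<lparr>carrier := Q\<rparr>)" using ext f(1,3) by simp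
    qed
    show "restrict (?cB x) P \<in> ?F P Q"
      if x: "x \<in> carrier B" and PQ: "subgroup P B \<and> subgroup Q B \<and> ?cB x ` P \<subseteq> Q" for P Q x
    proof -
      interpret h: group_hom B A r' using A B r'_hom by (simp add: group_hom_def group_hom_axioms_def)
      have PB: "\<And>y. y \<in> P \<Longrightarrow> y \<in> carrier B" using PQ subgroup.subset by blast
      have c: "r' (?cB x y) = ?cA (r' x) (r' y)" if "y \<in> P" for y
        using x PB[OF that] by simp
      let ?c = "restrict (?cA (r' x)) (r' ` P)"
      have "?cA (r' x) ` r' ` P \<subseteq> r' ` Q"
      proof (clarify)
        fix y assume y: "y \<in> P"
        then have "?cB x y \<in> Q" using PQ by blast
        then show "?cA (r' x) (r' y) \<in> r' ` Q" using c[OF y] by (metis imageI)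
      qed
      then have "?c \<in> F (r' ` P) (r' ` Q)"
        by (intro FD(3)[OF r'(1)[OF x]] sw.subgroup_image) (use PQ in simp_all)
      moreover have "restrict (?cB x) P = carry r r' (r' ` P) ?c"
      proof (rule eqI)
        show "restrict (?cB x) P y = r (?c (r' y))" if y: "y \<in> P" for y
        proof -
          have "r (r' (?cB x y)) = ?cB x y"
            by (rule r_r') (use PB[OF y] x in simp)
          then show ?thesis using y unfolding c[OF y] by simp
        qed
      qed (use PQ in auto)
      ultimately show ?thesis using pI PQ by simp
    qed
    show "compose P g f \<in> ?F P R" if f: "f \<in> ?F P Q" and g: "g \<in> ?F Q R" for P Q R f g
    proof -
      obtain \<phi>
        where \<phi>: "f = carry r r' (r' ` P) \<phi>" "\<phi> \<in> F (r' ` P) (r' ` Q)" "subgroup P B" "subgroup Q B"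
        using pE[OF f] by blast
      obtain \<psi> where \<psi>: "g = carry r r' (r' ` Q) \<psi>" "\<psi> \<in> F (r' ` Q) (r' ` R)" "subgroup R B"
        using pE[OF g] by blast
      have QB: "\<And>y. y \<in> Q \<Longrightarrow> y \<in> carrier B" using \<phi>(4) subgroup.subset by blast
      have "compose P g f = carry r r' (r' ` P) (compose (r' ` P) \<psi> \<phi>)"
      proof (rule eqI[OF \<phi>(3)])
        fix y assume y: "y \<in> P"
        then obtain z where z: "z \<in> Q" "\<phi> (r' y) = r' z" using FE(2)[OF \<phi>(2)] by blast
        have "f y = z" using val[OF \<phi>(3) y] \<phi>(1) z r_r' QB by simp
        then show "compose P g f y = r (compose (r' ` P) \<psi> \<phi> (r' y))"
          using y z val[OF \<phi>(4) z(1)] \<psi>(1) by (simp add: compose_def)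
      qed simp
      then show ?thesis using pI[OF FD(4)[OF \<phi>(2) \<psi>(2)] \<phi>(3) \<psi>(3)] by simp
    qed
    fix P Q f assume f: "f \<in> ?F P Q"
    obtain \<phi> where \<phi>: "f = carry r r' (r' ` P) \<phi>" "\<phi> \<in> F (r' ` P) (r' ` Q)" "subgroup P B" "subgroup Q B"
      using pE[OF f] by blast
    note f' = FE[OF \<phi>(2)]
    have PB: "\<And>y. y \<in> P \<Longrightarrow> y \<in> carrier B" using \<phi>(3) subgroup.subset by blast
    have fP: "f ` P = r ` (\<phi> ` r' ` P)" using val[OF \<phi>(3)] \<phi>(1) by (force simp: image_image)
    have sA: "\<phi> ` r' ` P \<subseteq> carrier A" using f'(4) subgroup.subset by blast
    have sub: "subgroup (f ` P) B" unfolding fP by (rule subgroup_image[OF f'(4)])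
    have r'fP: "r' ` f ` P = \<phi> ` r' ` P" unfolding fP by (rule image_image_r[OF sA])
    show "f \<in> ?F P (f ` P)" using pI[OF _ \<phi>(3) sub] FD(5)[OF \<phi>(2)] \<phi>(1) r'fP by simp
    have "restrict (inv_into P f) (f ` P) = carry r r' (r' ` f ` P) (restrict (inv_into (r' ` P) \<phi>) (\<phi> ` r' ` P))"
    proof (rule eqI[OF sub])
      fix u assume u: "u \<in> f ` P"
      then obtain y where y: "y \<in> P" "u = f y" by blast
      have fy: "f y = r (\<phi> (r' y))" using val[OF \<phi>(3) y(1)] \<phi>(1) by simp
      have cA: "\<phi> (r' y) \<in> carrier A" using sA y by auto
      have injf: "inj_on f P"
      proof (rule inj_onI)
        fix a b assume ab: "a \<in> P" "b \<in> P" "f a = f b"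
        have c: "\<phi> (r' a) \<in> carrier A" "\<phi> (r' b) \<in> carrier A" using sA ab by auto
        have "r (\<phi> (r' a)) = r (\<phi> (r' b))" using val[OF \<phi>(3) ab(1)] val[OF \<phi>(3) ab(2)] \<phi>(1) ab(3) by simp
        then have "\<phi> (r' a) = \<phi> (r' b)" by (rule inj_r[OF c])
        then have "r' a = r' b" by (rule inj_onD[OF f'(3)]) (use ab in auto)
        then show "a = b" by (rule inj_r'[OF PB[OF ab(1)] PB[OF ab(2)]])
      qed
      have "inv_into P f u = y" using y inv_into_f_f[OF injf] by simp
      moreover have "r' u = \<phi> (r' y)" using y fy r'_r[OF cA] by simp
      moreover have "inv_into (r' ` P) \<phi> (\<phi> (r' y)) = r' y" using y inv_into_f_f[OF f'(3)] by simp
      ultimately show "restrict (inv_into P f) (f ` P) u = r (restrict (inv_into (r' ` P) \<phi>) (\<phi> ` r' ` P) (r' u))"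
        using u y r_r'[OF PB[OF y(1)]] by simp
    qed simp
    then show "restrict (inv_into P f) (f ` P) \<in> ?F (f ` P) P"
      using pI[OF _ sub \<phi>(3)] FD(6)[OF \<phi>(2)] r'fP by metis
  qed
qed

text \<open>Any fusion system on \<open>B\<close> containing \<open>G'\<close> is pulled back to one
  on \<open>A\<close> containing \<open>G\<close>. It contains \<open>\<phi>\<close> by definition
  of the generated system, and carrying forward again lands in the given system.\<close>

lemma carry_fusion_gen:
  assumes G: "\<And>R T c. (R, T, c) \<in> G \<Longrightarrow> subgroup R A \<and> subgroup T A \<and> c \<in> extensional R \<and> c ` R \<subseteq> T"
    and GG': "\<And>R T c. (R, T, c) \<in> G \<Longrightarrow> (r ` R, r ` T, carry r r' R c) \<in> G'"
    and P: "subgroup P A" and \<phi>: "\<phi> \<in> fusion_gen A G P Q"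
  shows "carry r r' P \<phi> \<in> fusion_gen B G' (r ` P) (r ` Q)"
  unfolding fusion_gen_mem
proof (intro allI impI)
  fix F assume F: "fusion_system B F \<and> (\<forall>(R, T, c) \<in> G'. c \<in> F R T)"
  interpret sw: inverse_isos B A r' r by (rule swap)
  have fs: "fusion_system A (push_fusion B A r' r F)" using sw.fusion_system_push_fusion F by blast
  have "c \<in> push_fusion B A r' r F R T" if RTc: "(R, T, c) \<in> G" for R T c
  proof -
    note g = G[OF RTc]
    have c: "carry r r' R c \<in> F (r ` R) (r ` T)" using GG'[OF RTc] F by blast
    have RA: "R \<subseteq> carrier A" "T \<subseteq> carrier A" using g subgroup.subset by blast+
    have "carry r' r (r ` R) (carry r r' R c) = c" by (rule carry_carry) (use g RA in auto)
    then have "c \<in> carry r' r (r ` R) ` F (r ` R) (r ` T)" using c by (metis imageI)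
    then show ?thesis using g by (simp add: push_fusion_def)
  qed
  then have "\<phi> \<in> push_fusion B A r' r F P Q" using \<phi> fs unfolding fusion_gen_mem by blast
  then obtain \<psi> where \<psi>: "\<psi> \<in> F (r ` P) (r ` Q)" "\<phi> = carry r' r (r ` P) \<psi>"
    by (auto simp: push_fusion_def split: if_splits)
  have s: "subgroup (r ` P) B" using subgroup_image[OF P] .
  have m: "\<psi> \<in> extensional (r ` P)" "\<psi> ` r ` P \<subseteq> carrier B"
    using fusion_system_memD(1,2,6)[OF conjunct1[OF F] B \<psi>(1)] by auto
  then have "carry r r' (r' ` r ` P) (carry r' r (r ` P) \<psi>) = \<psi>"
    by (intro sw.carry_carry[OF subgroup.subset[OF s] m(1)])
  then show "carry r r' P \<phi> \<in> F (r ` P) (r ` Q)" using \<psi> image_image_r[OF subgroup.subset[OF P]] by simp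
qed

text \<open>Both inclusions are instances of \<open>carry_fusion_gen\<close>, the second with the
  roles of \<open>A\<close> and \<open>B\<close> exchanged. What remains is that carrying back and
  forth is the identity.\<close>

lemma fusion_gen_eq:
  assumes G: "\<And>R T c. (R, T, c) \<in> G \<Longrightarrow> subgroup R A \<and> subgroup T A \<and> c \<in> extensional R \<and> c ` R \<subseteq> T"
    and G': "\<And>R T c. (R, T, c) \<in> G' \<Longrightarrow> subgroup R B \<and> subgroup T B \<and> c \<in> extensional R \<and>
          c \<in> mon (B\<lparr>carrier := R\<rparr>) (B\<lparr>carrier := T\<rparr>)"
    and GG': "\<And>R T c. (R, T, c) \<in> G \<Longrightarrow> (r ` R, r ` T, carry r r' R c) \<in> G'"
    and G'G: "\<And>R T c. (R, T, c) \<in> G' \<Longrightarrow> (r' ` R, r' ` T, carry r' r R c) \<in> G"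
    and P: "subgroup P A" "subgroup Q A"
  shows "fusion_gen B G' (r ` P) (r ` Q) = carry r r' P ` fusion_gen A G P Q"
proof
  show "carry r r' P ` fusion_gen A G P Q \<subseteq> fusion_gen B G' (r ` P) (r ` Q)"
    using carry_fusion_gen[OF G GG' P(1)] by blast
  show "fusion_gen B G' (r ` P) (r ` Q) \<subseteq> carry r r' P ` fusion_gen A G P Q"
  proof
    fix \<psi> assume \<psi>: "\<psi> \<in> fusion_gen B G' (r ` P) (r ` Q)"
    interpret sw: inverse_isos B A r' r by (rule swap)
    have sP: "subgroup (r ` P) B" using subgroup_image P by blast
    have g': "subgroup R B \<and> subgroup T B \<and> c \<in> extensional R \<and> c ` R \<subseteq> T" if "(R, T, c) \<in> G'" for R T c
      using G'[OF that] mon_subgroup_image(2)[OF B] by blast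
    have 1: "carry r' r (r ` P) \<psi> \<in> fusion_gen A G P Q"
      using sw.carry_fusion_gen[OF g' G'G sP \<psi>] image_image_r[OF subgroup.subset[OF P(1)]]
        image_image_r[OF subgroup.subset[OF P(2)]]
      by simp
    let ?U = "\<lambda>P Q. if subgroup P B \<and> subgroup Q B
      then extensional P \<inter> mon (B\<lparr>carrier := P\<rparr>) (B\<lparr>carrier := Q\<rparr>) else {}"
    \<comment> \<open>Carrying back and forth is the identity only on extensional maps with values
      in \<open>carrier B\<close>; membership in this system shows that \<open>\<psi>\<close> is
      one.\<close>
    have "fusion_system B ?U" by (rule fusion_system_universal[OF B])
    moreover have "\<forall>(R, T, c) \<in> G'. c \<in> ?U R T" using G' by auto
    ultimately have "\<psi> \<in> ?U (r ` P) (r ` Q)" using \<psi> unfolding fusion_gen_mem by blast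
    then have m: "subgroup (r ` Q) B" "\<psi> \<in> extensional (r ` P)"
      "\<psi> \<in> mon (B\<lparr>carrier := r ` P\<rparr>) (B\<lparr>carrier := r ` Q\<rparr>)"
      by (auto split: if_splits)
    have "\<psi> ` r ` P \<subseteq> carrier B" using mon_subgroup_image(2)[OF B sP m(1,3)] subgroup.subset[OF m(1)]
      by blast
    then have "carry r r' (r' ` r ` P) (carry r' r (r ` P) \<psi>) = \<psi>"
      by (intro sw.carry_carry[OF subgroup.subset[OF sP] m(2)])
    then have "\<psi> = carry r r' P (carry r' r (r ` P) \<psi>)" using image_image_r[OF subgroup.subset[OF P(1)]]
      by simp
    then show "\<psi> \<in> carry r r' P ` fusion_gen A G P Q" using 1 by blast
  qed
qed

end

section \<open>Generators of the fusion systems of a locality and its quotient\<close>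

definition conj_maps :: "'a pgroup \<Rightarrow> 'a set set \<Rightarrow> 'a set \<Rightarrow> ('a set \<times> 'a set \<times> ('a \<Rightarrow> 'a)) set" where
  "conj_maps L \<Delta> S = {(R, pconj_set L R g, restrict (\<lambda>x. pconj L x g) R) | R g.
     R \<in> \<Delta> \<and> g \<in> carrier L \<and> R \<subseteq> conj_dom L g \<and> psubgroup L (pconj_set L R g) \<and> pconj_set L R g \<subseteq> S}"

lemma conj_mapsI:
  assumes "R \<in> \<Delta>" "g \<in> carrier L" "R \<subseteq> conj_dom L g" "pconj_set L R g = T" "psubgroup L T" "T \<subseteq> S"
    "c = restrict (\<lambda>x. pconj L x g) R"
  shows "(R, T, c) \<in> conj_maps L \<Delta> S"
  using assms unfolding conj_maps_def by blast

lemma fusion_of_gen: "fusion_of L \<Delta> S = fusion_gen (grp L S) (conj_maps L \<Delta> S)"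
proof -
  have "(\<forall>(R, T, c)\<in>conj_maps L \<Delta> S. c \<in> F R T) \<longleftrightarrow>
    (\<forall>R\<in>\<Delta>. \<forall>g\<in>carrier L.
           R \<subseteq> conj_dom L g \<and> psubgroup L (pconj_set L R g) \<and> pconj_set L R g \<subseteq> S \<longrightarrow>
           restrict (\<lambda>x. pconj L x g) R \<in> F R (pconj_set L R g))" for F
    unfolding conj_maps_def by blast
  then show ?thesis by (intro ext) (simp add: fusion_of_def fusion_gen_def)
qed

text \<open>Conjugation by \<open>g\<close> is multiplicative on \<open>R\<close> because
  \<open>R\<close> lies in \<open>Sdom g\<close>.\<close>

lemma (in locality) conj_maps_wf:
  assumes "(R, T, c) \<in> conj_maps L \<Delta> S"
  shows "subgroup R (grp L S) \<and> subgroup T (grp L S) \<and> c \<in> extensional R \<and> c ` R \<subseteq> T \<and>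
    c \<in> mon (grp L S\<lparr>carrier := R\<rparr>) (grp L S\<lparr>carrier := T\<rparr>)"
proof -
  obtain g where g: "T = pconj_set L R g" "c = restrict (\<lambda>x. pconj L x g) R"
     "R \<in> \<Delta>" "g \<in> carrier L" "R \<subseteq> conj_dom L g" "psubgroup L (pconj_set L R g)" "pconj_set L R g \<subseteq> S"
    using assms by (auto simp: conj_maps_def)
  have R: "psubgroup L R" "R \<subseteq> S" using object_psubgroup[OF g(3)] object_subset[OF g(3)] by auto
  have 1: "subgroup R (grp L S)" "subgroup T (grp L S)" using subgroup_grp_iff[OF S_psubgroup] R g
    by auto
  have d: "R \<subseteq> Sdom g" using g R by (auto simp: Sdom_def pconj_set_def)
  have im: "c ` R \<subseteq> T" using g by (auto simp: pconj_set_def)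
  have "c \<in> mon (grp L S\<lparr>carrier := R\<rparr>) (grp L S\<lparr>carrier := T\<rparr>)"
  proof (rule monI[OF im])
    show "inj_on c R" unfolding g(2) by (simp add: inj_on_subset[OF pconj_inj g(5)])
    fix x y assume xy: "x \<in> R" "y \<in> R"
    then have "x \<cdot> y \<in> R" using psubgroupD(5)[OF R(1), of "[x, y]"] by simp
    then show "c (x \<otimes>\<^bsub>grp L S\<^esub> y) = c x \<otimes>\<^bsub>grp L S\<^esub> c y"
      using xy Sdom_mult(2)[of x g y] d by (auto simp: g(2) grp_def)
  qed
  then show ?thesis using 1 im g(2) by simp
qed

text \<open>The generators correspond under \<open>\<rho>\<close>: conjugation by \<open>g\<close>
  projects to conjugation by its image, and in the other direction a maximal representative of the
  conjugating element conjugates the objects in \<open>L\<close> in the same way.\<close>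

lemma (in signalizer) quot_fusion:
  assumes P: "subgroup P (grp L S)" "subgroup Q (grp L S)"
  shows "fusion_of Lq \<Delta>q Sq (\<rho> ` P) (\<rho> ` Q) = transport \<rho> S P ` fusion_of L \<Delta> S P Q"
proof -
  interpret q: locality p Lq \<Delta>q Sq by (rule quot_locality)
  let ?r' = "inv_into S \<rho>"
  have r'r: "?r' (\<rho> x) = x" if "x \<in> S" for x using inv_into_f_f[OF proj_inj_S that] .
  have r'im: "?r' ` \<rho> ` R = R" if "R \<subseteq> S" for R using inv_into_image_cancel[OF proj_inj_S that] .
  interpret iso: inverse_isos "grp L S" "grp Lq Sq" \<rho> ?r'
  proof (rule inverse_isos.intro)
    show "group (grp L S)" "group (grp Lq Sq)"
      using psubgroup_group[OF S_psubgroup] q.psubgroup_group[OF q.S_psubgroup] by auto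
    have mult: "pprod Lq [\<rho> x, \<rho> y] = \<rho> (x \<cdot> y)" "x \<cdot> y \<in> S" if "x \<in> S" "y \<in> S" for x y
      using quot_mult[of x y] psubgroupD(4,5)[OF S_psubgroup, of "[x, y]"] that by auto
    show "\<rho> \<in> hom (grp L S) (grp Lq Sq)" by (rule proj_hom[OF S_psubgroup])
    show "?r' \<in> hom (grp Lq Sq) (grp L S)" using mult r'r by (auto simp: hom_def grp_def)
  qed (auto simp: grp_def r'r)
  have "transport \<rho> S P = carry \<rho> ?r' P" by (intro ext) (simp add: transport_def carry_def)
  moreover have "fusion_gen (grp Lq Sq) (conj_maps Lq \<Delta>q Sq) (\<rho> ` P) (\<rho> ` Q) =
      carry \<rho> ?r' P ` fusion_gen (grp L S) (conj_maps L \<Delta> S) P Q"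
  proof (rule iso.fusion_gen_eq[OF _ _ _ _ P])
    show "subgroup R (grp L S) \<and> subgroup T (grp L S) \<and> c \<in> extensional R \<and> c ` R \<subseteq> T"
      if "(R, T, c) \<in> conj_maps L \<Delta> S" for R T c using conj_maps_wf[OF that] by blast
    show "subgroup R (grp Lq Sq) \<and> subgroup T (grp Lq Sq) \<and> c \<in> extensional R \<and>
        c \<in> mon (grp Lq Sq\<lparr>carrier := R\<rparr>) (grp Lq Sq\<lparr>carrier := T\<rparr>)"
      if "(R, T, c) \<in> conj_maps Lq \<Delta>q Sq" for R T c using q.conj_maps_wf[OF that] by blast
    show "(\<rho> ` R, \<rho> ` T, carry \<rho> ?r' R c) \<in> conj_maps Lq \<Delta>q Sq" if RTc: "(R, T, c) \<in> conj_maps L \<Delta> S"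
      for R T c
    proof -
      obtain g where g: "T = pconj_set L R g" "c = restrict (\<lambda>x. pconj L x g) R"
         "R \<in> \<Delta>" "g \<in> carrier L" "R \<subseteq> conj_dom L g" "psubgroup L (pconj_set L R g)" "pconj_set L R g \<subseteq> S"
        using RTc by (auto simp: conj_maps_def)
      have RS: "R \<subseteq> S" using object_subset[OF g(3)] .
      note cs = quot_conj_set[OF g(5)]
      have "carry \<rho> ?r' R c = restrict (\<lambda>x. pconj Lq x (\<rho> g)) (\<rho> ` R)"
        unfolding carry_def
      proof (rule restrict_ext)
        fix y assume "y \<in> \<rho> ` R"
        then obtain x where x: "x \<in> R" "y = \<rho> x" by blast
        then have "c (?r' y) = pconj L x g" using r'r[OF subsetD[OF RS x(1)]] g(2) by simp
        then show "\<rho> (c (?r' y)) = pconj Lq y (\<rho> g)" using quot_conj(2)[OF subsetD[OF g(5) x(1)]] x(2)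
          by simp
      qed
      moreover have "pconj_set Lq (\<rho> ` R) (\<rho> g) = \<rho> ` T" using cs(2) g(1) by simp
      moreover have "psubgroup Lq (\<rho> ` T)" "\<rho> ` T \<subseteq> Sq" using quot_psubgroup g(1,6,7) by auto
      moreover have "\<rho> g \<in> carrier Lq" using g(4) by (simp add: quot_carrier)
      ultimately show ?thesis using cs(1) imageI[OF g(3)] by (intro conj_mapsI)
    qed
    show "(?r' ` R, ?r' ` T, carry ?r' \<rho> R c) \<in> conj_maps L \<Delta> S" if RTc: "(R, T, c) \<in> conj_maps Lq \<Delta>q Sq"
      for R T c
    proof -
      obtain x where x: "T = pconj_set Lq R x" "c = restrict (\<lambda>y. pconj Lq y x) R"
         "R \<in> \<Delta>q" "x \<in> carrier Lq" "R \<subseteq> conj_dom Lq x" "pconj_set Lq R x \<subseteq> Sq"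
        using RTc by (auto simp: conj_maps_def)
      obtain R0 where R0: "R0 \<in> \<Delta>" "R = \<rho> ` R0" using x(3) by blast
      have R0S: "R0 \<subseteq> S" using object_subset[OF R0(1)] .
      obtain g0 where "g0 \<in> carrier L" "x = \<rho> g0" using x(4) by (auto simp: quot_carrier)
      \<comment> \<open>An arbitrary preimage of \<open>x\<close> may have too small a domain to act
        on \<open>R0\<close>; a maximal one contains \<open>R0\<close> in its domain.\<close>
      then obtain h where h: "maximal h" "x = \<rho> h" using proj_rep by metis
      obtain T0 where T0: "T0 \<in> \<Delta>" "moves R0 h T0" "pconj_set Lq R x = \<rho> ` T0"
        using quot_objects_conj[OF h(1) R0(1)] x(5,6) h(2) R0(2) by auto
      have d: "R0 \<subseteq> conj_dom L h" "pconj_set L R0 h = T0" "h \<in> carrier L" using T0(2)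
        by (auto simp: moves_def)
      have r'R: "?r' ` R = R0" using r'im[OF R0S] R0(2) by simp
      have r'T: "?r' ` T = T0" using r'im[OF object_subset[OF T0(1)]] T0(3) x(1) by simp
      have "carry ?r' \<rho> R c = restrict (\<lambda>x. pconj L x h) R0"
        unfolding carry_def r'R
      proof (rule restrict_ext)
        fix y assume y: "y \<in> R0"
        have "c (\<rho> y) = \<rho> (pconj L y h)" using y x(2) R0(2) h(2) quot_conj(2)[of y h] d(1) by auto
        moreover have "pconj L y h \<in> S" using movesD(5)[OF T0(2) y] object_subset[OF T0(1)] by blast
        ultimately show "?r' (c (\<rho> y)) = pconj L y h" using r'r by simp
      qed
      then show ?thesis
        unfolding r'R r'T
        by (intro conj_mapsI[OF R0(1) d(3,1,2) object_psubgroup[OF T0(1)] object_subset[OF T0(1)]])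
    qed
  qed
  ultimately show ?thesis by (simp add: fusion_of_gen)
qed

theorem theorem1p3:
  fixes p :: nat and L :: "'a pgroup" and \<Delta> :: "'a set set" and S :: "'a set"
    and \<theta> :: "'a \<Rightarrow> 'a set"
  assumes "prime p"
    and "punctured_group p L \<Delta> S"
    and "signalizer_functor p L S \<theta>"
  shows "let N = Theta_hat p L S \<theta>; \<rho> = proj L N; Lq = quot L N;
             Sq = \<rho> ` S; \<Delta>q = (`) \<rho> ` \<Delta>
         in partial_normal L N \<and>
            N \<inter> S = {pone L} \<and>
            \<rho> \<in> iso (grp L S) (grp Lq Sq) \<and>
            locality p Lq \<Delta>q Sq \<and>
            (\<forall>P Q. subgroup P (grp L S) \<and> subgroup Q (grp L S) \<longrightarrow>
               fusion_of Lq \<Delta>q Sq (\<rho> ` P) (\<rho> ` Q) =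
                 transport \<rho> S P ` fusion_of L \<Delta> S P Q) \<and>
            (\<forall>P \<in> \<Delta>.
               let G = grp L (pnormalizer L P); Gq = grp Lq (pnormalizer Lq (\<rho> ` P))
               in \<rho> \<in> epi G Gq \<and>
                  kernel G Gq \<rho> = Theta p L \<theta> P \<and>
                  (\<lambda>X. the_elem (\<rho> ` X)) \<in> iso (G Mod Theta p L \<theta> P) Gq)"
proof -
  have "locality p L \<Delta> S" and "\<Delta> = {P. psubgroup L P \<and> P \<subseteq> S \<and> P \<noteq> {pone L}}"
    using assms(2) unfolding punctured_group_def by blast+
  then interpret signalizer p L \<Delta> S \<theta>
    using assms(1,3) by (intro signalizer.intro signalizer_axioms.intro)
  show ?thesis
    unfolding Let_def
    using N_partial_normal N_Int_S proj_iso_S quot_locality quot_fusion normalizer_epi by blast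
qed

end
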